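(* For every integer $r\ge2$ and every integer $k\ge10^{18}\,r^{3}$, \[ D_{r,k}=\det\,[a_{k+j-i}]_{i,j=0}^{r-1}>0 . \]
   Context: Let $\Phi(u)=\sum_{n\ge1}\bigl(2\pi^2n^4e^{9u}-3\pi n^2e^{5u}\bigr)e^{-\pi n^2e^{4u}}$ for $u\ge0$ (so $\Phi>0$). For integers $k\ge0$ put $a_k=\frac1{(2k)!}\int_0^\infty u^{2k}\Phi(u)\,du>0$, and put $a_\ell=0$ for $\ell<0$. Equivalently, with $\xi(s)=\tfrac12 s(s-1)\pi^{-s/2}\Gamma(s/2)\zeta(s)$, one has $\tfrac18\,\xi\!\left(\tfrac12+\tfrac{ix}{2}\right)=\int_0^\infty\Phi(u)\cos(xu)\,du=\sum_{k\ge0}(-1)^k a_k x^{2k}$. For $r\ge1$, $k\ge0$, $D_{r,k}$ is the determinant of the $r\times r$ Toeplitz matrix with $(i,j)$ entry $a_{k+j-i}$, $0\le i,j\le r-1$. *)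

theory Defs
  imports "HOL-Analysis.Analysis" "Jordan_Normal_Form.Determinant"
begin

text \<open>The series over \<open>n \<ge> 1\<close> is reindexed by \<open>n = Suc m\<close>. Only the values at
  \<open>u \<ge> 0\<close> are used.\<close>

definition Phi :: "real \<Rightarrow> real" where
  "Phi u = (\<Sum>m. let n = real (Suc m) in
     (2 * pi ^ 2 * n ^ 4 * exp (9 * u) - 3 * pi * n ^ 2 * exp (5 * u))
       * exp (- (pi * n ^ 2 * exp (4 * u))))"

text \<open>The index is an integer because the Toeplitz matrix below refers to \<open>a\<^sub>\<ell>\<close> with
  \<open>\<ell> < 0\<close> when \<open>k < r - 1\<close>.\<close>

definition xi_coeff :: "int \<Rightarrow> real" where
  "xi_coeff l = (if l < 0 then 0
     else (LINT u:{0..}|lborel. u ^ (2 * nat l) * Phi u) / fact (2 * nat l))"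

text \<open>The names are qualified since \<^theory>\<open>HOL-Analysis.Determinants\<close> and its ancestors provide
  \<open>det\<close> and \<open>mat\<close> for type-indexed matrices; here the size \<open>r\<close> is a variable.\<close>

definition toeplitz_det :: "nat \<Rightarrow> nat \<Rightarrow> real" where
  "toeplitz_det r k =
     Determinant.det (Matrix.mat r r (\<lambda>(i, j). xi_coeff (int k + int j - int i)))"

end

theory Submission
  imports Defs "HOL-Complex_Analysis.Complex_Analysis" "Jordan_Normal_Form.Char_Poly"
begin

text \<open>Let \<open>D r k\<close> be the Toeplitz determinant of order \<open>r\<close>. The Desnanot-Jacobi identity
  \<open>D (r+1) k * D (r-1) k = (D r k)^2 - D r (k+1) * D r (k-1)\<close>
  reduces positivity in order \<open>r + 1\<close> to strict log-concavity of \<open>k \<mapsto> D r k\<close> in order \<open>r\<close>. If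
  \<open>exp (- h r k) = D r (k+1) * D r (k-1) / (D r k)^2\<close>, then the identity becomes a Toda recursion,
  \<open>h (r+1) = 2 h r - h (r-1) - \<Delta>\<^sup>2 (ln (1 - exp (- h r)))\<close>,
  with \<open>\<Delta>\<^sup>2\<close> the central second difference in \<open>k\<close>. Without the last term the solution is
  \<open>h r = r * h 1\<close>. The last term is small because \<open>h 1\<close> extends to a holomorphic function on a disc
  about \<open>k\<close> of radius proportional to \<open>k\<close>, where it stays close to \<open>2 / k\<close>: the logarithm is then a
  constant plus a bounded holomorphic function, and Cauchy's estimate on discs of radius
  proportional to \<open>k / r\<close> bounds its second difference by a multiple of \<open>(r / k)^2\<close>. Summed twice over
  the orders this perturbs \<open>h r\<close> by a multiple of \<open>r^4 / k^2\<close>, which is small against \<open>r / k\<close> as soon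
  as \<open>k\<close> exceeds a large multiple of \<open>r^3\<close>; this is where the cubic condition comes from. The argument
  is carried out in \<open>Toeplitz_pos_of_slowly_varying_curvature\<close>.

  It remains to control \<open>h 1\<close>, the second logarithmic difference of the coefficients
  (\<open>xi_curvature\<close>). The factor \<open>1 / (2 k)!\<close> contributes about \<open>2 / k\<close>. The moments contribute, with
  the opposite sign, the second difference with step 2 of the logarithm of
  \<open>M z = \<integral> u^z * Phi u du\<close> near \<open>z = 2 k\<close>, and this is shown to be less than \<open>1 / k\<close> in modulus on a
  complex disc. The substitution \<open>4 u = ln w\<close> turns \<open>M z\<close> into \<open>4^(-z-1) * N z\<close> with
  \<open>N z = \<integral> (ln w)^z * w^(5/4) * Q w * exp (- pi w) dw\<close> over \<open>w \<ge> 1\<close>, where \<open>Q\<close> is a rapidly convergent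
  series, bounded and with values close to the positive axis. Let \<open>s = 2 k\<close>. Two facts about \<open>N\<close> on the disc of radius \<open>s / 1000\<close> about \<open>s\<close>
  suffice.

  The first is that \<open>N\<close> has no zeros there (\<open>ray_integral_nonzero\<close>). By Cauchy's theorem the path of
  integration may be rotated about \<open>1\<close> until it passes through the saddle point, the solution of
  \<open>z = pi * w * ln w\<close>. On this ray minus the second derivative of the exponent lies in a narrow sector
  about the positive axis, so that the phase changes by at most a small multiple of the
  decay \<open>X\<close> of the logarithm of the modulus. Hence there is no cancellation except where \<open>exp (- X)\<close> is small,
  and convexity of \<open>X\<close> shows that the far part is harmless, uniformly in \<open>k\<close>.

  The second is the bound \<open>\<bar>N z\<bar> \<le> 40 * l^\<tau> * exp (51/50 * \<tau>^2 / (l * s)) * \<bar>N s\<bar>\<close>, where \<open>\<tau> = Re z - s\<close>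
  and \<open>l \<ge> 39\<close> is the logarithm of the real saddle point (\<open>ray_integral_upper\<close>). So the real part of \<open>ln N\<close>
  minus a linear function is bounded above by a small multiple of \<open>s\<close>. The Borel-Caratheodory inequality makes
  this a bound for the modulus, and Cauchy's formula bounds the second difference. The
  size of \<open>l\<close> is what pushes the resulting constant below that of the factorial.\<close>

section \<open>Cauchy estimates\<close>

text \<open>Cauchy's formula is applied at the three points at once: the three kernels add up to
  \<open>2 * d^2 / (x * (x^2 - d^2))\<close>, so that the estimate is quadratic in \<open>d\<close> with the constant that
  Cauchy's estimate gives for the second derivative.\<close>

lemma second_difference_bound:
  fixes f :: "complex \<Rightarrow> complex"
  assumes holf: "f holomorphic_on ball z R" and r: "norm d < r" "r < R"
    and B: "\<And>x. x \<in> ball z R \<Longrightarrow> norm (f x) \<le> B"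
  shows "norm (f (z + d) - 2 * f z + f (z - d)) \<le> 2 * (norm d)^2 * B / (r^2 - (norm d)^2)"
proof -
  have r0: "r > 0" using r norm_ge_zero[of d] by linarith
  have sub: "cball z r \<subseteq> ball z R" using r by auto
  have hol: "f holomorphic_on cball z r" using holf sub holomorphic_on_subset by blast
  have C: "((\<lambda>u. f u / (u - w)) has_contour_integral 2 * of_real pi * \<i> * f w) (circlepath z r)"
    if "w \<in> ball z r" for w
    using Cauchy_integral_circlepath_simple[OF hol, of w] that by (simp add: dist_norm norm_minus_commute)
  have ci: "((\<lambda>u. f u / (u - (z + d)) - 2 * (f u / (u - z)) + f u / (u - (z - d))) has_contour_integral
      2 * of_real pi * \<i> * f (z + d) - 2 * (2 * of_real pi * \<i> * f z) + 2 * of_real pi * \<i> * f (z - d))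
      (circlepath z r)"
    by (intro has_contour_integral_add has_contour_integral_diff has_contour_integral_lmul C)
       (use r r0 in \<open>auto simp: dist_norm\<close>)
  have d2: "(norm d)^2 < r^2" using r by (simp add: power_strict_mono)
  have "norm (f z) \<le> B" using B[of z] r r0 by simp
  hence B0: "0 \<le> B" using norm_ge_zero[of "f z"] by linarith
  have bd: "norm (f u / (u - (z + d)) - 2 * (f u / (u - z)) + f u / (u - (z - d)))
      \<le> 2 * (norm d)^2 * B / (r * (r^2 - (norm d)^2))" if u: "norm (u - z) = r" for u
  proof -
    define x where "x = u - z"
    have x: "norm x = r" using u x_def by simp
    have ne: "x \<noteq> 0" "x \<noteq> d" "x \<noteq> - d" using x r r0 by auto
    have ne': "x\<^sup>2 - d\<^sup>2 \<noteq> 0" using ne by (simp add: power2_eq_iff)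
    have "f u / (u - (z + d)) - 2 * (f u / (u - z)) + f u / (u - (z - d))
        = f u * (1 / (x - d) - 2 / x + 1 / (x + d))"
      by (simp add: x_def algebra_simps diff_diff_eq)
    also have "1 / (x - d) - 2 / x + 1 / (x + d) = 2 * d^2 / (x * (x^2 - d^2))"
    proof -
      have "x - d \<noteq> 0" "x + d \<noteq> 0" using ne by (auto simp: add_eq_0_iff)
      moreover have "x^2 - d^2 = (x - d) * (x + d)" by (simp add: power2_eq_square algebra_simps)
      ultimately show ?thesis using ne(1) by (simp add: divide_simps) (simp add: algebra_simps power2_eq_square)
    qed
    finally have e: "norm (f u / (u - (z + d)) - 2 * (f u / (u - z)) + f u / (u - (z - d)))
       = norm (f u) * (2 * (norm d)^2 / (r * norm (x^2 - d^2)))"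
      by (simp add: norm_mult norm_divide norm_power x)
    have "norm (x^2 - d^2) \<ge> r^2 - (norm d)^2"
      using norm_triangle_ineq2[of "x^2" "d^2"] by (simp add: norm_power x)
    moreover from this d2 have "norm (x^2 - d^2) > 0" by linarith
    ultimately have "2 * (norm d)^2 / (r * norm (x^2 - d^2)) \<le> 2 * (norm d)^2 / (r * (r^2 - (norm d)^2))"
      using d2 r0 by (intro divide_left_mono mult_left_mono mult_pos_pos) auto
    note kernel = this
    have fB: "norm (f u) \<le> B" using B[of u] u r by (simp add: dist_norm norm_minus_commute)
    have "norm (f u) * (2 * (norm d)^2 / (r * norm (x^2 - d^2))) \<le> B * (2 * (norm d)^2 / (r * (r^2 - (norm d)^2)))"
      by (rule mult_mono[OF fB kernel B0]) (use r0 in simp)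
    thus ?thesis unfolding e by (simp add: mult_ac)
  qed
  have "norm (2 * of_real pi * \<i> * f (z + d) - 2 * (2 * of_real pi * \<i> * f z) + 2 * of_real pi * \<i> * f (z - d))
    \<le> 2 * (norm d)^2 * B / (r * (r^2 - (norm d)^2)) * (2 * pi * r)"
    by (rule has_contour_integral_bound_circlepath[OF ci _ r0 bd])
       (use B0 d2 r0 r in \<open>auto intro!: divide_nonneg_nonneg mult_nonneg_nonneg\<close>)
  moreover have "2 * of_real pi * \<i> * f (z + d) - 2 * (2 * of_real pi * \<i> * f z) + 2 * of_real pi * \<i> * f (z - d)
     = 2 * of_real pi * \<i> * (f (z + d) - 2 * f z + f (z - d))" by (simp add: algebra_simps)
  moreover have "norm (2 * of_real pi * \<i> * (f (z + d) - 2 * f z + f (z - d))) = 2 * pi * norm (f (z + d) - 2 * f z + f (z - d))"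
    by (simp only: norm_mult) simp
  moreover have "2 * (norm d)^2 * B / (r * (r^2 - (norm d)^2)) * (2 * pi * r) = 2 * pi * (2 * (norm d)^2 * B / (r^2 - (norm d)^2))"
    using r0 by simp
  ultimately have "2 * pi * norm (f (z + d) - 2 * f z + f (z - d)) \<le> 2 * pi * (2 * (norm d)^2 * B / (r^2 - (norm d)^2))" by metis
  thus ?thesis by (subst (asm) mult_le_cancel_left_pos) (use pi_gt_zero in auto)
qed


text \<open>The map \<open>w \<mapsto> w / (2 * A - w)\<close> sends the half-plane \<open>Re w \<le> A\<close> into the closed unit disc and
  fixes \<open>0\<close>; Schwarz's lemma applies after the maximum principle has excluded the boundary.\<close>

lemma Borel_Caratheodory:
  fixes f :: "complex \<Rightarrow> complex"
  assumes holf: "f holomorphic_on ball a R" and f0: "f a = 0" and A: "A > 0"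
    and Re: "\<And>z. z \<in> ball a R \<Longrightarrow> Re (f z) \<le> A" and z: "norm (z - a) \<le> r" "r < R"
  shows "norm (f z) \<le> 2 * A * r / (R - r)"
proof -
  have R: "R > 0" "r \<ge> 0" using z norm_ge_zero[of "z - a"] by linarith+
  define g where "g = (\<lambda>u. f (a + of_real R * u) / (2 * of_real A - f (a + of_real R * u)))"
  have in_b: "a + of_real R * u \<in> ball a R" if "norm u < 1" for u
    using that R by (simp add: dist_norm norm_mult)
  have lt: "norm w \<le> norm (2 * of_real A - w) \<and> 2 * of_real A - w \<noteq> 0" if "Re w \<le> A" for w
  proof -
    have "(norm w)^2 \<le> (norm (2 * of_real A - w))^2" using that A
      by (simp add: cmod_power2) (simp add: power2_eq_square algebra_simps)
    hence 1: "norm w \<le> norm (2 * of_real A - w)" by (rule power2_le_imp_le) simp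
    have "Re (2 * of_real A - w) > 0" using that A by simp
    hence "2 * of_real A - w \<noteq> 0" by (metis less_irrefl zero_complex.sel(1))
    thus ?thesis using 1 by blast
  qed
  have hg: "g holomorphic_on ball 0 1" unfolding g_def
  proof (intro holomorphic_intros)
    have l: "(\<lambda>u. a + of_real R * u) holomorphic_on ball 0 1" by (intro holomorphic_intros)
    show "(\<lambda>u. f (a + of_real R * u)) holomorphic_on ball 0 1"
      using holomorphic_on_compose_gen[OF l holf] in_b by (auto simp: o_def image_subset_iff)
    thus "(\<lambda>u. f (a + of_real R * u)) holomorphic_on ball 0 1" .
  next
    fix u :: complex assume "u \<in> ball 0 1"
    thus "2 * of_real A - f (a + of_real R * u) \<noteq> 0" using lt[OF Re[OF in_b]] by simp
  qed
  have g0: "g 0 = 0" by (simp add: g_def f0)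
  have glt1: "norm (g u) \<le> 1" if "norm u < 1" for u
    using lt[OF Re[OF in_b[OF that]]] by (simp add: g_def norm_divide divide_le_eq)
  have g1: "norm (g u) < 1" if u: "norm u < 1" for u
  proof (cases "\<forall>v. norm v < 1 \<longrightarrow> norm (g v) < 1")
    case True thus ?thesis using u by blast
  next
    case False
    then obtain v where v: "norm v < 1" "norm (g v) = 1" using glt1 by (metis less_eq_real_def)
    have "g constant_on ball 0 1"
      by (rule maximum_modulus_principle[OF hg, of "ball 0 1" v]) (use v glt1 in \<open>auto\<close>)
    hence "g v = g 0" using v by (auto simp: constant_on_def)
    thus ?thesis using v g0 by simp
  qed
  define u where "u = (z - a) / of_real R"
  have u: "norm u \<le> r / R" "norm u < 1" using z R by (auto simp: u_def norm_divide divide_le_cancel divide_less_eq)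
  have zu: "z = a + of_real R * u" using R by (simp add: u_def)
  have "norm (g u) \<le> norm u" using Schwarz_Lemma(1)[OF hg g0 g1] u by simp
  hence gr: "norm (g u) \<le> r / R" using u by simp
  define q where "q = norm (g u)"
  have ne: "2 * of_real A - f z \<noteq> 0" using lt[OF Re] z R by (simp add: dist_norm norm_minus_commute)
  have "f z = g u * (2 * of_real A - f z)" using ne by (simp add: g_def zu[symmetric])
  hence "norm (f z) = q * norm (2 * of_real A - f z)" by (metis norm_mult q_def)
  also have "\<dots> \<le> q * (2 * A + norm (f z))"
    using norm_triangle_ineq4[of "2 * of_real A" "f z"] A by (intro mult_left_mono) (auto simp: q_def)
  also have "\<dots> \<le> r / R * (2 * A + norm (f z))" using gr A by (intro mult_right_mono) (auto simp: q_def add_nonneg_nonneg)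
  finally have "norm (f z) * R \<le> r * (2 * A + norm (f z))" using R by (simp add: field_simps)
  hence "norm (f z) * (R - r) \<le> 2 * A * r" by (simp add: algebra_simps)
  thus ?thesis using z by (simp add: pos_le_divide_eq)
qed

section \<open>The Desnanot-Jacobi identity for Toeplitz determinants\<close>

text \<open>An inner column is a unit vector; expansion along it removes its row and column and keeps the
  shape of the matrix.\<close>

lemma det_identity_two_columns:
  fixes x y :: "nat \<Rightarrow> 'a :: idom"
  shows "Determinant.det (Matrix.mat (m + 2) (m + 2) (\<lambda>(i, j). if j = 0 then x i else if j = m + 1 then y i else if i = j then 1 else 0))
    = x 0 * y (m + 1) - x (m + 1) * y 0"
proof (induction m arbitrary: x y)
  case 0
  let ?C = "Matrix.mat 2 2 (\<lambda>(i, j). if j = 0 then x i else if j = 1 then y i else if i = j then 1 else 0)"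
  have del: "mat_delete ?C i 0 \<in> carrier_mat 1 1" for i by (simp add: mat_delete_def)
  have "Determinant.det ?C = (\<Sum>i<2. ?C $$ (i, 0) * cofactor ?C i 0)"
    by (rule laplace_expansion_column) auto
  also have "\<dots> = x 0 * y 1 - x 1 * y 0"
    by (simp add: numeral_2_eq_2 cofactor_def det_single[OF del] mat_delete_def det_single)
  finally show ?case by (simp only: add_0)
next
  case (Suc m)
  let ?C = "Matrix.mat (Suc m + 2) (Suc m + 2) (\<lambda>(i, j). if j = 0 then x i else if j = Suc m + 1 then y i else if i = j then 1 else 0)"
  let ?s = "\<lambda>i::nat. if i < 1 then i else i + 1"
  have del: "mat_delete ?C 1 1 = Matrix.mat (m + 2) (m + 2)
      (\<lambda>(i, j). if j = 0 then x (?s i) else if j = m + 1 then y (?s i) else if i = j then 1 else 0)"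
    by (rule eq_matI) (auto simp: mat_delete_def)
  have "Determinant.det ?C = (\<Sum>i<Suc m + 2. ?C $$ (i, 1) * cofactor ?C i 1)"
    by (rule laplace_expansion_column) auto
  also have "\<dots> = (\<Sum>i<Suc m + 2. if i = 1 then cofactor ?C 1 1 else 0)"
    by (rule sum.cong) auto
  also have "\<dots> = Determinant.det (mat_delete ?C 1 1)" by (simp add: cofactor_def)
  also have "\<dots> = x 0 * y (Suc m + 1) - x (Suc m + 1) * y 0"
    unfolding del by (subst Suc.IH) auto
  finally show ?case .
qed

text \<open>This matrix is the product of \<open>A\<close> with the one above, when \<open>x\<close> and \<open>y\<close> are the outer columns of
  the adjugate of \<open>A\<close> and \<open>d = Determinant.det A\<close>.\<close>

lemma det_two_scaled_unit_columns:
  fixes A :: "'a :: idom mat"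
  assumes "A \<in> carrier_mat (m + 2) (m + 2)"
  shows "Determinant.det (Matrix.mat (m + 2) (m + 2) (\<lambda>(i, j). if j = 0 \<or> j = m + 1 then (if i = j then d else 0) else A $$ (i, j)))
    = d ^ 2 * Determinant.det (Matrix.mat m m (\<lambda>(i, j). A $$ (i + 1, j + 1)))"
proof -
  let ?E = "Matrix.mat (m + 2) (m + 2) (\<lambda>(i, j). if j = 0 \<or> j = m + 1 then (if i = j then d else 0) else A $$ (i, j))"
  let ?F = "Matrix.mat (m + 1) (m + 1) (\<lambda>(i, j). if j = m then (if i = j then d else 0) else A $$ (i + 1, j + 1))"
  have "Determinant.det ?E = (\<Sum>i<m + 2. ?E $$ (i, 0) * cofactor ?E i 0)"
    by (rule laplace_expansion_column) auto
  also have "\<dots> = (\<Sum>i<m + 2. if i = 0 then d * cofactor ?E 0 0 else 0)"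
    by (rule sum.cong) auto
  also have "\<dots> = d * Determinant.det (mat_delete ?E 0 0)" by (simp add: cofactor_def)
  also have "mat_delete ?E 0 0 = ?F" by (rule eq_matI) (auto simp: mat_delete_def)
  finally have 1: "Determinant.det ?E = d * Determinant.det ?F" .
  have "Determinant.det ?F = (\<Sum>i<m + 1. ?F $$ (i, m) * cofactor ?F i m)"
    by (rule laplace_expansion_column) auto
  also have "\<dots> = (\<Sum>i<m + 1. if i = m then d * cofactor ?F m m else 0)"
    by (rule sum.cong) auto
  also have "\<dots> = d * Determinant.det (mat_delete ?F m m)" by (simp add: cofactor_def flip: mult_2)
  also have "mat_delete ?F m m = Matrix.mat m m (\<lambda>(i, j). A $$ (i + 1, j + 1))"
    by (rule eq_matI) (auto simp: mat_delete_def)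
  finally have 2: "Determinant.det ?F = d * Determinant.det (Matrix.mat m m (\<lambda>(i, j). A $$ (i + 1, j + 1)))" .
  show ?thesis unfolding 1 2 by (simp add: power2_eq_square)
qed

text \<open>Jacobi's argument: \<open>A\<close> times the identity matrix with outer columns replaced by those of
  the adjugate has the outer columns of a scalar matrix. Taking determinants gives the identity multiplied
  by the determinant of \<open>A\<close>, which cancels.\<close>

lemma Desnanot_Jacobi_nonsingular:
  fixes A :: "'a :: idom mat"
  assumes A: "A \<in> carrier_mat (m + 2) (m + 2)" and nz: "Determinant.det A \<noteq> 0"
  shows "Determinant.det A * Determinant.det (Matrix.mat m m (\<lambda>(i, j). A $$ (i + 1, j + 1)))
    = Determinant.det (mat_delete A 0 0) * Determinant.det (mat_delete A (m + 1) (m + 1))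
      - Determinant.det (mat_delete A 0 (m + 1)) * Determinant.det (mat_delete A (m + 1) 0)"
proof -
  let ?adj = "adj_mat A"
  let ?C = "Matrix.mat (m + 2) (m + 2) (\<lambda>(i, j). if j = 0 then ?adj $$ (i, 0) else if j = m + 1 then ?adj $$ (i, m + 1) else if i = j then 1 else 0)"
  let ?E = "Matrix.mat (m + 2) (m + 2) (\<lambda>(i, j). if j = 0 \<or> j = m + 1 then (if i = j then Determinant.det A else 0) else A $$ (i, j))"
  have adj: "?adj \<in> carrier_mat (m + 2) (m + 2)" "A * ?adj = Determinant.det A \<cdot>\<^sub>m 1\<^sub>m (m + 2)"
    using adj_mat[OF A] by auto
  have colC: "Matrix.col ?C j = (if j = 0 \<or> j = m + 1 then Matrix.col ?adj j else unit_vec (m + 2) j)" if "j < m + 2" for j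
    using that adj by (intro eq_vecI) (auto simp: unit_vec_def)
  have "A * ?C = ?E"
  proof (rule eq_matI)
    fix i j assume ij: "i < dim_row ?E" "j < dim_col ?E"
    hence i: "i < m + 2" and j: "j < m + 2" by auto
    have e: "(A * ?C) $$ (i, j) = scalar_prod (Matrix.row A i) (Matrix.col ?C j)" using i j A by simp
    show "(A * ?C) $$ (i, j) = ?E $$ (i, j)"
    proof (cases "j = 0 \<or> j = m + 1")
      case True
      have "scalar_prod (Matrix.row A i) (Matrix.col ?adj j) = (A * ?adj) $$ (i, j)"
        using i j A adj(1) by (metis carrier_matD index_mult_mat(1))
      also have "\<dots> = (if i = j then Determinant.det A else 0)" unfolding adj(2) using i j by simp
      finally show ?thesis using True e colC[OF j] i j by simp
    next
      case False
      thus ?thesis using e colC[OF j] i j A by (simp add: Matrix.row_def)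
    qed
  qed (use A in auto)
  hence "Determinant.det A * Determinant.det ?C = Determinant.det ?E" using det_mult[OF A, of ?C] by simp
  also have "\<dots> = Determinant.det A ^ 2 * Determinant.det (Matrix.mat m m (\<lambda>(i, j). A $$ (i + 1, j + 1)))"
    by (rule det_two_scaled_unit_columns[OF A])
  finally have "Determinant.det ?C = Determinant.det A * Determinant.det (Matrix.mat m m (\<lambda>(i, j). A $$ (i + 1, j + 1)))"
    using nz by (simp add: power2_eq_square)
  moreover have "Determinant.det ?C = ?adj $$ (0, 0) * ?adj $$ (m + 1, m + 1) - ?adj $$ (m + 1, 0) * ?adj $$ (0, m + 1)"
    by (rule det_identity_two_columns)
  moreover have "?adj $$ (0, 0) = Determinant.det (mat_delete A 0 0)" "?adj $$ (m + 1, m + 1) = Determinant.det (mat_delete A (m + 1) (m + 1))"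
    "?adj $$ (m + 1, 0) * ?adj $$ (0, m + 1) = Determinant.det (mat_delete A 0 (m + 1)) * Determinant.det (mat_delete A (m + 1) 0)"
    using A by (simp_all add: adj_mat_def cofactor_def flip: mult_2 power_mult_distrib)
  ultimately show ?thesis by simp
qed

text \<open>The matrix \<open>X * 1 + A\<close> over the polynomial ring has a monic determinant, so the nonsingular case applies to it;
  evaluation at \<open>X = 0\<close> gives the identity for every \<open>A\<close>.\<close>

theorem Desnanot_Jacobi:
  fixes A :: "'a :: idom mat"
  assumes A: "A \<in> carrier_mat (m + 2) (m + 2)"
  shows "Determinant.det A * Determinant.det (Matrix.mat m m (\<lambda>(i, j). A $$ (i + 1, j + 1)))
    = Determinant.det (mat_delete A 0 0) * Determinant.det (mat_delete A (m + 1) (m + 1))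
      - Determinant.det (mat_delete A 0 (m + 1)) * Determinant.det (mat_delete A (m + 1) 0)"
proof -
  define P where "P = char_poly_matrix (- A)"
  have P: "P \<in> carrier_mat (m + 2) (m + 2)" using A by (simp add: P_def)
  have "monic (char_poly (- A))" using degree_monic_char_poly[of "- A" "m + 2"] A by simp
  hence nz: "Determinant.det P \<noteq> 0" unfolding P_def char_poly_def[symmetric] by auto
  have el: "poly (P $$ (i, j)) 0 = A $$ (i, j)" if "i < m + 2" "j < m + 2" for i j
    using that A by (auto simp: P_def char_poly_matrix_def)
  have m0: "map_mat (\<lambda>p. poly p 0) P = A"
    using P A el by (intro eq_matI) auto
  have md: "map_mat (\<lambda>p. poly p 0) (mat_delete P i j) = mat_delete A i j" if "i < m + 2" "j < m + 2" for i j
    using P A that by (intro eq_matI) (auto simp: mat_delete_def el)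
  have mi: "map_mat (\<lambda>p. poly p 0) (Matrix.mat m m (\<lambda>(i, j). P $$ (i + 1, j + 1))) = Matrix.mat m m (\<lambda>(i, j). A $$ (i + 1, j + 1))"
    by (intro eq_matI) (auto simp: el)
  have "poly (Determinant.det P * Determinant.det (Matrix.mat m m (\<lambda>(i, j). P $$ (i + 1, j + 1)))) 0
    = poly (Determinant.det (mat_delete P 0 0) * Determinant.det (mat_delete P (m + 1) (m + 1))
      - Determinant.det (mat_delete P 0 (m + 1)) * Determinant.det (mat_delete P (m + 1) 0)) 0"
    by (simp only: Desnanot_Jacobi_nonsingular[OF P nz])
  thus ?thesis
    by (simp add: poly_mult poly_diff comm_ring_hom.hom_det[OF poly_hom.comm_ring_hom_axioms, symmetric] m0 md mi mi[simplified])
qed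

definition Toeplitz :: "(int \<Rightarrow> 'a :: idom) \<Rightarrow> nat \<Rightarrow> int \<Rightarrow> 'a" where
  "Toeplitz a r m = Determinant.det (Matrix.mat r r (\<lambda>(i, j). a (m + int j - int i)))"

lemma Toeplitz_0 [simp]: "Toeplitz a 0 m = 1"
  by (simp add: Toeplitz_def)

lemma Toeplitz_1 [simp]: "Toeplitz a (Suc 0) m = a m"
  unfolding Toeplitz_def by (subst det_single) auto

lemma Toeplitz_condensation:
  "Toeplitz a (r + 2) m * Toeplitz a r m
    = (Toeplitz a (r + 1) m)^2 - Toeplitz a (r + 1) (m + 1) * Toeplitz a (r + 1) (m - 1)"
proof -
  let ?A = "Matrix.mat (r + 2) (r + 2) (\<lambda>(i, j). a (m + int j - int i))"
  have A: "?A \<in> carrier_mat (r + 2) (r + 2)" by simp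
  have 1: "Matrix.mat r r (\<lambda>(i, j). ?A $$ (i + 1, j + 1)) = Matrix.mat r r (\<lambda>(i, j). a (m + int j - int i))"
    by (intro eq_matI) (auto simp: algebra_simps)
  have 2: "mat_delete ?A 0 0 = Matrix.mat (r + 1) (r + 1) (\<lambda>(i, j). a (m + int j - int i))"
    by (intro eq_matI) (auto simp: mat_delete_def algebra_simps)
  have 3: "mat_delete ?A (r + 1) (r + 1) = Matrix.mat (r + 1) (r + 1) (\<lambda>(i, j). a (m + int j - int i))"
    by (intro eq_matI) (auto simp: mat_delete_def)
  have 4: "mat_delete ?A 0 (r + 1) = Matrix.mat (r + 1) (r + 1) (\<lambda>(i, j). a (m - 1 + int j - int i))"
    by (intro eq_matI) (auto simp: mat_delete_def algebra_simps)
  have 5: "mat_delete ?A (r + 1) 0 = Matrix.mat (r + 1) (r + 1) (\<lambda>(i, j). a (m + 1 + int j - int i))"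
    by (intro eq_matI) (auto simp: mat_delete_def algebra_simps)
  show ?thesis using Desnanot_Jacobi[OF A] unfolding 1 2 3 4 5 Toeplitz_def
    by (simp add: power2_eq_square mult.commute)
qed

section \<open>The Toda recursion\<close>

text \<open>The recursion for the second logarithmic differences of Toeplitz determinants, for complex
  arguments: \<open>h\<close> is the one of order 1. The divisor \<open>c * r\<close> cancels in the second difference; it moves
  the argument of \<open>Ln\<close> close to 1 when \<open>h\<close> is close to \<open>c\<close>.\<close>

fun toda :: "(complex \<Rightarrow> complex) \<Rightarrow> real \<Rightarrow> nat \<Rightarrow> complex \<Rightarrow> complex" where
  "toda h c 0 z = 0"
| "toda h c (Suc 0) z = h z"
| "toda h c (Suc (Suc r)) z =
     (let L = (\<lambda>w. Ln ((1 - exp (- toda h c (Suc r) w)) / of_real (c * real (Suc r))))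
      in 2 * toda h c (Suc r) z - toda h c r z - (L (z + 1) - 2 * L z + L (z - 1)))"

text \<open>Keeps the argument of \<open>Ln\<close> in the recursion in a disc about 1 on which \<open>Ln\<close> is bounded.\<close>

lemma normalized_log_arg:
  fixes x :: complex and d :: real
  assumes d: "d > 0" "d \<le> 1/2000"
    and x: "norm (x - of_real d) \<le> 48/100 * d"
  shows "Re x > 0" "norm ((1 - exp (- x)) / of_real d - 1) \<le> 49/100"
proof -
  have "\<bar>Re x - d\<bar> \<le> 48/100 * d"
    using x abs_Re_le_cmod[of "x - of_real d"] by simp
  thus "Re x > 0" using d by linarith
  have nx: "norm x \<le> 2 * d"
    using norm_triangle_ineq[of "x - of_real d" "of_real d"] x d by simp
  have "norm (exp (- x) - (\<Sum>k\<le>1. (- x) ^ k / fact k)) \<le> exp \<bar>Re (- x)\<bar> * norm (- x) ^ Suc 1 / fact 1"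
    by (rule Taylor_exp)
  hence 1: "norm (exp (- x) - (1 - x)) \<le> exp \<bar>Re x\<bar> * (norm x)^2"
    by (simp add: power2_eq_square)
  have "exp \<bar>Re x\<bar> \<le> exp (1::real)" using abs_Re_le_cmod[of x] nx d by (subst exp_le_cancel_iff) linarith
  also have "\<dots> \<le> 3" by (rule exp_le)
  finally have "exp \<bar>Re x\<bar> * (norm x)^2 \<le> 3 * (2 * d)^2"
    using nx by (intro mult_mono power_mono) auto
  also have "\<dots> = (12 * d) * d" by (simp add: power2_eq_square)
  also have "\<dots> \<le> (1/100) * d" using d by (intro mult_right_mono) auto
  finally have 2: "norm (exp (- x) - (1 - x)) \<le> (1/100) * d" using 1 by simp
  have "norm ((x - of_real d) - (exp (- x) - (1 - x))) \<le> 48/100 * d + 1/100 * d"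
    using norm_triangle_ineq4[of "x - of_real d" "exp (- x) - (1 - x)"] x 2 by linarith
  also have "(x - of_real d) - (exp (- x) - (1 - x)) = ((1 - exp (- x)) / of_real d - 1) * of_real d"
    using d by (simp add: field_simps)
  finally show "norm ((1 - exp (- x)) / of_real d - 1) \<le> 49/100"
    using d by (simp add: norm_mult)
qed

lemma Ln_near_1:
  fixes u :: complex
  assumes "norm (u - 1) \<le> 49/100"
  shows "u \<notin> \<real>\<^sub>\<le>\<^sub>0" "norm (Ln u) \<le> 1"
proof -
  have "\<bar>Re u - 1\<bar> \<le> 49/100" using abs_Re_le_cmod[of "u - 1"] assms by simp
  thus "u \<notin> \<real>\<^sub>\<le>\<^sub>0" by (auto simp: complex_nonpos_Reals_iff)
  show "norm (Ln u) \<le> 1" using norm_Ln_le[of "u - 1"] assms by simp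
qed

text \<open>The recursion is compared with its approximate solution \<open>r * h\<close>. Its term of order \<open>r\<close> is known on
  a disc of radius \<open>(R + 1 - r) * s\<close> with \<open>s = S / R\<close>, so that in each step Cauchy's estimate is
  available with radius \<open>s / 2\<close> and costs an error of at most \<open>e = 9 / s^2\<close>. The errors add up
  to \<open>r^2 * e\<close> in order \<open>r\<close>. Since \<open>s\<close> is a multiple of \<open>k / R\<close>, the lower bound for \<open>k\<close> makes this at
  most \<open>1/100 * r / k\<close>, which together with the distance \<open>95/100 * r / k\<close> from \<open>r * h\<close> to \<open>2 * r / k\<close> keeps the
  real part positive.\<close>

theorem Toeplitz_pos_of_slowly_varying_curvature:
  fixes a :: "int \<Rightarrow> real" and k R :: nat and h :: "complex \<Rightarrow> complex" and S :: real
  defines "S \<equiv> real k / 50000"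
  assumes R: "R \<ge> 2" and k: "real k \<ge> 10000000000000 * real R ^ 3"
    and holh: "h holomorphic_on ball (of_nat k) S"
    and hb: "\<And>z. z \<in> ball (of_nat k) S \<Longrightarrow> norm (h z - 2 / of_nat k) \<le> 95 / 100 / real k"
    and apos: "\<And>m. of_int m \<in> ball (of_nat k :: complex) S \<Longrightarrow> a m > 0"
    and ah: "\<And>m. of_int m \<in> ball (of_nat k :: complex) S \<Longrightarrow> exp (- h (of_int m)) = of_real (a (m + 1) * a (m - 1) / (a m)^2)"
  shows "Toeplitz a R (int k) > 0"
proof -
  define s where "s = S / real R"
  define B where "B = (\<lambda>r. ball (of_nat k :: complex) ((real R + 1 - real r) * s))"
  define e where "e = 9 / s^2"
  define H where "H = toda h (2 / real k)"
  define T where "T = Toeplitz a"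
  define L where "L = (\<lambda>r w. Ln ((1 - exp (- H r w)) / of_real (2 / real k * real r)))"
  have R0: "real R \<ge> 2" using R by simp
  have R3: "real R ^ 3 = real R * (real R * real R)" by (simp add: power3_eq_cube)
  have RR: "real R * real R \<ge> 4" using mult_mono[of 2 "real R" 2 "real R"] R0 by simp
  have "real R ^ 3 \<ge> real R * 4" unfolding R3 by (rule mult_left_mono) (use RR R0 in auto)
  hence kR: "real k \<ge> 10000000000000 * real R" "real k > 0" using k R0 by linarith+
  have s_eq: "s = real k / (50000 * real R)" by (simp add: s_def S_def)
  have s6: "s \<ge> 6" unfolding s_eq using kR R0 by (simp add: field_simps)
  have e_bound: "real R * e \<le> 1 / 100 / real k"
  proof -
    have "real R * e = 22500000000 * real R ^ 3 / (real k)^2"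
      unfolding e_def s_eq using R0 kR by (simp add: field_simps power2_eq_square R3)
    also have "\<dots> \<le> 22500000000 * (real k / 10000000000000) / (real k)^2"
      using k kR by (intro divide_right_mono mult_left_mono) auto
    also have "\<dots> \<le> 1 / 100 / real k" using kR by (simp add: field_simps power2_eq_square)
    finally show ?thesis .
  qed
  have e0: "e \<ge> 0" by (simp add: e_def)
  have H0: "H 0 z = 0" and H1: "H (Suc 0) z = h z" for z by (auto simp: H_def)
  have H2: "H (Suc (Suc r)) z = 2 * H (Suc r) z - H r z - (L (Suc r) (z + 1) - 2 * L (Suc r) z + L (Suc r) (z - 1))" for r z
    by (simp add: H_def L_def Let_def)
  have Tc: "T (Suc (Suc r)) m * T r m = (T (Suc r) m)^2 - T (Suc r) (m + 1) * T (Suc r) (m - 1)" for r m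
    using Toeplitz_condensation[of a r m] by (simp add: T_def)
  have T0: "T 0 m = 1" and T1: "T (Suc 0) m = a m" for m by (auto simp: T_def)
  have B1: "B 1 = ball (of_nat k) S" using R0 by (simp add: B_def s_def)
  have Bmono: "B (Suc r) \<subseteq> B r" for r
    unfolding B_def using s6 by (intro subset_ball) (simp add: algebra_simps)
  have Bball: "ball z s \<subseteq> B r" if "z \<in> B (Suc r)" for z r
  proof
    fix w assume "w \<in> ball z s"
    thus "w \<in> B r" using that dist_triangle[of "of_nat k" w z]
      unfolding B_def mem_ball by (simp add: algebra_simps)
  qed
  have Bshift: "z + 1 \<in> B r" "z - 1 \<in> B r" if "z \<in> B (Suc r)" for z r
    using Bball[OF that] s6 by (auto simp: dist_norm subset_iff)
  \<comment> \<open>Two consecutive orders are carried along, with the deviation of the later one from \<open>r * h\<close> expressed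
    by its increment, since the recursion is of second order.\<close>
  have inv: "H r holomorphic_on B r \<and> H (Suc r) holomorphic_on B (Suc r)
     \<and> (\<forall>z\<in>B r. norm (H r z - of_nat r * h z) \<le> real r ^ 2 * e)
     \<and> (\<forall>z\<in>B (Suc r). norm ((H (Suc r) z - of_nat (Suc r) * h z) - (H r z - of_nat r * h z)) \<le> real r * e)
     \<and> (\<forall>m. of_int m \<in> B r \<longrightarrow> T r m > 0 \<and> exp (- H r (of_int m)) = of_real (T r (m + 1) * T r (m - 1) / (T r m)^2))
     \<and> (\<forall>m. of_int m \<in> B (Suc r) \<longrightarrow> T (Suc r) m > 0
          \<and> exp (- H (Suc r) (of_int m)) = of_real (T (Suc r) (m + 1) * T (Suc r) (m - 1) / (T (Suc r) m)^2))"
    if "Suc r \<le> R" for r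
    using that
  proof (induction r)
    case 0
    have "H (Suc 0) = h" "H 0 = (\<lambda>_. 0)" by (auto simp: H0 H1)
    thus ?case using holh ah apos B1 by (simp add: T0 T1)
  next
    case (Suc r)
    define n where "n = Suc r"
    have nR: "n < R" "n \<ge> 1" using Suc.prems by (auto simp: n_def)
    have IH: "H r holomorphic_on B r" "H n holomorphic_on B n"
      "\<And>z. z \<in> B r \<Longrightarrow> norm (H r z - of_nat r * h z) \<le> real r ^ 2 * e"
      "\<And>z. z \<in> B n \<Longrightarrow> norm ((H n z - of_nat n * h z) - (H r z - of_nat r * h z)) \<le> real r * e"
      "\<And>m. of_int m \<in> B r \<Longrightarrow> T r m > 0"
      "\<And>m. of_int m \<in> B r \<Longrightarrow> exp (- H r (of_int m)) = of_real (T r (m + 1) * T r (m - 1) / (T r m)^2)"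
      "\<And>m. of_int m \<in> B n \<Longrightarrow> T n m > 0"
      "\<And>m. of_int m \<in> B n \<Longrightarrow> exp (- H n (of_int m)) = of_real (T n (m + 1) * T n (m - 1) / (T n m)^2)"
      using Suc.IH Suc.prems unfolding n_def by auto
    have Bn1: "B n \<subseteq> B 1"
      unfolding B_def using s6 nR by (intro subset_ball mult_right_mono) auto
    have Bnr: "B n \<subseteq> B r" using Bmono n_def by simp
    have En: "norm (H n z - of_nat n * h z) \<le> real n ^ 2 * e" if z: "z \<in> B n" for z
    proof -
      have "norm (H n z - of_nat n * h z) \<le> real r ^ 2 * e + real r * e"
        using IH(3)[of z] IH(4)[of z] z Bnr norm_triangle_ineq[of "(H n z - of_nat n * h z) - (H r z - of_nat r * h z)" "H r z - of_nat r * h z"]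
        by (auto simp: algebra_simps)
      also have "\<dots> = (real r ^ 2 + real r) * e" by (simp add: algebra_simps)
      also have "\<dots> \<le> real n ^ 2 * e" using e0 by (intro mult_right_mono) (auto simp: n_def power2_eq_square algebra_simps)
      finally show ?thesis .
    qed
    define d where "d = 2 / real k * real n"
    have d: "d > 0" "d \<le> 1/2000"
      using kR nR R0 by (auto simp: d_def field_simps)
    have close: "norm (H n z - of_real d) \<le> 48/100 * d" if z: "z \<in> B n" for z
    proof -
      have "norm (of_nat n * (h z - 2 / of_nat k)) \<le> real n * (95 / 100 / real k)"
        unfolding norm_mult using hb[of z] z Bn1 B1 by (intro mult_mono) auto
      hence 1: "norm (of_nat n * h z - of_real d) \<le> real n * (95 / 100 / real k)"
        by (simp add: d_def algebra_simps)
      have "real n ^ 2 * e = real n * (real n * e)" by (simp add: power2_eq_square)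
      also have "\<dots> \<le> real n * (real R * e)" using nR e0 by (intro mult_left_mono mult_right_mono) auto
      also have "\<dots> \<le> real n * (1 / 100 / real k)" using e_bound by (intro mult_left_mono) auto
      finally have 2: "norm (H n z - of_nat n * h z) \<le> real n * (1 / 100 / real k)" using En[OF z] by simp
      have "norm (H n z - of_real d) \<le> real n * (1 / 100 / real k) + real n * (95 / 100 / real k)"
        using norm_triangle_ineq[of "H n z - of_nat n * h z" "of_nat n * h z - of_real d"] 1 2 by simp
      also have "\<dots> = 48/100 * d" by (simp add: d_def field_simps)
      finally show ?thesis .
    qed
    have Ln_eq: "L n z = Ln ((1 - exp (- H n z)) / of_real d)" for z by (simp add: L_def d_def)
    have arg: "norm ((1 - exp (- H n z)) / of_real d - 1) \<le> 49/100" "Re (H n z) > 0" if "z \<in> B n" for z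
      using normalized_log_arg[OF d close[OF that]] by auto
    have Lb: "norm (L n z) \<le> 1" if "z \<in> B n" for z
      unfolding Ln_eq by (rule Ln_near_1(2)[OF arg(1)[OF that]])
    have Lhol: "L n holomorphic_on B n"
    proof -
      have "(\<lambda>z. Ln ((1 - exp (- H n z)) / of_real d)) holomorphic_on B n"
        using d Ln_near_1(1)[OF arg(1)] by (intro holomorphic_intros IH(2)) auto
      moreover have "L n = (\<lambda>z. Ln ((1 - exp (- H n z)) / of_real d))" using Ln_eq by (rule ext)
      ultimately show ?thesis by simp
    qed
    have expL: "exp (L n z) = (1 - exp (- H n z)) / of_real d" if "z \<in> B n" for z
    proof -
      have "(1 - exp (- H n z)) / of_real d \<noteq> 0" using arg(1)[OF that] by auto
      thus ?thesis unfolding Ln_eq by (rule exp_Ln)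
    qed
    have hol': "H (Suc n) holomorphic_on B (Suc n)"
    proof -
      have s1: "(\<lambda>z. L n (z + 1)) holomorphic_on B (Suc n)" "(\<lambda>z. L n (z - 1)) holomorphic_on B (Suc n)"
        using Bshift by (auto intro!: holomorphic_on_compose_gen[OF _ Lhol, unfolded o_def] holomorphic_intros)
      have s2: "L n holomorphic_on B (Suc n)" "H n holomorphic_on B (Suc n)" "H r holomorphic_on B (Suc n)"
        using Lhol IH(1,2) Bmono[of n] Bnr by (meson holomorphic_on_subset order_trans)+
      have "(\<lambda>z. 2 * H n z - H r z - (L n (z + 1) - 2 * L n z + L n (z - 1))) holomorphic_on B (Suc n)"
        by (intro holomorphic_intros s1 s2)
      moreover have "H (Suc n) = (\<lambda>z. 2 * H n z - H r z - (L n (z + 1) - 2 * L n z + L n (z - 1)))"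
        using H2[of r] unfolding n_def by (rule ext)
      ultimately show ?thesis by simp
    qed
    have Ediff: "norm ((H (Suc n) z - of_nat (Suc n) * h z) - (H n z - of_nat n * h z)) \<le> real n * e"
      if z: "z \<in> B (Suc n)" for z
    proof -
      have "L n holomorphic_on ball z s" using Lhol Bball[OF z] holomorphic_on_subset by blast
      hence "norm (L n (z + 1) - 2 * L n z + L n (z - 1)) \<le> 2 * (norm (1::complex))^2 * 1 / ((s/2)^2 - (norm (1::complex))^2)"
        by (rule second_difference_bound) (use s6 Lb Bball[OF z] in auto)
      also have "\<dots> = 2 / ((s/2)^2 - 1)" by simp
      also have "\<dots> \<le> e"
      proof -
        have "s^2 \<ge> 36" using power_mono[of 6 s 2] s6 by simp
        hence y: "(s/2)^2 - 1 > 0" "s^2 > 0" "2 * s^2 \<le> 9 * ((s/2)^2 - 1)" by (auto simp: power_divide)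
        have "2 / P \<le> 9 / y" if "P > 0" "y > 0" "2 * y \<le> 9 * P" for P y :: real
          using that by (simp add: field_simps)
        from this[OF y] show ?thesis by (simp add: e_def)
      qed
      finally have 1: "norm (L n (z + 1) - 2 * L n z + L n (z - 1)) \<le> e" .
      have "(H (Suc n) z - of_nat (Suc n) * h z) - (H n z - of_nat n * h z)
        = ((H n z - of_nat n * h z) - (H r z - of_nat r * h z)) - (L n (z + 1) - 2 * L n z + L n (z - 1))"
        using H2[of r z] by (simp add: n_def algebra_simps)
      moreover have "norm (((H n z - of_nat n * h z) - (H r z - of_nat r * h z)) - (L n (z + 1) - 2 * L n z + L n (z - 1)))
          \<le> real r * e + e"
        using z Bmono[of n] by (intro order_trans[OF norm_triangle_ineq4] add_mono IH(4) 1) auto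
      ultimately have "norm ((H (Suc n) z - of_nat (Suc n) * h z) - (H n z - of_nat n * h z)) \<le> real r * e + e"
        by (simp only:)
      thus ?thesis by (simp add: n_def algebra_simps)
    qed
    define q where "q = (\<lambda>m. T n (m + 1) * T n (m - 1) / (T n m)^2)"
    have Tq: "T (Suc n) m * T r m = (T n m)^2 * (1 - q m)" "1 - q m > 0" "T (Suc n) m > 0" if m: "of_int m \<in> B n" for m
    proof -
      have p: "T n m > 0" "T r m > 0" using IH(5,7) m Bnr by auto
      show 1: "T (Suc n) m * T r m = (T n m)^2 * (1 - q m)"
      proof -
        have "(T n m)^2 * (1 - q m) = (T n m)^2 - T n (m + 1) * T n (m - 1)"
          using p by (simp add: q_def right_diff_distrib)
        thus ?thesis using Tc[of r m] by (simp only: n_def)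
      qed
      have "norm (exp (- H n (of_int m))) < 1" using arg(2)[OF m] by simp
      hence "\<bar>q m\<bar> < 1" using IH(8)[OF m] by (simp add: q_def flip: of_real_mult of_real_divide of_real_power)
      thus 2: "1 - q m > 0" by simp
      have "T (Suc n) m * T r m > 0" unfolding 1 using 2 p by simp
      thus "T (Suc n) m > 0" using p by (simp add: zero_less_mult_iff)
    qed
    \<comment> \<open>At integers the recursion is the condensation identity: \<open>T (Suc n) = (T n)^2 * (1 - q) / T r\<close> at \<open>m\<close> and
      at both neighbours, and the normalising constant \<open>d\<close> cancels.\<close>
    have expH: "exp (- H (Suc n) (of_int m)) = of_real (T (Suc n) (m + 1) * T (Suc n) (m - 1) / (T (Suc n) m)^2)"
      if m: "of_int m \<in> B (Suc n)" for m
    proof -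
      have mB: "of_int m \<in> B n" "of_int (m + 1) \<in> B n" "of_int (m - 1) \<in> B n" "of_int m \<in> B r"
         "of_int (m + 1) \<in> B r" "of_int (m - 1) \<in> B r"
        using m Bmono[of n] Bnr Bshift[OF m] by auto
      have eL: "exp (L n (of_int j)) = of_real ((1 - q j) / d)" if "of_int j \<in> B n" for j
        using expL[OF that] IH(8)[OF that] by (simp add: q_def)
      have step: "- H (Suc n) (of_int m) = ((- H n (of_int m)) + (- H n (of_int m))) - (- H r (of_int m))
          + ((L n (of_int (m + 1)) + L n (of_int (m - 1))) - (L n (of_int m) + L n (of_int m)))"
        using H2[of r "of_int m"] by (simp add: n_def algebra_simps)
      have qH: "exp (- H n (of_int m)) = of_real (q m)" using IH(8)[OF mB(1)] by (simp only: q_def)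
      have "exp (- H (Suc n) (of_int m)) = (exp (- H n (of_int m)) * exp (- H n (of_int m))) / exp (- H r (of_int m))
          * ((exp (L n (of_int (m + 1))) * exp (L n (of_int (m - 1)))) / (exp (L n (of_int m)) * exp (L n (of_int m))))"
        unfolding step exp_add exp_diff ..
      also have "\<dots> = (of_real (q m) * of_real (q m)) / of_real (T r (m + 1) * T r (m - 1) / (T r m)^2)
          * ((of_real ((1 - q (m + 1)) / d) * of_real ((1 - q (m - 1)) / d)) / (of_real ((1 - q m) / d) * of_real ((1 - q m) / d)))"
        unfolding IH(6)[OF mB(4)] qH eL[OF mB(1)] eL[OF mB(2)] eL[OF mB(3)] ..
      also have "\<dots> = of_real (q m * q m / (T r (m + 1) * T r (m - 1) / (T r m)^2)
          * (((1 - q (m + 1)) / d) * ((1 - q (m - 1)) / d) / (((1 - q m) / d) * ((1 - q m) / d))))"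
        by (simp only: of_real_mult of_real_divide)
      also have "q m * q m / (T r (m + 1) * T r (m - 1) / (T r m)^2)
          * (((1 - q (m + 1)) / d) * ((1 - q (m - 1)) / d) / (((1 - q m) / d) * ((1 - q m) / d)))
          = T (Suc n) (m + 1) * T (Suc n) (m - 1) / (T (Suc n) m)^2"
      proof -
        have W: "T (Suc n) j = (T n j)^2 * (1 - q j) / T r j" if "of_int j \<in> B n" for j
          using Tq(1)[OF that] IH(5)[of j] that Bnr by (auto simp: field_simps)
        have pos: "T n m > 0" "T n (m + 1) > 0" "T n (m - 1) > 0" "T r m > 0" "T r (m + 1) > 0" "T r (m - 1) > 0"
          "1 - q m > 0" using IH(5,7) mB Tq(2) by auto
        have qq: "q m * q m = (T n (m + 1))^2 * (T n (m - 1))^2 / (T n m)^4"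
          by (simp add: q_def power2_eq_square power4_eq_xxxx mult_ac)
        have alg: "Xp^2 * Xm^2 / X^4 / (Yp * Ym / Y^2) * ((up / d) * (um / d) / ((u / d) * (u / d)))
          = (Xp^2 * up / Yp) * (Xm^2 * um / Ym) / (X^2 * u / Y)^2"
          if "Xp > 0" "Xm > 0" "X > 0" "Yp > 0" "Ym > 0" "Y > 0" "u > 0" "d > 0" for Xp Xm X Yp Ym Y up um u d :: real
        proof -
          have "(up / d) * (um / d) / ((u / d) * (u / d)) = up * um / (u * u)" using that by simp
          thus ?thesis by (simp only:) (simp add: divide_inverse power2_eq_square power4_eq_xxxx mult_ac)
        qed
        show ?thesis unfolding qq W[OF mB(1)] W[OF mB(2)] W[OF mB(3)]
          by (rule alg) (use pos d in auto)
      qed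
      finally show ?thesis .
    qed
    show ?case unfolding n_def[symmetric]
      using IH(2,7,8) hol' En Ediff Tq(3) expH Bmono[of n] by blast
  qed
  obtain r where r: "R = Suc r" using R by (cases R) auto
  have "of_int (int k) \<in> B (Suc r)" unfolding B_def using s6 r by simp
  thus ?thesis using inv[of r] r by (simp add: T_def)
qed

section \<open>Sectors around the positive axis\<close>

text \<open>The parameter is the tangent of half the opening angle. In this form membership consists of linear
  inequalities and passes to integrals.\<close>

definition in_sector :: "real \<Rightarrow> complex \<Rightarrow> bool" where
  "in_sector a x \<longleftrightarrow> 0 < Re x \<and> \<bar>Im x\<bar> \<le> a * Re x"

lemma sector_mono: "in_sector a x \<Longrightarrow> a \<le> b \<Longrightarrow> in_sector b x"
  unfolding in_sector_def by (meson less_imp_le mult_right_mono order_trans)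

lemma sector_add_of_real: "in_sector a x \<Longrightarrow> a \<ge> 0 \<Longrightarrow> r \<ge> 0 \<Longrightarrow> in_sector a (x + of_real r)"
  unfolding in_sector_def using mult_left_mono[of "Re x" "Re x + r" a] by auto

lemma sector_inverse:
  assumes "in_sector a x"
  shows "in_sector a (inverse x)"
proof -
  have x: "Re x > 0" "\<bar>Im x\<bar> \<le> a * Re x" using assms by (auto simp: in_sector_def)
  have n: "(Re x)^2 + (Im x)^2 > 0" using x by (simp add: add_pos_nonneg)
  have "\<bar>Im (inverse x)\<bar> = \<bar>Im x\<bar> / ((Re x)^2 + (Im x)^2)" using n by (simp add: abs_divide)
  also have "\<dots> \<le> (a * Re x) / ((Re x)^2 + (Im x)^2)" using x n by (intro divide_right_mono) auto
  finally show ?thesis using x n by (simp add: in_sector_def)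
qed

text \<open>Arguments add up, and so do their tangents up to the factor \<open>1 / (1 - a * b)\<close>.\<close>

lemma sector_mult:
  assumes "in_sector a x" "in_sector b y" "0 \<le> a" "a \<le> 1/10" "0 \<le> b" "b \<le> 1/10"
  shows "in_sector (51/50 * (a + b)) (x * y)"
proof -
  have x: "Re x > 0" "\<bar>Im x\<bar> \<le> a * Re x" and y: "Re y > 0" "\<bar>Im y\<bar> \<le> b * Re y"
    using assms by (auto simp: in_sector_def)
  define p where "p = Re x * Re y"
  have p: "p > 0" using x y by (simp add: p_def)
  have "\<bar>Im x * Im y\<bar> \<le> (a * Re x) * (b * Re y)" unfolding abs_mult using x y assms by (intro mult_mono) auto
  also have "\<dots> = (a * b) * p" by (simp add: p_def)
  also have "\<dots> \<le> (1/10 * (1/10)) * p" using assms p by (intro mult_right_mono mult_mono) auto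
  finally have re: "Re (x * y) \<ge> 99/100 * p" by (simp add: p_def)
  have "\<bar>Im (x * y)\<bar> \<le> \<bar>Re x * Im y\<bar> + \<bar>Im x * Re y\<bar>" by simp
  also have "\<dots> \<le> Re x * (b * Re y) + (a * Re x) * Re y" unfolding abs_mult using x y
    by (intro add_mono mult_mono) auto
  also have "\<dots> = (a + b) * p" by (simp add: p_def algebra_simps)
  also have "\<dots> \<le> (a + b) * (51/50 * Re (x * y))" using re p assms by (intro mult_left_mono) auto
  finally show ?thesis using re p by (simp add: in_sector_def algebra_simps)
qed

section \<open>The series behind Phi\<close>

text \<open>With \<open>n = Suc m\<close> and \<open>w = exp (4 * u)\<close> this is the \<open>n\<close>-th term of \<open>Phi u\<close> divided by
  \<open>w powr (9/4) * exp (- pi * w)\<close>.\<close>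

definition xi_term :: "nat \<Rightarrow> complex \<Rightarrow> complex" where
  "xi_term m w = (2 * of_real pi ^ 2 * of_nat (Suc m) ^ 4 - 3 * of_real pi * of_nat (Suc m) ^ 2 / w)
     * exp (- (of_real pi * (of_nat (Suc m) ^ 2 - 1) * w))"

definition xi_series :: "complex \<Rightarrow> complex" where
  "xi_series w = (\<Sum>m. xi_term m w)"

text \<open>A geometric majorant, from \<open>n \<le> 2 ^ m\<close> and \<open>n^2 - 1 \<ge> 3 * m\<close> for \<open>n = Suc m\<close>.\<close>

lemma norm_xi_term_le:
  assumes w: "Re w \<ge> x" and x: "x > 0"
  shows "norm (xi_term m w) \<le> (20 + 10 / x) * (16 * exp (- (9 * x))) ^ m"
proof -
  define n where "n = real (Suc m)"
  have n1: "n \<ge> 1" by (simp add: n_def)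
  have pi2: "pi ^ 2 \<le> 10" using pi_approx by (intro order_trans[OF power_mono[of pi "3.1416" 2]]) (auto simp: power2_eq_square)
  have nw: "norm w \<ge> x" using w x abs_Re_le_cmod[of w] by linarith
  have n2: "n^2 \<le> n^4" using n1 by (intro power_increasing) auto
  have "norm (3 * of_real pi * of_nat (Suc m) ^ 2 / w) = 3 * pi * n^2 / norm w"
    by (simp add: norm_mult norm_divide norm_power n_def del: of_nat_Suc)
  also have "\<dots> \<le> 10 * n^4 / x"
    using n2 nw x pi_approx by (intro frac_le mult_mono) auto
  finally have 1: "norm (3 * of_real pi * of_nat (Suc m) ^ 2 / w) \<le> 10 * n^4 / x" .
  have "norm (2 * of_real pi ^ 2 * of_nat (Suc m) ^ 4 :: complex) = 2 * pi^2 * n^4"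
    by (simp add: norm_mult norm_power n_def del: of_nat_Suc)
  also have "\<dots> \<le> 20 * n^4" using pi2 n1 by (intro mult_right_mono) auto
  finally have 2: "norm (2 * of_real pi ^ 2 * of_nat (Suc m) ^ 4 - 3 * of_real pi * of_nat (Suc m) ^ 2 / w) \<le> (20 + 10 / x) * n^4"
    using norm_triangle_ineq4[of "2 * of_real pi ^ 2 * of_nat (Suc m) ^ 4" "3 * of_real pi * of_nat (Suc m) ^ 2 / w"] 1
    by (simp add: algebra_simps)
  have "n \<le> 2 ^ m" unfolding n_def using of_nat_mono[OF Suc_leI[OF less_exp[of m]], where 'a = real] by simp
  hence "n ^ 4 \<le> (2 ^ m) ^ 4" using n1 by (intro power_mono) auto
  hence 3: "n ^ 4 \<le> 16 ^ m" by (simp add: power_mult[symmetric] mult.commute[of m] power_mult)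
  have "3 * real m \<le> n^2 - 1"
  proof (cases m)
    case (Suc j) thus ?thesis by (simp add: n_def power2_eq_square algebra_simps)
  qed (simp add: n_def)
  hence "3 * (3 * real m) * x \<le> pi * (n^2 - 1) * Re w"
    using w x pi_approx by (intro mult_mono) auto
  moreover have "Re (of_real pi * (of_nat (Suc m) ^ 2 - 1) * w) = pi * (n^2 - 1) * Re w"
  proof -
    have "(of_real pi * (of_nat (Suc m) ^ 2 - 1) * w) = of_real (pi * (n^2 - 1)) * w" by (simp add: n_def)
    thus ?thesis by (simp only: times_complex.sel Re_complex_of_real Im_complex_of_real)
  qed
  ultimately have "norm (exp (- (of_real pi * (of_nat (Suc m) ^ 2 - 1) * w))) = exp (- (pi * (n^2 - 1) * Re w))"
      "3 * (3 * real m) * x \<le> pi * (n^2 - 1) * Re w"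
    by (simp_all only: norm_exp_eq_Re uminus_complex.sel)
  hence 4: "norm (exp (- (of_real pi * (of_nat (Suc m) ^ 2 - 1) * w))) \<le> exp (- (9 * x) * real m)"
    by (simp only: exp_le_cancel_iff) (simp add: mult_ac)
  have "norm (xi_term m w) \<le> ((20 + 10 / x) * n^4) * exp (- (9 * x) * real m)"
    unfolding xi_term_def norm_mult by (rule mult_mono[OF 2 4]) (use x n1 in auto)
  also have "\<dots> \<le> ((20 + 10 / x) * 16 ^ m) * exp (- (9 * x) * real m)"
    using 3 x by (intro mult_right_mono mult_left_mono) auto
  also have "exp (- (9 * x) * real m) = exp (- (9 * x)) ^ m"
    by (simp add: exp_of_nat_mult[symmetric] mult.commute)
  finally show ?thesis by (simp add: power_mult_distrib mult_ac)
qed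

lemma exp_1_ge_27: "27 / 10 \<le> exp (1::real)"
  using e_approx_32 by (simp add: abs_if split: if_splits)

lemma exp_half_ratio: "16 * exp (- (9 * (1/2))) < (1::real)"
proof -
  have "(16::real) < (27/10) ^ 4" by (simp add: power4_eq_xxxx)
  also have "\<dots> \<le> exp 1 ^ 4" using exp_1_ge_27 by (intro power_mono) auto
  also have "\<dots> = exp 4" by (simp add: exp_of_nat_mult[symmetric])
  also have "\<dots> \<le> exp (9/2::real)" by simp
  finally show ?thesis by (simp add: exp_minus field_simps)
qed

lemma exp_full_ratio: "16 * exp (- (9 * 1)) \<le> (1/300::real)"
proof -
  have "(4800::real) \<le> (27/10) ^ 9" by (simp add: power_divide)
  also have "\<dots> \<le> exp 1 ^ 9" using exp_1_ge_27 by (intro power_mono) auto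
  also have "\<dots> = exp 9" by (simp add: exp_of_nat_mult[symmetric])
  finally show ?thesis by (simp add: exp_minus field_simps)
qed

lemma summable_xi_bound: "summable (\<lambda>m. (20 + 10 / (1/2)) * (16 * exp (- (9 * (1/2)))) ^ m :: real)"
  using exp_half_ratio by (intro summable_mult summable_geometric) simp

lemma summable_xi_term:
  assumes "Re w \<ge> 1/2"
  shows "summable (\<lambda>m. norm (xi_term m w))" "summable (\<lambda>m. xi_term m w)"
proof -
  show "summable (\<lambda>m. norm (xi_term m w))"
    by (rule summable_comparison_test'[OF summable_xi_bound, of 0])
       (use norm_xi_term_le[of "1/2" w] assms in simp)
  thus "summable (\<lambda>m. xi_term m w)" by (rule summable_norm_cancel)
qed

lemma holomorphic_xi_series: "xi_series holomorphic_on {w. Re w > 1/2}"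
proof (rule holomorphic_uniform_sequence)
  show op: "open {w. Re w > 1/2}" by (rule open_halfspace_Re_gt)
  show "(\<lambda>w. \<Sum>m<n. xi_term m w) holomorphic_on {w. Re w > 1/2}" for n
    unfolding xi_term_def by (intro holomorphic_intros) auto
  fix x :: complex assume "x \<in> {w. Re w > 1/2}"
  then obtain d where d: "d > 0" "cball x d \<subseteq> {w. Re w > 1/2}"
    using op open_contains_cball by metis
  have "uniform_limit {w. Re w > 1/2} (\<lambda>n w. \<Sum>m<n. xi_term m w) xi_series sequentially"
    unfolding xi_series_def[abs_def]
    by (rule Weierstrass_m_test[OF _ summable_xi_bound]) (use norm_xi_term_le[of "1/2"] in simp)
  thus "\<exists>d>0. cball x d \<subseteq> {w. Re w > 1/2} \<and> uniform_limit (cball x d) (\<lambda>n w. \<Sum>m<n. xi_term m w) xi_series sequentially"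
    using d uniform_limit_on_subset by blast
qed

text \<open>The term \<open>m = 0\<close> carries no exponential factor, and it is all that matters: the next one is already
  multiplied by \<open>exp (- 3 * pi)\<close> at \<open>w = 1\<close>.\<close>

lemma xi_series_approx:
  assumes "Re w \<ge> 1"
  shows "norm (xi_series w - (2 * of_real pi ^ 2 - 3 * of_real pi / w)) \<le> 3 / 25"
proof -
  let ?q = "16 * exp (- (9 * 1)) :: real"
  have q: "0 < ?q" "?q \<le> 1/300" using exp_full_ratio by auto
  have S: "summable (\<lambda>m. norm (xi_term m w))" "summable (\<lambda>m. xi_term m w)"
    using summable_xi_term assms by auto
  have S': "summable (\<lambda>m. norm (xi_term (Suc m) w))" using S(1) summable_Suc_iff[of "\<lambda>m. norm (xi_term m w)"] by simp
  have sg: "summable (\<lambda>m. 30 * ?q ^ Suc m)" using q by (intro summable_mult summable_Suc_iff[THEN iffD2] summable_geometric) auto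
  have "xi_series w = xi_term 0 w + (\<Sum>m. xi_term (Suc m) w)"
    unfolding xi_series_def using suminf_split_head[OF S(2)] by simp
  moreover have "xi_term 0 w = 2 * of_real pi ^ 2 - 3 * of_real pi / w" by (simp add: xi_term_def)
  ultimately have "norm (xi_series w - (2 * of_real pi ^ 2 - 3 * of_real pi / w)) = norm (\<Sum>m. xi_term (Suc m) w)" by simp
  also have "\<dots> \<le> (\<Sum>m. norm (xi_term (Suc m) w))" by (rule summable_norm[OF S'])
  also have "\<dots> \<le> (\<Sum>m. 30 * ?q ^ Suc m)"
    by (rule suminf_le[OF _ S' sg]) (use norm_xi_term_le[of 1 w "Suc _"] assms in simp)
  also have "\<dots> = 30 * ?q * (1 / (1 - ?q))"
    using q suminf_geometric[of ?q] summable_geometric[of ?q] by (simp add: suminf_mult mult.assoc)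
  also have "\<dots> \<le> 30 * (1/300) * (1 / (1 - 1/300))"
    using q by (intro mult_mono frac_le) auto
  also have "\<dots> \<le> 3/25" by simp
  finally show ?thesis .
qed

lemma xi_series_bounds:
  assumes w: "Re w \<ge> 1"
  shows "Re (xi_series w) \<ge> 9" "norm (xi_series w) \<le> 30" "\<bar>Im (xi_series w)\<bar> \<le> 3/25 + 10 * (\<bar>Im w\<bar> / Re w)"
proof -
  define v where "v = 2 * of_real pi ^ 2 - 3 * of_real pi / w"
  define e where "e = xi_series w - v"
  have e: "norm e \<le> 3/25" using xi_series_approx[OF w] by (simp add: e_def v_def)
  have eq: "xi_series w = v + e" by (simp add: e_def)
  have p: "3.1415 < pi" "pi < 3.1416" using pi_approx by auto
  have n2: "norm w ^ 2 \<ge> Re w * Re w" "Re w * Re w \<ge> 1 * 1"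
    using w mult_mono[of 1 "Re w" 1 "Re w"] by (simp_all add: cmod_power2) (simp add: power2_eq_square)
  have re_inv: "Re (3 * of_real pi / w) = 3 * pi * Re w / norm w ^ 2"
    "Im (3 * of_real pi / w) = - (3 * pi * Im w / norm w ^ 2)"
    by (simp_all add: Re_divide Im_divide cmod_power2)
  have "Re w / norm w ^ 2 \<le> Re w / (Re w * Re w)" using n2 w by (intro divide_left_mono mult_pos_pos) auto
  also have "\<dots> \<le> 1" using w by simp
  finally have "3 * pi * (Re w / norm w ^ 2) \<le> 3 * pi * 1" by (intro mult_left_mono) auto
  hence "Re v \<ge> 2 * pi^2 - 3 * pi" by (simp add: v_def re_inv)
  also have "2 * pi^2 - 3 * pi = pi * (2 * pi - 3)" by (simp add: power2_eq_square algebra_simps)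
  also have "pi * (2 * pi - 3) \<ge> 3.1415 * (2 * 3.1415 - 3)" using p by (intro mult_mono) auto
  finally have "Re v \<ge> 9.5" by simp
  thus "Re (xi_series w) \<ge> 9" using abs_Re_le_cmod[of e] e by (simp add: eq)
  have nw1: "norm w \<ge> 1" using w abs_Re_le_cmod[of w] by linarith
  have "norm v \<le> 2 * pi^2 + 3 * pi / norm w"
    using norm_triangle_ineq4[of "2 * of_real pi ^ 2" "3 * of_real pi / w"]
    by (simp add: v_def norm_mult norm_divide norm_power)
  also have "\<dots> \<le> 2 * 3.1416^2 + 3 * 3.1416 / 1" using p nw1 by (intro add_mono mult_mono frac_le power_mono) auto
  finally have "norm v \<le> 29.5" by (simp add: power2_eq_square)
  thus "norm (xi_series w) \<le> 30" using e norm_triangle_ineq[of v e] by (simp add: eq)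
  have "\<bar>Im v\<bar> = 3 * pi * (\<bar>Im w\<bar> / norm w ^ 2)" by (simp add: v_def re_inv abs_mult flip: of_real_power)
  also have "\<dots> \<le> 10 * (\<bar>Im w\<bar> / (Re w * 1))"
  proof (intro mult_mono divide_left_mono)
    show "Re w * 1 \<le> norm w ^ 2" using n2 w mult_mono[of "Re w" "Re w" 1 "Re w"] by linarith
    show "0 < norm w ^ 2 * (Re w * 1)" using w nw1 by (intro mult_pos_pos zero_less_power) auto
  qed (use p w nw1 in auto)
  finally show "\<bar>Im (xi_series w)\<bar> \<le> 3/25 + 10 * (\<bar>Im w\<bar> / Re w)"
    using abs_Im_le_cmod[of e] e by (simp add: eq)
qed

section \<open>Integrals along rays\<close>

text \<open>The integrand of the moment of order \<open>z\<close> of \<open>Phi\<close> after the substitution \<open>4 * u = ln w\<close>. At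
  \<open>w = 1\<close> the value is \<open>0\<close> when \<open>Re z > 0\<close>, which is also the limit.\<close>

definition xi_integrand :: "complex \<Rightarrow> complex \<Rightarrow> complex" where
  "xi_integrand z w = Ln w powr z * w powr (5/4) * xi_series w * exp (- (of_real pi * w))"

text \<open>Multiplied by \<open>c\<close>, this is the integral along the half-line from \<open>1\<close> in the direction of \<open>c\<close>.\<close>

definition ray_integral :: "complex \<Rightarrow> complex \<Rightarrow> complex" where
  "ray_integral c z = (LINT t:{0..}|lborel. xi_integrand z (1 + c * of_real t))"

lemma continuous_on_xi_integrand:
  assumes "Re z > 0"
  shows "continuous_on {w. Re w \<ge> 1} (xi_integrand z)"
proof -
  have "continuous_on {w. Re w \<ge> 1} xi_series"
    by (rule continuous_on_subset[OF holomorphic_on_imp_continuous_on[OF holomorphic_xi_series]]) auto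
  moreover have "Re (Ln w) \<ge> 0" if "Re w \<ge> 1" for w
  proof -
    have "norm w \<ge> 1" "w \<noteq> 0" using that abs_Re_le_cmod[of w] by auto
    thus ?thesis by simp
  qed
  ultimately show ?thesis unfolding xi_integrand_def
    using assms by (intro continuous_intros) (auto simp: complex_nonpos_Reals_iff)
qed

lemma Ln_not_nonpos_Reals:
  assumes "Re w \<ge> 1" "w \<noteq> 1"
  shows "Re (Ln w) > 0" "Ln w \<notin> \<real>\<^sub>\<le>\<^sub>0"
proof -
  have "norm w > 1"
  proof (cases "Re w = 1")
    case True
    hence "Im w \<noteq> 0" using assms by (auto simp: complex_eq_iff)
    hence "1\<^sup>2 < (norm w)^2" using True by (simp add: cmod_power2)
    thus ?thesis by (rule power2_less_imp_less) simp
  qed (use assms abs_Re_le_cmod[of w] in linarith)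
  moreover have "w \<noteq> 0" using assms by auto
  ultimately show "Re (Ln w) > 0" by simp
  thus "Ln w \<notin> \<real>\<^sub>\<le>\<^sub>0" by (auto simp: complex_nonpos_Reals_iff)
qed

lemma xi_integrand_exp:
  assumes "Re w \<ge> 1" "w \<noteq> 1"
  shows "xi_integrand z w = exp (z * Ln (Ln w) - of_real pi * w) * w powr (5/4) * xi_series w"
proof -
  have "Ln w \<noteq> 0" using Ln_not_nonpos_Reals[OF assms] by auto
  hence e1: "Ln w powr z = exp (z * Ln (Ln w))" by (simp only: powr_def if_False)
  have e2: "exp (z * Ln (Ln w) - of_real pi * w) = exp (z * Ln (Ln w)) * exp (- (of_real pi * w))"
    by (simp only: diff_conv_add_uminus exp_add)
  have perm: "a * b * c * d = a * d * b * c" for a b c d :: complex by simp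
  have "xi_integrand z w = exp (z * Ln (Ln w)) * w powr (5/4) * xi_series w * exp (- (of_real pi * w))"
    by (simp only: xi_integrand_def e1)
  also have "\<dots> = exp (z * Ln (Ln w)) * exp (- (of_real pi * w)) * w powr (5/4) * xi_series w"
    by (rule perm)
  also have "\<dots> = exp (z * Ln (Ln w) - of_real pi * w) * w powr (5/4) * xi_series w"
    by (simp only: e2)
  finally show ?thesis .
qed

lemma holomorphic_xi_integrand: "xi_integrand z holomorphic_on {w. Re w > 1}"
proof -
  have 1: "xi_series holomorphic_on {w. Re w > 1}"
    by (rule holomorphic_on_subset[OF holomorphic_xi_series]) auto
  have Ln: "Ln w \<notin> \<real>\<^sub>\<le>\<^sub>0" "w \<notin> \<real>\<^sub>\<le>\<^sub>0" if "w \<in> {w. Re w > 1}" for w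
    using that Ln_not_nonpos_Reals(2)[of w] by (force simp: complex_nonpos_Reals_iff)+
  have "(\<lambda>w. exp (z * Ln (Ln w) - of_real pi * w) * exp (5/4 * Ln w) * xi_series w) holomorphic_on {w. Re w > 1}"
    by (intro holomorphic_intros 1 Ln)
  moreover have "exp (z * Ln (Ln w) - of_real pi * w) * exp (5/4 * Ln w) * xi_series w = xi_integrand z w"
    if "w \<in> {w. Re w > 1}" for w
  proof -
    have c: "Re w \<ge> 1" "w \<noteq> 1" "w \<noteq> 0" using that by auto
    have p: "w powr (5/4) = exp (5/4 * Ln w)" using c(3) by (simp only: powr_def if_False)
    have "xi_integrand z w = exp (z * Ln (Ln w) - of_real pi * w) * exp (5/4 * Ln w) * xi_series w"
      using xi_integrand_exp[OF c(1,2), of z] by (simp only: p)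
    thus ?thesis by (rule sym)
  qed
  ultimately show ?thesis by (rule holomorphic_transform)
qed

lemma power_le_exp: "x ^ n \<le> fact n * exp x" if "x \<ge> 0" for x :: real
proof -
  have "x ^ n / fact n \<le> (\<Sum>k. x ^ k / fact k)"
    using sum_le_suminf[OF summable_exp_generic[of x, unfolded scaleR_conv_of_real], of "{n}"] that
    by (simp add: divide_inverse mult.commute)
  also have "\<dots> = exp x" by (simp add: exp_def divide_inverse mult.commute)
  finally show ?thesis by (simp add: field_simps)
qed

text \<open>The constant is uniform for \<open>z\<close> in bounded sets. The factor \<open>exp (- pi * w)\<close> is split: one part absorbs
  the powers of \<open>w\<close> and of \<open>ln w\<close>, the rest gives the decay.\<close>

lemma norm_xi_integrand_le:
  fixes X Y :: real
  obtains C where "C \<ge> 0" "\<And>z w. 0 < Re z \<Longrightarrow> Re z \<le> X \<Longrightarrow> \<bar>Im z\<bar> \<le> Y \<Longrightarrow> Re w \<ge> 1 \<Longrightarrow> \<bar>Im w\<bar> \<le> Re w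
    \<Longrightarrow> norm (xi_integrand z w) \<le> C * exp (- Re w)"
proof -
  define K where "K = nat \<lceil>X\<rceil>"
  define C where "C = exp (pi * Y) * 6 ^ (K + 2) * fact (K + 2) * 30"
  have "norm (xi_integrand z w) \<le> C * exp (- Re w)"
    if z: "0 < Re z" "Re z \<le> X" "\<bar>Im z\<bar> \<le> Y" and w: "Re w \<ge> 1" "\<bar>Im w\<bar> \<le> Re w" for z w
  proof -
    define r where "r = Re w"
    have r: "r \<ge> 1" using w by (simp add: r_def)
    have w0: "w \<noteq> 0" using w by auto
    have Y: "Y \<ge> 0" using z by linarith
    have nw: "1 \<le> norm w" "norm w \<le> 2 * r"
      using w abs_Re_le_cmod[of w] cmod_le[of w] by (auto simp: r_def)
    have ln: "0 \<le> ln (norm w)" "ln (norm w) \<le> norm w"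
      using nw ln_le_minus_one[of "norm w"] w0 by auto
    have "norm (Ln w) \<le> \<bar>Re (Ln w)\<bar> + \<bar>Im (Ln w)\<bar>" by (rule cmod_le)
    also have "\<dots> \<le> norm w + pi" using ln w0 Im_Ln_le_pi[OF w0] mpi_less_Im_Ln[OF w0] by simp
    also have "\<dots> \<le> 6 * r" using nw r pi_less_4 by simp
    finally have nL: "norm (Ln w) \<le> 6 * r" .
    have K: "Re z \<le> real K" using z by (simp add: K_def) linarith
    have 1: "norm (Ln w powr z) \<le> (6 * r) ^ K * exp (pi * Y)"
    proof (cases "Ln w = 0")
      case False
      have "Re (z * Ln (Ln w)) = Re z * ln (norm (Ln w)) - Im z * Im (Ln (Ln w))" using False by simp
      also have "\<dots> \<le> real K * ln (6 * r) + pi * Y"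
      proof -
        have "Re z * ln (norm (Ln w)) \<le> Re z * ln (6 * r)" using nL False z by (intro mult_left_mono ln_mono) auto
        also have "\<dots> \<le> real K * ln (6 * r)" using K r by (intro mult_right_mono) auto
        finally have a: "Re z * ln (norm (Ln w)) \<le> real K * ln (6 * r)" .
        have "\<bar>Im z * Im (Ln (Ln w))\<bar> \<le> Y * pi" unfolding abs_mult
          using z Y Im_Ln_le_pi[OF False] mpi_less_Im_Ln[OF False] by (intro mult_mono) auto
        thus ?thesis using a by (simp add: mult.commute)
      qed
      finally have "exp (Re (z * Ln (Ln w))) \<le> exp (real K * ln (6 * r) + pi * Y)" by (simp only: exp_le_cancel_iff)
      also have "\<dots> = (6 * r) ^ K * exp (pi * Y)" using r by (simp add: exp_add exp_of_nat_mult)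
      finally show ?thesis using False by (simp add: powr_def norm_exp_eq_Re)
    qed (use z r in auto)
    have 2: "norm (w powr (5/4)) \<le> (6 * r) ^ 2"
    proof -
      have "norm (w powr (5/4)) = norm w powr (5/4)" using w0 by (simp add: powr_def norm_exp_eq_Re)
      also have "\<dots> \<le> norm w powr 2" using nw by (intro powr_mono) auto
      also have "\<dots> = norm w ^ 2" using nw by simp
      also have "\<dots> \<le> (6 * r) ^ 2" using nw r by (intro power_mono) auto
      finally show ?thesis .
    qed
    have 3: "norm (exp (- (of_real pi * w))) \<le> exp (- (2 * r))"
      using r pi_gt3 by (simp add: norm_exp_eq_Re r_def[symmetric])
    have 4: "norm (xi_series w) \<le> 30" using xi_series_bounds(2) w by simp
    have "norm (xi_integrand z w) \<le> ((6 * r) ^ K * exp (pi * Y)) * (6 * r) ^ 2 * 30 * exp (- (2 * r))"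
      unfolding xi_integrand_def norm_mult using r by (intro mult_mono 1 2 3 4) auto
    also have "\<dots> = exp (pi * Y) * 6 ^ (K + 2) * r ^ (K + 2) * 30 * exp (- (2 * r))"
      by (simp add: power_mult_distrib power_add power2_eq_square)
    also have "\<dots> \<le> exp (pi * Y) * 6 ^ (K + 2) * (fact (K + 2) * exp r) * 30 * exp (- (2 * r))"
      using r by (intro mult_right_mono mult_left_mono power_le_exp) auto
    also have "\<dots> = C * (exp r * exp (- (2 * r)))" by (simp add: C_def)
    also have "exp r * exp (- (2 * r)) = exp (- Re w)" by (simp add: r_def flip: exp_add)
    finally show ?thesis .
  qed
  moreover have "C \<ge> 0" by (simp add: C_def)
  ultimately show ?thesis using that by blast
qed

lemma set_integrable_exp_atLeast:
  assumes "a > 0"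
  shows "set_integrable lborel {0..} (\<lambda>t. exp (- (a * t)) :: real)"
proof -
  have "((\<lambda>t. exp (- (a * t))) has_integral exp (- (a * 0)) / a) {0..}"
    using has_integral_exp_minus_to_infinity[OF assms, of 0] by simp
  hence "(\<lambda>t. exp (- (a * t))) absolutely_integrable_on {0..}"
    by (intro nonnegative_absolutely_integrable_1) (auto simp: integrable_on_def)
  thus ?thesis unfolding set_integrable_def
    by (subst (asm) integrable_completion) auto
qed

lemma lborel_integral_cong_except_0:
  fixes f g :: "real \<Rightarrow> 'a :: {banach, second_countable_topology}"
  assumes "\<And>t. t \<noteq> 0 \<Longrightarrow> f t = g t"
  shows "(LINT t|lborel. f t) = (LINT t|lborel. g t)"
proof -
  have f: "f \<in> borel_measurable lborel \<longleftrightarrow> g \<in> borel_measurable lborel"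
  proof -
    have "h \<in> borel_measurable lborel" if "h' \<in> borel_measurable lborel" "\<And>t. t \<noteq> 0 \<Longrightarrow> h t = h' t" for h h' :: "real \<Rightarrow> 'a"
    proof -
      have "h = (\<lambda>t. if t = 0 then h 0 else h' t)" using that by auto
      moreover have "(\<lambda>t. if t = 0 then h 0 else h' t) \<in> borel_measurable lborel" using that by measurable
      ultimately show ?thesis by simp
    qed
    thus ?thesis using assms by metis
  qed
  show ?thesis
  proof (cases "g \<in> borel_measurable lborel")
    case True
    show ?thesis by (rule integral_cong_AE) (use f True assms AE_lborel_singleton[of "0::real"] in auto)
  next
    case False
    hence "\<not> integrable lborel f" "\<not> integrable lborel g" using f borel_measurable_integrable by blast+
    thus ?thesis by (simp add: not_integrable_integral_eq)
  qed
qed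

lemma sector_point:
  assumes "in_sector 1 c" "t \<ge> 0"
  shows "Re (1 + c * of_real t) \<ge> 1" "\<bar>Im (1 + c * of_real t)\<bar> \<le> Re (1 + c * of_real t)"
    "Re (1 + c * of_real t) = 1 + Re c * t"
  using assms mult_right_mono[of "\<bar>Im c\<bar>" "Re c" t] by (auto simp: in_sector_def abs_mult)

lemma continuous_on_xi_ray:
  assumes "in_sector 1 c" "Re z > 0"
  shows "continuous_on {0..} (\<lambda>t. xi_integrand z (1 + c * of_real t))"
  by (rule continuous_on_compose2[OF continuous_on_xi_integrand])
     (use assms sector_point[OF assms(1)] in \<open>auto intro!: continuous_intros\<close>)

lemma set_integrable_xi_ray:
  assumes c: "in_sector 1 c" and z: "Re z > 0"
  shows "set_integrable lborel {0..} (\<lambda>t. xi_integrand z (1 + c * of_real t))"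
proof -
  obtain C where C: "C \<ge> 0" "\<And>z' w. 0 < Re z' \<Longrightarrow> Re z' \<le> Re z \<Longrightarrow> \<bar>Im z'\<bar> \<le> \<bar>Im z\<bar> \<Longrightarrow> Re w \<ge> 1 \<Longrightarrow> \<bar>Im w\<bar> \<le> Re w
    \<Longrightarrow> norm (xi_integrand z' w) \<le> C * exp (- Re w)" using norm_xi_integrand_le by blast
  have a: "Re c > 0" using c by (simp add: in_sector_def)
  show ?thesis
  proof (rule set_integrable_bound)
    show "set_integrable lborel {0..} (\<lambda>t. C * exp (- (Re c * t)))"
      using set_integrable_exp_atLeast[OF a] by simp
    show "set_borel_measurable lborel {0..} (\<lambda>t. xi_integrand z (1 + c * of_real t))"
      using borel_measurable_continuous_on_indicator[OF _ continuous_on_xi_ray[OF c z]]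
      by (simp add: set_borel_measurable_def)
    show "AE t in lborel. t \<in> {0..} \<longrightarrow> norm (xi_integrand z (1 + c * of_real t)) \<le> norm (C * exp (- (Re c * t)))"
    proof (intro AE_I2 impI)
      fix t :: real assume t: "t \<in> {0..}"
      have "norm (xi_integrand z (1 + c * of_real t)) \<le> C * exp (- Re (1 + c * of_real t))"
        using t sector_point[OF c] z by (intro C(2)) auto
      also have "\<dots> \<le> C * exp (- (Re c * t))" using C(1) by (intro mult_left_mono) auto
      also have "\<dots> \<le> norm (C * exp (- (Re c * t)))" by simp
      finally show "norm (xi_integrand z (1 + c * of_real t)) \<le> norm (C * exp (- (Re c * t)))" .
    qed
  qed
qed

lemma contour_integral_ray:
  assumes c: "in_sector 1 c" and z: "Re z > 0" and T: "T > 0"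
  shows "contour_integral (linepath 1 (1 + c * of_real T)) (xi_integrand z)
     = c * (LINT t:{0..T}|lborel. xi_integrand z (1 + c * of_real t))"
proof -
  let ?f = "\<lambda>t. xi_integrand z (1 + c * of_real t)"
  have cont: "continuous_on {0..T} ?f"
    by (rule continuous_on_subset[OF continuous_on_xi_ray[OF c z]]) auto
  have int: "set_integrable lborel {0..T} ?f" by (rule borel_integrable_atLeastAtMost'[OF cont])
  have "(?f has_integral (LINT t:{0..T}|lborel. ?f t)) {0..T}"
    using has_integral_set_lebesgue[of "{0..T}" ?f] set_borel_integral_eq_integral[OF int] integrable_integral by metis
  hence "((\<lambda>x. ?f (T * x + 0)) has_integral (1 / \<bar>T\<bar> ^ DIM(real)) *\<^sub>R (LINT t:{0..T}|lborel. ?f t)) ((\<lambda>x. (1 / T) *\<^sub>R x + - ((1 / T) *\<^sub>R 0)) ` {0..T})"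
    using has_integral_affinity[of ?f _ 0 T T 0] T by simp
  moreover have "(\<lambda>x. (1 / T) *\<^sub>R x + - ((1 / T) *\<^sub>R 0)) ` {0..T} = {0..1}"
    using T by (auto simp: image_iff divide_le_eq intro!: bexI[of _ "T * _"])
  ultimately have "((\<lambda>x. ?f (T * x)) has_integral (1 / T) *\<^sub>R (LINT t:{0..T}|lborel. ?f t)) {0..1}"
    using T by simp
  hence "((\<lambda>x. ?f (T * x) * (c * of_real T)) has_integral ((1 / T) *\<^sub>R (LINT t:{0..T}|lborel. ?f t)) * (c * of_real T)) {0..1}"
    by (rule has_integral_mult_left)
  moreover have "1 + c * of_real (T * x) = linepath 1 (1 + c * of_real T) x" for x
    by (simp add: linepath_def scaleR_conv_of_real algebra_simps)
  ultimately have "(xi_integrand z has_contour_integral ((1 / T) *\<^sub>R (LINT t:{0..T}|lborel. ?f t)) * (c * of_real T)) (linepath 1 (1 + c * of_real T))"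
    by (simp add: has_contour_integral_linepath)
  thus ?thesis using T by (simp add: contour_integral_unique scaleR_conv_of_real)
qed

lemma ray_truncation_tendsto:
  assumes c: "in_sector 1 c" and z: "Re z > 0"
  shows "(\<lambda>n. LINT t:{0..real n}|lborel. xi_integrand z (1 + c * of_real t)) \<longlonglongrightarrow> ray_integral c z"
  unfolding ray_integral_def set_lebesgue_integral_def
proof (rule integral_dominated_convergence)
  let ?f = "\<lambda>t. xi_integrand z (1 + c * of_real t)"
  have I: "integrable lborel (\<lambda>t. indicator {0..} t *\<^sub>R ?f t)"
    using set_integrable_xi_ray[OF c z] by (simp add: set_integrable_def)
  show "(\<lambda>t. indicator {0..} t *\<^sub>R ?f t) \<in> borel_measurable lborel" using I by simp
  show "integrable lborel (\<lambda>t. norm (indicator {0..} t *\<^sub>R ?f t))" using I by (rule integrable_norm)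
  have "set_integrable lborel {0..real n} ?f" for n
    by (rule set_integrable_subset[OF set_integrable_xi_ray[OF c z]]) auto
  thus "(\<lambda>t. indicator {0..real n} t *\<^sub>R ?f t) \<in> borel_measurable lborel" for n by (simp add: set_integrable_def)
  show "AE t in lborel. (\<lambda>n. indicator {0..real n} t *\<^sub>R ?f t) \<longlonglongrightarrow> indicator {0..} t *\<^sub>R ?f t"
  proof (rule AE_I2)
    fix t :: real
    have "\<forall>\<^sub>F n in sequentially. t \<le> real n"
      using filterlim_real_sequentially unfolding filterlim_at_top by blast
    hence "\<forall>\<^sub>F n in sequentially. indicator {0..real n} t *\<^sub>R ?f t = indicator {0..} t *\<^sub>R ?f t"
      by eventually_elim (auto simp: indicator_def)
    thus "(\<lambda>n. indicator {0..real n} t *\<^sub>R ?f t) \<longlonglongrightarrow> indicator {0..} t *\<^sub>R ?f t" by (rule tendsto_eventually)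
  qed
  show "AE t in lborel. norm (indicator {0..real n} t *\<^sub>R ?f t) \<le> norm (indicator {0..} t *\<^sub>R ?f t)" for n
    by (rule AE_I2) (auto simp: indicator_def)
qed

text \<open>Cauchy's theorem for the triangle with vertices \<open>1\<close>, \<open>1 + n * Re c\<close> and \<open>1 + n * c\<close>. The integrand is
  only continuous at the vertex \<open>1\<close>, and on the vertical side it decays like \<open>exp (- n * Re c)\<close>.\<close>

lemma ray_integral_rotate_aux:
  assumes c: "in_sector 1 c" and z: "Re z > 0"
  shows "c * ray_integral c z = of_real (Re c) * ray_integral (of_real (Re c)) z"
proof -
  define a where "a = (of_real (Re c) :: complex)"
  have rc: "Re c > 0" using c by (simp add: in_sector_def)
  have a: "in_sector 1 a" using c by (simp add: a_def in_sector_def)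
  obtain C where C: "C \<ge> 0" "\<And>z' w. 0 < Re z' \<Longrightarrow> Re z' \<le> Re z \<Longrightarrow> \<bar>Im z'\<bar> \<le> \<bar>Im z\<bar> \<Longrightarrow> Re w \<ge> 1 \<Longrightarrow> \<bar>Im w\<bar> \<le> Re w
    \<Longrightarrow> norm (xi_integrand z' w) \<le> C * exp (- Re w)" using norm_xi_integrand_le by blast
  let ?F = "xi_integrand z"
  let ?I = "\<lambda>p q. contour_integral (linepath p q) ?F"
  define A where "A = (\<lambda>n. 1 + a * of_real (real n))"
  define B where "B = (\<lambda>n. 1 + c * of_real (real n))"
  have hull: "convex hull {1, A n, B n} \<subseteq> {w. Re w \<ge> 1}" for n
    using rc by (intro hull_minimal convex_halfspace_Re_ge) (auto simp: A_def B_def a_def)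
  have seg: "closed_segment (A n) (B n) \<subseteq> {w. Re w = 1 + Re c * real n \<and> \<bar>Im w\<bar> \<le> Re w}" for n
  proof (rule closed_segment_subset)
    have "\<bar>Im c * real n\<bar> \<le> Re c * real n" using c unfolding in_sector_def abs_mult by (intro mult_mono) auto
    thus "A n \<in> {w. Re w = 1 + Re c * real n \<and> \<bar>Im w\<bar> \<le> Re w}" "B n \<in> {w. Re w = 1 + Re c * real n \<and> \<bar>Im w\<bar> \<le> Re w}"
      using rc by (auto simp: A_def B_def a_def)
    have "{w. Re w = 1 + Re c * real n \<and> \<bar>Im w\<bar> \<le> Re w}
        = {w. Re w \<le> 1 + Re c * real n} \<inter> {w. Re w \<ge> 1 + Re c * real n} \<inter> {w. Im w \<le> 1 + Re c * real n} \<inter> {w. Im w \<ge> - (1 + Re c * real n)}"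
      by auto
    also have "convex \<dots>" by (intro convex_Int convex_halfspace_Im_le convex_halfspace_Im_ge
        convex_halfspace_Re_le convex_halfspace_Re_ge)
    finally show "convex {w. Re w = 1 + Re c * real n \<and> \<bar>Im w\<bar> \<le> Re w}" .
  qed
  have tri: "?I 1 (A n) + ?I (A n) (B n) - ?I 1 (B n) = 0" for n
  proof -
    have cont: "continuous_on (convex hull {1, A n, B n}) ?F"
      by (rule continuous_on_subset[OF continuous_on_xi_integrand[OF z] hull])
    have "interior (convex hull {1, A n, B n}) \<subseteq> interior {w. Re w \<ge> 1}" by (rule interior_mono[OF hull])
    hence "interior (convex hull {1, A n, B n}) \<subseteq> {w. Re w > 1}"
      using interior_halfspace_ge[of "1 :: complex" 1] by (simp add: inner_complex_def)
    hence hol: "?F holomorphic_on interior (convex hull {1, A n, B n})"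
      by (rule holomorphic_on_subset[OF holomorphic_xi_integrand])
    have 0: "(?F has_contour_integral 0) (linepath 1 (A n) +++ linepath (A n) (B n) +++ linepath (B n) 1)"
      by (rule Cauchy_theorem_triangle_interior[OF cont hol])
    have ci: "?F contour_integrable_on linepath p q" if "p \<in> {1, A n, B n}" "q \<in> {1, A n, B n}" for p q
    proof (rule contour_integrable_continuous_linepath, rule continuous_on_subset[OF cont])
      show "closed_segment p q \<subseteq> convex hull {1, A n, B n}"
        unfolding segment_convex_hull using that by (intro hull_mono) auto
    qed
    have "contour_integral (linepath 1 (A n) +++ linepath (A n) (B n) +++ linepath (B n) 1) ?F = ?I 1 (A n) + (?I (A n) (B n) + ?I (B n) 1)"
      using ci by (simp add: contour_integrable_join)
    moreover have "?I (B n) 1 = - ?I 1 (B n)" using ci by (intro contour_integral_reverse_linepath continuous_on_subset[OF cont]) (auto simp: segment_convex_hull intro!: hull_mono)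
    ultimately show ?thesis using contour_integral_unique[OF 0] by (simp add: algebra_simps)
  qed
  have side: "(\<lambda>n. ?I (A n) (B n)) \<longlonglongrightarrow> 0"
  proof (rule Lim_null_comparison)
    show "\<forall>\<^sub>F n in sequentially. norm (?I (A n) (B n)) \<le> (C * \<bar>Im c\<bar>) * (real n * exp (- (Re c * real n)))"
    proof (rule always_eventually, rule allI)
      fix n
      have "?F contour_integrable_on linepath (A n) (B n)"
        using seg[of n] rc by (intro contour_integrable_continuous_linepath continuous_on_subset[OF continuous_on_xi_integrand[OF z]]) auto
      hence "norm (?I (A n) (B n)) \<le> (C * exp (- (Re c * real n))) * norm (B n - A n)"
      proof (rule contour_integral_bound_linepath)
        fix w assume "w \<in> closed_segment (A n) (B n)"
        hence w: "Re w = 1 + Re c * real n" "\<bar>Im w\<bar> \<le> Re w" using seg by auto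
        hence "norm (?F w) \<le> C * exp (- Re w)" using rc z by (intro C(2)) auto
        also have "\<dots> \<le> C * exp (- (Re c * real n))" using C(1) w by (intro mult_left_mono) auto
        finally show "norm (?F w) \<le> C * exp (- (Re c * real n))" .
      qed (use C in auto)
      also have "B n - A n = \<i> * of_real (Im c * real n)"
        by (simp add: A_def B_def a_def complex_eq_iff)
      also have "norm \<dots> = \<bar>Im c\<bar> * real n" by (simp add: norm_mult abs_mult)
      finally show "norm (?I (A n) (B n)) \<le> (C * \<bar>Im c\<bar>) * (real n * exp (- (Re c * real n)))" by (simp add: mult_ac)
    qed
    have "((\<lambda>x::real. (Re c * x) ^ 1 / exp (Re c * x)) \<longlongrightarrow> 0) at_top"
      by (rule filterlim_compose[OF tendsto_power_div_exp_0]) (use rc in \<open>auto intro!: filterlim_tendsto_pos_mult_at_top filterlim_ident\<close>)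
    hence "(\<lambda>n. (Re c * real n) ^ 1 / exp (Re c * real n)) \<longlonglongrightarrow> 0"
      by (rule filterlim_compose[OF _ filterlim_real_sequentially])
    hence "(\<lambda>n. (C * \<bar>Im c\<bar> / Re c) * ((Re c * real n) ^ 1 / exp (Re c * real n))) \<longlonglongrightarrow> (C * \<bar>Im c\<bar> / Re c) * 0"
      by (rule tendsto_mult_left)
    moreover have "(C * \<bar>Im c\<bar> / Re c) * ((Re c * real n) ^ 1 / exp (Re c * real n))
        = (C * \<bar>Im c\<bar>) * (real n * exp (- (Re c * real n)))" for n
      using rc by (simp add: exp_minus divide_inverse)
    ultimately show "(\<lambda>n. (C * \<bar>Im c\<bar>) * (real n * exp (- (Re c * real n)))) \<longlonglongrightarrow> 0"
      by (simp only: mult_zero_right)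
  qed
  have lim: "(\<lambda>n. ?I 1 (1 + d * of_real (real n))) \<longlonglongrightarrow> d * ray_integral d z" if d: "in_sector 1 d" for d
  proof (rule Lim_transform_eventually)
    show "(\<lambda>n. d * (LINT t:{0..real n}|lborel. xi_integrand z (1 + d * of_real t))) \<longlonglongrightarrow> d * ray_integral d z"
      by (intro tendsto_mult_left ray_truncation_tendsto d z)
    show "\<forall>\<^sub>F n in sequentially. d * (LINT t:{0..real n}|lborel. xi_integrand z (1 + d * of_real t)) = ?I 1 (1 + d * of_real (real n))"
      using eventually_gt_at_top[of 0] by eventually_elim (simp add: contour_integral_ray[OF d z, symmetric])
  qed
  have "(\<lambda>n. ?I 1 (A n) + ?I (A n) (B n) - ?I 1 (B n)) \<longlonglongrightarrow> a * ray_integral a z + 0 - c * ray_integral c z"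
    using lim[OF a] lim[OF c] side unfolding A_def B_def by (intro tendsto_add tendsto_diff) auto
  hence "a * ray_integral a z + 0 - c * ray_integral c z = 0"
    unfolding tri using LIMSEQ_unique tendsto_const by metis
  thus ?thesis by (simp add: a_def)
qed

lemma ray_integral_scale:
  assumes a: "a > 0"
  shows "of_real a * ray_integral (of_real a) z = ray_integral 1 z"
proof -
  let ?f = "\<lambda>t. indicator {0..} t *\<^sub>R xi_integrand z (1 + of_real t)"
  have "(LINT t|lborel. ?f t) = \<bar>a\<bar> *\<^sub>R (LINT t|lborel. ?f (0 + a * t))"
    using a by (intro lborel_integral_real_affine) auto
  also have "(\<lambda>t. ?f (0 + a * t)) = (\<lambda>t. indicator {0..} t *\<^sub>R xi_integrand z (1 + of_real a * of_real t))"
    using a by (auto simp: fun_eq_iff indicator_def zero_le_mult_iff)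
  finally show ?thesis using a by (simp add: ray_integral_def set_lebesgue_integral_def scaleR_conv_of_real)
qed

theorem ray_integral_rotate:
  assumes "in_sector 1 c" "Re z > 0"
  shows "c * ray_integral c z = ray_integral 1 z"
  using ray_integral_rotate_aux[OF assms] ray_integral_scale[of "Re c" z] assms by (simp add: in_sector_def)

section \<open>Moments of Phi as ray integrals\<close>

lemma sector_1_1: "in_sector 1 1"
  by (simp add: in_sector_def)

lemma holomorphic_truncated_ray_integral:
  assumes a: "0 < a"
  shows "(\<lambda>z. integral {a..b} (\<lambda>t. xi_integrand z (1 + of_real t))) holomorphic_on {z. Re z > 0}"
proof -
  define G where "G = (\<lambda>t::real. Ln (Ln (1 + of_real t)))"
  define K where "K = (\<lambda>t::real. exp (- (of_real pi * (1 + of_real t))) * exp (5/4 * Ln (1 + of_real t)) * xi_series (1 + of_real t))"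
  have pt: "Re (1 + of_real t) \<ge> 1" "1 + of_real t \<noteq> (1::complex)" "1 + of_real t \<noteq> (0::complex)" if "t \<in> {a..b}" for t
  proof -
    show "Re (1 + of_real t) \<ge> 1" "1 + of_real t \<noteq> (1::complex)" using that a by auto
    have "Re (1 + of_real t) > 0" using that a by simp
    thus "1 + of_real t \<noteq> (0::complex)" by (metis less_irrefl zero_complex.sel(1))
  qed
  have np: "Ln (1 + of_real t) \<notin> \<real>\<^sub>\<le>\<^sub>0" "1 + of_real t \<notin> (\<real>\<^sub>\<le>\<^sub>0 :: complex set)" if "t \<in> {a..b}" for t
    using Ln_not_nonpos_Reals(2)[OF pt(1,2)[OF that]] pt(1)[OF that] by (auto simp: complex_nonpos_Reals_iff)
  have contG: "continuous_on {a..b} G" unfolding G_def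
    using np by (intro continuous_intros) auto
  have contx: "continuous_on {a..b} (\<lambda>t. xi_series (1 + of_real t))"
    by (rule continuous_on_compose2[OF holomorphic_on_imp_continuous_on[OF holomorphic_xi_series]])
       (use a in \<open>auto intro!: continuous_intros\<close>)
  have contK: "continuous_on {a..b} K" unfolding K_def
    using np by (intro continuous_intros contx) auto
  have eq: "xi_integrand z (1 + of_real t) = exp (z * G t) * K t" if "t \<in> {a..b}" for z t
  proof -
    have p: "(1 + of_real t) powr (5/4) = exp (5/4 * Ln (1 + of_real t :: complex))"
      using pt(3)[OF that] by (simp only: powr_def if_False)
    have "exp (z * Ln (Ln (1 + of_real t)) - of_real pi * (1 + of_real t))
       = exp (z * G t) * exp (- (of_real pi * (1 + of_real t)))"
      by (simp only: G_def diff_conv_add_uminus exp_add)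
    thus ?thesis using xi_integrand_exp[OF pt(1,2)[OF that], of z]
      by (simp only: p K_def mult.assoc)
  qed
  have "(\<lambda>z. integral (cbox a b) (\<lambda>t. exp (z * G t) * K t)) holomorphic_on {z. Re z > 0}"
  proof (rule leibniz_rule_holomorphic)
    show "((\<lambda>z. exp (z * G t) * K t) has_field_derivative exp (z * G t) * G t * K t) (at z within {z. Re z > 0})" for z t
      by (auto intro!: derivative_eq_intros)
    show "(\<lambda>t. exp (z * G t) * K t) integrable_on cbox a b" for z
      unfolding interval_cbox[symmetric] by (intro integrable_continuous_real continuous_intros contG contK)
    have "continuous_on ({z. Re z > 0} \<times> cbox a b) (\<lambda>p. exp (fst p * G (snd p)) * G (snd p) * K (snd p))"
      by (intro continuous_intros continuous_on_compose2[OF contG] continuous_on_compose2[OF contK]) auto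
    thus "continuous_on ({z. Re z > 0} \<times> cbox a b) (\<lambda>(z, t). exp (z * G t) * G t * K t)"
      by (simp only: case_prod_unfold)
    show "convex {z. Re z > 0}" by (rule convex_halfspace_Re_gt)
  qed
  moreover have "integral (cbox a b) (\<lambda>t. exp (z * G t) * K t) = integral {a..b} (\<lambda>t. xi_integrand z (1 + of_real t))" for z
    unfolding interval_cbox[symmetric] by (rule integral_cong) (simp only: eq)
  ultimately show ?thesis by (simp only:)
qed

text \<open>Truncating to \<open>1 / (n + 1) \<le> t \<le> n + 1\<close> avoids the logarithmic singularity at \<open>t = 0\<close>, and the error is bounded
  by a multiple of the tail of the integral of \<open>exp (- t)\<close>, locally uniformly in \<open>z\<close>.\<close>

lemma holomorphic_ray_integral: "ray_integral 1 holomorphic_on {z. Re z > 0}"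
proof (rule holomorphic_uniform_sequence)
  define I where "I = (\<lambda>n::nat. {1 / (real n + 1)..real n + 1})"
  define f where "f = (\<lambda>n z. integral (I n) (\<lambda>t. xi_integrand z (1 + of_real t)))"
  show op: "open {z. Re z > 0}" by (rule open_halfspace_Re_gt)
  show "f n holomorphic_on {z. Re z > 0}" for n
    unfolding f_def I_def by (rule holomorphic_truncated_ray_integral) simp
  define E where "E = (\<lambda>n. LINT t|lborel. indicator ({0..} - I n) t *\<^sub>R exp (- (1 * t)))"
  have Eint: "integrable lborel (\<lambda>t. indicator {0..} t *\<^sub>R exp (- (1 * t)) :: real)"
    using set_integrable_exp_atLeast[of 1] by (simp add: set_integrable_def)
  have E0: "E \<longlonglongrightarrow> (LINT t::real|lborel. 0)" unfolding E_def
  proof (rule integral_dominated_convergence)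
    show "integrable lborel (\<lambda>t. indicator {0..} t *\<^sub>R exp (- (1 * t)) :: real)" by (rule Eint)
    show "(\<lambda>t. 0) \<in> borel_measurable lborel" by simp
    show "(\<lambda>t. indicator ({0..} - I n) t *\<^sub>R exp (- (1 * t)) :: real) \<in> borel_measurable lborel" for n
      unfolding I_def by simp
    show "AE t in lborel. norm (indicator ({0..} - I n) t *\<^sub>R exp (- (1 * t)) :: real) \<le> indicator {0..} t *\<^sub>R exp (- (1 * t))" for n
      by (rule AE_I2) (auto simp: indicator_def)
    show "AE t in lborel. (\<lambda>n. indicator ({0..} - I n) t *\<^sub>R exp (- (1 * t)) :: real) \<longlonglongrightarrow> 0"
      using AE_lborel_singleton[of "0::real"]
    proof eventually_elim
      fix t :: real assume t: "t \<noteq> 0"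
      show "(\<lambda>n. indicator ({0..} - I n) t *\<^sub>R exp (- (1 * t)) :: real) \<longlonglongrightarrow> 0"
      proof (cases "t > 0")
        case True
        have "\<forall>\<^sub>F n in sequentially. max t (1 / t) \<le> real n"
          using filterlim_real_sequentially unfolding filterlim_at_top by blast
        hence "\<forall>\<^sub>F n in sequentially. indicator ({0..} - I n) t *\<^sub>R exp (- (1 * t)) = (0::real)"
        proof eventually_elim
          fix n assume n: "max t (1 / t) \<le> real n"
          have "1 \<le> t * (real n + 1)" using n True by (simp add: field_simps)
          hence "t \<in> I n" using n True by (simp add: I_def field_simps)
          thus "indicator ({0..} - I n) t *\<^sub>R exp (- (1 * t)) = (0::real)" by simp
        qed
        thus ?thesis by (rule tendsto_eventually)
      qed (use t in \<open>simp add: indicator_def\<close>)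
    qed
  qed
  fix x :: complex assume "x \<in> {z. Re z > 0}"
  then obtain d where d: "d > 0" "cball x d \<subseteq> {z. Re z > 0}"
    using op open_contains_cball by metis
  obtain C where C: "C \<ge> 0" "\<And>z w. 0 < Re z \<Longrightarrow> Re z \<le> Re x + d \<Longrightarrow> \<bar>Im z\<bar> \<le> \<bar>Im x\<bar> + d \<Longrightarrow> Re w \<ge> 1 \<Longrightarrow> \<bar>Im w\<bar> \<le> Re w
    \<Longrightarrow> norm (xi_integrand z w) \<le> C * exp (- Re w)" using norm_xi_integrand_le by blast
  have bd: "norm (f n z - ray_integral 1 z) \<le> C * E n" if z: "z \<in> cball x d" for n z
  proof -
    have rz: "Re z > 0" "Re z \<le> Re x + d" "\<bar>Im z\<bar> \<le> \<bar>Im x\<bar> + d"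
    proof -
      show "Re z > 0" using z d by auto
      have "\<bar>Re (z - x)\<bar> \<le> d" "\<bar>Im (z - x)\<bar> \<le> d"
        using z abs_Re_le_cmod[of "z - x"] abs_Im_le_cmod[of "z - x"] by (auto simp: dist_norm norm_minus_commute)
      thus "Re z \<le> Re x + d" "\<bar>Im z\<bar> \<le> \<bar>Im x\<bar> + d" by auto
    qed
    let ?g = "\<lambda>t. xi_integrand z (1 + of_real t)"
    have SI: "set_integrable lborel {0..} ?g" using set_integrable_xi_ray[OF sector_1_1 rz(1)] by simp
    have sub: "I n \<subseteq> {0..}"
    proof
      fix t assume "t \<in> I n"
      hence "1 / (real n + 1) \<le> t" by (simp add: I_def)
      moreover have "0 \<le> 1 / (real n + 1)" by simp
      ultimately have "0 \<le> t" by linarith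
      thus "t \<in> {0..}" by simp
    qed
    have SI': "set_integrable lborel (I n) ?g" "set_integrable lborel ({0..} - I n) ?g"
      by (rule set_integrable_subset[OF SI]; use sub in \<open>auto simp: I_def\<close>)+
    have fn: "f n z = (LINT t:I n|lborel. ?g t)"
      unfolding f_def using set_borel_integral_eq_integral(2)[OF SI'(1)] by simp
    have "ray_integral 1 z = (LINT t:I n \<union> ({0..} - I n)|lborel. ?g t)"
      using sub by (simp add: ray_integral_def Un_absorb1)
    also have "\<dots> = (LINT t:I n|lborel. ?g t) + (LINT t:{0..} - I n|lborel. ?g t)"
      by (rule set_integral_Un[OF _ SI']) auto
    finally have "norm (f n z - ray_integral 1 z) = norm (LINT t:{0..} - I n|lborel. ?g t)"
      by (simp add: fn)
    also have "\<dots> \<le> (LINT t|lborel. norm (indicator ({0..} - I n) t *\<^sub>R ?g t))"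
      unfolding set_lebesgue_integral_def by (rule integral_norm_bound)
    also have "\<dots> \<le> (LINT t|lborel. C * (indicator ({0..} - I n) t *\<^sub>R exp (- (1 * t))))"
    proof (rule integral_mono)
      show "integrable lborel (\<lambda>t. norm (indicator ({0..} - I n) t *\<^sub>R ?g t))"
        using SI'(2) unfolding set_integrable_def by (rule integrable_norm)
      have "set_integrable lborel ({0..} - I n) (\<lambda>t. exp (- (1 * t)) :: real)"
        by (rule set_integrable_subset[OF set_integrable_exp_atLeast]) (auto simp: I_def)
      thus "integrable lborel (\<lambda>t. C * (indicator ({0..} - I n) t *\<^sub>R exp (- (1 * t))))"
        unfolding set_integrable_def by (rule integrable_mult_right)
      fix t :: real
      show "norm (indicator ({0..} - I n) t *\<^sub>R ?g t) \<le> C * (indicator ({0..} - I n) t *\<^sub>R exp (- (1 * t)))"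
      proof (cases "t \<in> {0..} - I n")
        case True
        hence "norm (?g t) \<le> C * exp (- Re (1 + of_real t))" using rz by (intro C(2)) auto
        also have "\<dots> \<le> C * exp (- (1 * t))" using C(1) by (intro mult_left_mono) auto
        finally show ?thesis using True by simp
      qed simp
    qed
    also have "\<dots> = C * E n" by (simp add: E_def)
    finally show ?thesis .
  qed
  have "uniform_limit (cball x d) f (ray_integral 1) sequentially"
  proof (rule uniform_limitI)
    fix e :: real assume e: "e > 0"
    have "(\<lambda>n. C * E n) \<longlonglongrightarrow> C * 0" using E0 by (intro tendsto_mult_left) simp
    hence "\<forall>\<^sub>F n in sequentially. C * E n < e" using e by (intro order_tendstoD(2)) auto
    thus "\<forall>\<^sub>F n in sequentially. \<forall>z\<in>cball x d. dist (f n z) (ray_integral 1 z) < e"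
    proof eventually_elim
      fix n assume "C * E n < e"
      thus "\<forall>z\<in>cball x d. dist (f n z) (ray_integral 1 z) < e"
        using bd[of _ n] by (metis dist_norm le_less_trans)
    qed
  qed
  thus "\<exists>d>0. cball x d \<subseteq> {z. Re z > 0} \<and> uniform_limit (cball x d) f (ray_integral 1) sequentially"
    using d by blast
qed

lemma Phi_eq:
  assumes "u \<ge> 0"
  shows "complex_of_real (Phi u) = of_real (exp (9 * u) * exp (- (pi * exp (4 * u)))) * xi_series (of_real (exp (4 * u)))"
proof -
  define w where "w = exp (4 * u)"
  define E where "E = exp (9 * u) * exp (- (pi * w))"
  define p where "p = (\<lambda>m. let n = real (Suc m) in (2 * pi ^ 2 * n ^ 4 * exp (9 * u) - 3 * pi * n ^ 2 * exp (5 * u)) * exp (- (pi * n ^ 2 * exp (4 * u))))"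
  have w: "w \<ge> 1" using assms by (simp add: w_def)
  have tm: "complex_of_real (p m) = of_real E * xi_term m (of_real w)" for m
  proof -
    define n where "n = real (Suc m)"
    have 5: "exp (5 * u) = exp (9 * u) / w" by (simp add: w_def exp_diff[symmetric])
    have "p m = (2 * pi ^ 2 * n ^ 4 * exp (9 * u) - 3 * pi * n ^ 2 * (exp (9 * u) / w)) * exp (- (pi * n ^ 2 * w))"
      by (simp only: p_def Let_def n_def[symmetric] 5 w_def[symmetric])
    also have "- (pi * n ^ 2 * w) = - (pi * w) + - (pi * (n ^ 2 - 1) * w)" by (simp add: algebra_simps)
    also have "(2 * pi ^ 2 * n ^ 4 * exp (9 * u) - 3 * pi * n ^ 2 * (exp (9 * u) / w)) * exp (- (pi * w) + - (pi * (n ^ 2 - 1) * w))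
       = E * ((2 * pi ^ 2 * n ^ 4 - 3 * pi * n ^ 2 / w) * exp (- (pi * (n ^ 2 - 1) * w)))"
      unfolding E_def exp_add by (simp add: algebra_simps)
    finally have "complex_of_real (p m) = of_real \<dots>" by (simp only:)
    also have "\<dots> = of_real E * xi_term m (of_real w)"
      by (simp add: xi_term_def n_def exp_of_real[symmetric] del: of_nat_Suc)
    finally show ?thesis .
  qed
  have "(\<lambda>m. xi_term m (of_real w)) sums xi_series (of_real w)"
    unfolding xi_series_def using w by (intro summable_sums summable_xi_term) auto
  hence s: "(\<lambda>m. complex_of_real (p m)) sums (of_real E * xi_series (of_real w))"
    unfolding tm by (rule sums_mult)
  have "p sums Re (of_real E * xi_series (of_real w))"
    using sums_Re[OF s] by simp
  hence P: "Phi u = Re (of_real E * xi_series (of_real w))"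
    unfolding Phi_def p_def[symmetric] by (simp add: sums_iff)
  have "(\<lambda>m. 0) sums Im (of_real E * xi_series (of_real w))"
    using sums_Im[OF s] by simp
  hence "Im (of_real E * xi_series (of_real w)) = 0" using sums_0 sums_unique2 by blast
  thus ?thesis using P unfolding E_def w_def by (simp add: complex_eq_iff)
qed

text \<open>Read off from \<open>Phi_eq\<close>, where all other quantities are real.\<close>

lemma xi_series_of_real:
  assumes "w \<ge> 1"
  shows "xi_series (of_real w) = of_real (Re (xi_series (of_real w)))"
proof -
  define u where "u = ln w / 4"
  have u: "u \<ge> 0" "exp (4 * u) = w" using assms by (auto simp: u_def)
  define E where "E = exp (9 * u) * exp (- (pi * w))"
  have E: "E > 0" by (simp add: E_def)
  have "Im (of_real E * xi_series (of_real w)) = Im (of_real (Phi u))"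
    using Phi_eq[OF u(1)] by (simp only: u(2) E_def)
  hence "Im (xi_series (of_real w)) = 0" using E by simp
  thus ?thesis by (simp add: complex_eq_iff)
qed

lemma xi_integrand_of_nat:
  assumes "t > 0" "j > 0"
  shows "xi_integrand (of_nat j) (1 + of_real t)
    = of_real (ln (1 + t) ^ j * (1 + t) powr (5/4) * Re (xi_series (of_real (1 + t))) * exp (- (pi * (1 + t))))"
proof -
  have w: "(1 + of_real t :: complex) = of_real (1 + t)" by simp
  have a: "Ln (of_real (1 + t)) powr of_nat j = of_real (ln (1 + t) ^ j)"
    using assms by (subst powr_nat') (auto simp: Ln_of_real simp del: of_real_add)
  have b: "of_real (1 + t) powr (5/4 :: complex) = of_real ((1 + t) powr (5/4))"
    using powr_of_real[of "1 + t" "5/4"] assms by simp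
  have c: "exp (- (complex_of_real pi * of_real (1 + t))) = of_real (exp (- (pi * (1 + t))))"
    by (simp add: exp_of_real[symmetric])
  have d: "xi_series (of_real (1 + t)) = of_real (Re (xi_series (of_real (1 + t))))"
    using assms by (intro xi_series_of_real) auto
  show ?thesis unfolding xi_integrand_def w a b c by (subst d) (simp only: of_real_mult)
qed

lemma isCont_Phi:
  assumes "u > 0"
  shows "isCont Phi u"
proof -
  have ex: "1/2 < exp (4 * x)" if "x > 0" for x :: real
    using one_less_exp_iff[of "4 * x"] that by linarith
  have "continuous_on {0<..} (\<lambda>u. Re (of_real (exp (9 * u) * exp (- (pi * exp (4 * u)))) * xi_series (of_real (exp (4 * u)))))"
  proof (intro continuous_intros)
    show "continuous_on {0<..} (\<lambda>u::real. xi_series (of_real (exp (4 * u))))"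
      by (rule continuous_on_compose2[OF holomorphic_on_imp_continuous_on[OF holomorphic_xi_series]])
         (use ex in \<open>auto intro!: continuous_intros\<close>)
  qed
  moreover have "Re (of_real (exp (9 * u) * exp (- (pi * exp (4 * u)))) * xi_series (of_real (exp (4 * u)))) = Phi u"
    if "u \<in> {0<..}" for u
    using Phi_eq[of u] that by (metis Re_complex_of_real greaterThan_iff less_imp_le)
  ultimately have "continuous_on {0<..} Phi" by (rule continuous_on_eq)
  thus ?thesis using assms by (simp add: continuous_on_eq_continuous_at)
qed

lemma Phi_nonneg: "u \<ge> 0 \<Longrightarrow> Phi u \<ge> 0"
proof -
  assume u: "u \<ge> 0"
  have "Re (complex_of_real (Phi u)) = exp (9 * u) * exp (- (pi * exp (4 * u))) * Re (xi_series (of_real (exp (4 * u))))"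
    unfolding Phi_eq[OF u] by simp
  moreover have "Re (xi_series (of_real (exp (4 * u)))) \<ge> 9" using u by (intro xi_series_bounds) auto
  ultimately show ?thesis by simp
qed

text \<open>The substitution \<open>u = ln (1 + t) / 4\<close>; the factor \<open>1 / (4 * (1 + t))\<close> lowers the exponent \<open>9/4\<close> of
  \<open>1 + t\<close> to \<open>5/4\<close>.\<close>

lemma xi_coeff_eq_ray_integral:
  assumes m: "m > 0"
  shows "complex_of_real (xi_coeff (int m)) = ray_integral 1 (of_nat (2 * m)) / (4 ^ (2 * m + 1) * fact (2 * m))"
proof -
  define f where "f = (\<lambda>u. u ^ (2 * m) * Phi u)"
  define g where "g = (\<lambda>t::real. ln (1 + t) / 4)"
  define g' where "g' = (\<lambda>t::real. 1 / (4 * (1 + t)))"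
  define F where "F = (\<lambda>t. xi_integrand (of_nat (2 * m)) (1 + of_real t))"
  have fg: "f (g t) * g' t = Re (F t) / 4 ^ (2 * m + 1)" if t: "t > 0" for t
  proof -
    have w: "exp (4 * g t) = 1 + t" using t by (simp add: g_def)
    have g0: "g t \<ge> 0" using t by (simp add: g_def)
    have "Re (complex_of_real (Phi (g t))) = exp (9 * g t) * exp (- (pi * (1 + t))) * Re (xi_series (of_real (1 + t)))"
      unfolding Phi_eq[OF g0] w by simp
    hence P: "Phi (g t) = exp (9 * g t) * exp (- (pi * (1 + t))) * Re (xi_series (of_real (1 + t)))" by simp
    have "9 * g t = 5/4 * ln (1 + t) + ln (1 + t)" by (simp add: g_def)
    hence "exp (9 * g t) = exp (5/4 * ln (1 + t)) * exp (ln (1 + t))" by (simp only: exp_add)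
    hence e: "exp (9 * g t) = (1 + t) powr (5/4) * (1 + t)" using t by (simp add: powr_def)
    have RF: "Re (F t) = ln (1 + t) ^ (2 * m) * (1 + t) powr (5/4) * Re (xi_series (of_real (1 + t))) * exp (- (pi * (1 + t)))"
      unfolding F_def using xi_integrand_of_nat[OF t, of "2 * m"] m by (simp only: Re_complex_of_real)
    have fge: "f (g t) * g' t = (ln (1 + t) / 4) ^ (2 * m) * ((1 + t) powr (5/4) * exp (- (pi * (1 + t))) * Re (xi_series (of_real (1 + t)))) * ((1 + t) * g' t)"
      unfolding f_def P e by (simp add: g_def)
    have K: "(1 + t) * g' t = 1/4" using t by (simp add: g'_def field_simps)
    show ?thesis unfolding fge K RF by (simp add: power_divide mult_ac)
  qed
  have SF: "set_integrable lborel {0..} F" unfolding F_def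
    using set_integrable_xi_ray[OF sector_1_1, of "of_nat (2 * m)"] m by simp
  have SF': "set_integrable lborel {0<..} F" by (rule set_integrable_subset[OF SF]) auto
  have SR: "set_integrable lborel {0<..} (\<lambda>t. Re (F t))"
    using integrable_Re[OF SF'[unfolded set_integrable_def]] by (simp add: set_integrable_def)
  have int: "set_integrable lborel (einterval 0 \<infinity>) (\<lambda>t. f (g t) * g' t)"
  proof -
    have "set_integrable lborel {0<..} (\<lambda>t. Re (F t) / 4 ^ (2 * m + 1))" using SR by simp
    moreover have "(\<lambda>t. indicator {0<..} t *\<^sub>R (f (g t) * g' t)) = (\<lambda>t. indicator {0<..} t *\<^sub>R (Re (F t) / 4 ^ (2 * m + 1)))"
      by (rule ext) (simp add: indicator_def fg)
    ultimately show ?thesis unfolding set_integrable_def zero_ereal_def einterval_eq by (simp only:)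
  qed
  have sub: "(LBINT u=0..\<infinity>. f u) = (LBINT t=0..\<infinity>. f (g t) * g' t)"
  proof (rule interval_integral_substitution_nonneg(2))
    show "(0::ereal) < \<infinity>" by simp
    show "DERIV g t :> g' t" if "0 < ereal t" "ereal t < \<infinity>" for t
      using that unfolding g_def g'_def by (auto intro!: derivative_eq_intros simp: divide_simps)
    show "isCont f (g t)" if "0 < ereal t" "ereal t < \<infinity>" for t
      using that unfolding f_def by (intro continuous_intros isCont_Phi) (auto simp: g_def)
    show "isCont g' t" if "0 < ereal t" "ereal t < \<infinity>" for t
      using that unfolding g'_def by (intro continuous_intros) auto
    show "0 \<le> f (g t)" if "0 < ereal t" "ereal t < \<infinity>" for t
      using that unfolding f_def by (intro mult_nonneg_nonneg Phi_nonneg zero_le_power) (auto simp: g_def)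
    show "0 \<le> g' t" if "0 \<le> ereal t" "ereal t \<le> \<infinity>" for t using that by (simp add: g'_def)
    show "((ereal \<circ> g \<circ> real_of_ereal) \<longlongrightarrow> 0) (at_right 0)"
    proof -
      have "(g \<longlongrightarrow> ln (1 + 0) / 4) (at_right 0)" unfolding g_def by (intro tendsto_intros) auto
      hence "(g \<longlongrightarrow> 0) (at_right 0)" by simp
      thus ?thesis by (simp only: zero_ereal_def ereal_tendsto_simps)
    qed
    show "((ereal \<circ> g \<circ> real_of_ereal) \<longlongrightarrow> \<infinity>) (at_left \<infinity>)"
    proof -
      have "filterlim (\<lambda>t::real. 1 + t) at_top at_top" by (rule filterlim_tendsto_add_at_top[OF tendsto_const filterlim_ident])
      hence "filterlim (\<lambda>t. ln (1 + t) :: real) at_top at_top" by (rule filterlim_compose[OF ln_at_top])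
      hence "filterlim (\<lambda>t. ln (1 + t) * (1/4) :: real) at_top at_top"
        by (rule filterlim_at_top_mult_tendsto_pos[OF tendsto_const, rotated]) simp
      hence "filterlim g at_top at_top" by (simp add: g_def)
      thus ?thesis by (simp only: ereal_tendsto_simps)
    qed
  qed (rule int)
  have "(LINT u:{0..}|lborel. f u) = (LINT u:{0<..}|lborel. f u)"
    unfolding set_lebesgue_integral_def
    by (rule lborel_integral_cong_except_0) (auto simp: indicator_def)
  also have "\<dots> = (LBINT t=0..\<infinity>. f (g t) * g' t)"
    using sub by (simp add: zero_ereal_def interval_integral_to_infinity_eq)
  also have "\<dots> = (LINT t:{0<..}|lborel. f (g t) * g' t)" by (simp add: zero_ereal_def interval_integral_to_infinity_eq)
  also have "\<dots> = (LINT t:{0<..}|lborel. Re (F t) / 4 ^ (2 * m + 1))"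
    by (rule set_lebesgue_integral_cong) (auto simp: fg)
  also have "\<dots> = (LINT t:{0<..}|lborel. Re (F t)) / 4 ^ (2 * m + 1)" by simp
  finally have L: "(LINT u:{0..}|lborel. f u) = (LINT t:{0<..}|lborel. Re (F t)) / 4 ^ (2 * m + 1)" .
  have "ray_integral 1 (of_nat (2 * m)) = (LINT t:{0..}|lborel. F t)"
    by (simp add: ray_integral_def F_def)
  also have "\<dots> = (LINT t:{0<..}|lborel. F t)"
    unfolding set_lebesgue_integral_def
    by (rule lborel_integral_cong_except_0) (auto simp: indicator_def)
  also have "\<dots> = (LINT t:{0<..}|lborel. complex_of_real (Re (F t)))"
  proof (rule set_lebesgue_integral_cong)
    have "F t = of_real (Re (F t))" if "t > 0" for t
      unfolding F_def xi_integrand_of_nat[OF that, of "2 * m", OF mult_pos_pos[OF zero_less_numeral m]] Re_complex_of_real ..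
    thus "\<forall>t. t \<in> {0<..} \<longrightarrow> F t = complex_of_real (Re (F t))" by simp
  qed simp
  also have "\<dots> = of_real (LINT t:{0<..}|lborel. Re (F t))" by (rule set_integral_complex_of_real)
  finally have R: "ray_integral 1 (of_nat (2 * m)) = of_real (LINT t:{0<..}|lborel. Re (F t))" .
  have "xi_coeff (int m) = (LINT u:{0..}|lborel. f u) / fact (2 * m)" by (simp add: xi_coeff_def f_def)
  thus ?thesis unfolding R L by simp
qed

section \<open>The steepest descent ray\<close>

lemma DERIV_Re_of_real:
  assumes "(F has_field_derivative D) (at (of_real t))"
  shows "DERIV (\<lambda>t. Re (F (of_real t))) t :> Re D"
  using has_vector_derivative_real_field[OF assms, of UNIV]
  by (auto intro!: bounded_linear.has_vector_derivative[OF bounded_linear_Re] simp: has_real_derivative_iff_has_vector_derivative)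

lemma sector_ray_point:
  assumes "in_sector a c" "a \<ge> 0" "t \<ge> 0"
  shows "in_sector a (1 + c * of_real t)" "in_sector a (c / (1 + c * of_real t))"
proof -
  have c: "Re c > 0" "\<bar>Im c\<bar> \<le> a * Re c" using assms by (auto simp: in_sector_def)
  have "\<bar>Im c * t\<bar> \<le> a * Re c * t" unfolding abs_mult using c assms by (intro mult_mono) auto
  thus 1: "in_sector a (1 + c * of_real t)" using c assms by (auto simp: in_sector_def algebra_simps add_pos_nonneg)
  have "c \<noteq> 0" using c by auto
  moreover have "Re (1 + c * of_real t) > 0" using 1 by (simp only: in_sector_def)
  hence "1 + c * of_real t \<noteq> 0" by (metis less_irrefl zero_complex.sel(1))
  ultimately have "c / (1 + c * of_real t) = inverse (inverse c + of_real t)"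
    by (simp add: field_simps)
  thus "in_sector a (c / (1 + c * of_real t))"
    using sector_inverse[OF sector_add_of_real[OF sector_inverse[OF assms(1)] assms(2,3)]] by simp
qed

lemma ray_point_basic:
  assumes "in_sector a c" "t > 0"
  shows "Re (1 + c * of_real t) \<ge> 1" "1 + c * of_real t \<noteq> 1" "1 + c * of_real t \<notin> \<real>\<^sub>\<le>\<^sub>0"
    "Ln (1 + c * of_real t) \<notin> \<real>\<^sub>\<le>\<^sub>0" "Re (Ln (1 + c * of_real t)) > 0"
proof -
  have c: "Re c > 0" using assms by (simp add: in_sector_def)
  show 1: "Re (1 + c * of_real t) \<ge> 1" using c assms by simp
  show 2: "1 + c * of_real t \<noteq> 1" using c assms by auto
  show "1 + c * of_real t \<notin> \<real>\<^sub>\<le>\<^sub>0" using 1 by (auto simp: complex_nonpos_Reals_iff)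
  show "Ln (1 + c * of_real t) \<notin> \<real>\<^sub>\<le>\<^sub>0" "Re (Ln (1 + c * of_real t)) > 0"
    using Ln_not_nonpos_Reals[OF 1 2] by auto
qed

text \<open>A real functional that is nonnegative on the sector is nondecreasing along the ray, because the
  derivative \<open>c / (1 + c * t)\<close> lies in the sector; at \<open>t = 0\<close> the logarithm vanishes.\<close>

lemma sector_Ln:
  assumes c: "in_sector a c" and a: "a \<ge> 0" and t: "t > 0"
  shows "in_sector a (Ln (1 + c * of_real t))"
proof -
  have key: "0 \<le> Re (k * Ln (1 + c * of_real t))" if k: "\<And>x. in_sector a x \<Longrightarrow> Re (k * x) \<ge> 0" for k
  proof -
    have "Re (k * Ln (1 + c * of_real 0)) \<le> Re (k * Ln (1 + c * of_real t))"
    proof (rule DERIV_nonneg_imp_nondecreasing[where f = "\<lambda>t. Re (k * Ln (1 + c * of_real t))"])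
      fix s assume s: "0 \<le> s" "s \<le> t"
      have np: "1 + c * of_real s \<notin> \<real>\<^sub>\<le>\<^sub>0"
        using sector_ray_point(1)[OF c a s(1)] by (auto simp: complex_nonpos_Reals_iff in_sector_def)
      have "((\<lambda>u. k * Ln (1 + c * u)) has_field_derivative k * (c / (1 + c * of_real s))) (at (of_real s))"
        using np by (auto intro!: derivative_eq_intros simp: field_simps)
      hence "DERIV (\<lambda>s. Re (k * Ln (1 + c * of_real s))) s :> Re (k * (c / (1 + c * of_real s)))"
        by (rule DERIV_Re_of_real)
      thus "\<exists>y. DERIV (\<lambda>t. Re (k * Ln (1 + c * of_real t))) s :> y \<and> 0 \<le> y"
        using k[OF sector_ray_point(2)[OF c a s(1)]] by blast
    qed (use t in simp)
    thus ?thesis by simp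
  qed
  have "0 \<le> Re (Complex a 1 * Ln (1 + c * of_real t))" "0 \<le> Re (Complex a (-1) * Ln (1 + c * of_real t))"
    by (rule key; auto simp: in_sector_def)+
  thus ?thesis using ray_point_basic(5)[OF c t] by (simp add: in_sector_def)
qed

lemma sq_le_exp_half: "x^2 \<le> 8 * exp (x / 2)" if "x \<ge> 0" for x :: real
proof -
  have "1 + x/2 + (x/2)^2 / 2 \<le> exp (x/2)" using that by (intro exp_lower_Taylor_quadratic) auto
  thus ?thesis using that by (simp add: power_divide)
qed

lemma cos_ge_quadratic: "1 - x^2 / 2 \<le> cos (x::real)"
proof -
  have "cos x = 1 - 2 * (sin (x/2))^2" using cos_double_sin[of "x/2"] by simp
  moreover have "(sin (x/2))^2 \<le> (x/2)^2" using power_mono[OF abs_sin_x_le_abs_x[of "x/2"], of 2] by (simp add: power_divide)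
  ultimately show ?thesis by (simp add: power_divide)
qed

text \<open>The exponent \<open>z * Ln (Ln w) - pi * w\<close> has derivative \<open>z / (w * Ln w) - pi\<close> in \<open>w\<close>, which vanishes
  at \<open>w0\<close>. The ray \<open>1 + c * t\<close> reaches \<open>w0\<close> at \<open>t = 1\<close>. The slopes \<open>1/200\<close> hold for all \<open>z\<close> in a disc
  about a large real number whose radius is a fixed small multiple of the centre.\<close>

locale saddle =
  fixes z w0 :: complex
  assumes c_sector: "in_sector (1/200) (w0 - 1)"
    and z_sector: "in_sector (1/200) z"
    and saddle: "z = of_real pi * w0 * Ln w0"
begin

definition "c = w0 - 1"

definition "w t = 1 + c * of_real t"

definition "g t = z * Ln (Ln (w t)) - of_real pi * w t"

text \<open>The loss in the logarithm of the modulus of \<open>exp (g t)\<close> relative to the saddle point.\<close>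

definition "X t = Re (g 1 - g t)"

definition "B t = norm (w t) powr (5/4)"

lemmas c_sector' = c_sector[folded c_def]

lemma sector_1_c: "in_sector 1 c"
  using sector_mono[OF c_sector', of 1] by simp

lemma z_pos: "Re z > 0"
  using z_sector by (simp add: in_sector_def)

text \<open>The expression is minus the second derivative of \<open>g\<close>. It is a product of five factors from the
  sector of slope \<open>1/200\<close>.\<close>

lemma curvature_sector:
  assumes t: "t > 0"
  shows "in_sector (3/100) ((c / w t)^2 * z * (1 + 1 / Ln (w t)) / Ln (w t))"
proof -
  have L: "in_sector (1/200) (1 / Ln (w t))"
    using sector_inverse[OF sector_Ln[OF c_sector' _ t]] by (simp add: w_def inverse_eq_divide)
  have L1: "in_sector (1/200) (1 + 1 / Ln (w t))"
    using sector_add_of_real[OF L, of 1] by (simp add: add.commute)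
  have cw: "in_sector (1/200) (c / w t)"
    using sector_ray_point(2)[OF c_sector'] t by (simp add: w_def)
  have "in_sector (51/50 * (1/200 + 1/200)) ((c / w t) * (c / w t))" by (rule sector_mult[OF cw cw]) auto
  moreover have "in_sector (51/50 * (1/200 + 51/50 * (1/200 + 1/200))) (z * ((1 + 1 / Ln (w t)) * (1 / Ln (w t))))"
    by (intro sector_mult z_sector L L1) auto
  ultimately have "in_sector (51/50 * (51/50 * (1/200 + 1/200) + 51/50 * (1/200 + 51/50 * (1/200 + 1/200))))
     (((c / w t) * (c / w t)) * (z * ((1 + 1 / Ln (w t)) * (1 / Ln (w t)))))"
    by (rule sector_mult) auto
  from sector_mono[OF this, of "3/100"] show ?thesis by (simp add: power2_eq_square mult.assoc)
qed

text \<open>For \<open>k = 1\<close> this is convexity of \<open>X\<close>. For the two functionals that vanish on one side of the sector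
  it says that the phase is controlled by \<open>X\<close>.\<close>

lemma convex_exponent:
  assumes k: "\<And>x. in_sector (3/100) x \<Longrightarrow> Re (k * x) \<ge> 0"
  shows "convex_on {0<..} (\<lambda>t. - Re (k * g t))" "t > 0 \<Longrightarrow> Re (k * (g 1 - g t)) \<ge> 0"
proof -
  define W where "W = (\<lambda>s. 1 + c * s)"
  define g1 where "g1 = (\<lambda>s. c * (z / (W s * Ln (W s)) - of_real pi))"
  have W: "w t = W (of_real t)" for t by (simp add: w_def W_def)
  have np: "W (of_real t) \<notin> \<real>\<^sub>\<le>\<^sub>0" "Ln (W (of_real t)) \<notin> \<real>\<^sub>\<le>\<^sub>0" "W (of_real t) \<noteq> 0" "Ln (W (of_real t)) \<noteq> 0"
    if "t > 0" for t
    using ray_point_basic(3,4)[OF c_sector' that] by (auto simp: W_def)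
  have d1: "DERIV (\<lambda>t. - Re (k * g t)) t :> - Re (k * g1 (of_real t))" if t: "t > 0" for t
  proof -
    have "((\<lambda>s. k * (z * Ln (Ln (W s)) - of_real pi * W s)) has_field_derivative k * g1 (of_real t)) (at (of_real t))"
      using np[OF t] unfolding g1_def W_def
      by (auto intro!: derivative_eq_intros simp: field_simps)
    from DERIV_minus[OF DERIV_Re_of_real[OF this]] show ?thesis by (simp add: g_def W)
  qed
  have d2: "DERIV (\<lambda>t. - Re (k * g1 (of_real t))) t :> Re (k * ((c / w t)^2 * z * (1 + 1 / Ln (w t)) / Ln (w t)))"
    if t: "t > 0" for t
  proof -
    define u where "u = W (of_real t)"
    define L where "L = Ln u"
    have nz: "u \<noteq> 0" "L \<noteq> 0" using np[OF t] by (auto simp: u_def L_def)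
    have dW: "(W has_field_derivative c) (at (of_real t))" unfolding W_def by (auto intro!: derivative_eq_intros)
    have dL: "((\<lambda>s. Ln (W s)) has_field_derivative c / u) (at (of_real t))"
      using DERIV_chain2[OF has_field_derivative_Ln[OF np(1)[OF t]] dW] by (simp add: u_def divide_inverse mult.commute)
    have "((\<lambda>s. W s * Ln (W s)) has_field_derivative u * (c / u) + c * L) (at (of_real t))"
      using DERIV_mult'[OF dW dL] by (simp only: u_def L_def)
    moreover have "u * (c / u) + c * L = c * (L + 1)" using nz by (simp add: algebra_simps)
    ultimately have dWL: "((\<lambda>s. W s * Ln (W s)) has_field_derivative c * (L + 1)) (at (of_real t))" by simp
    have "((\<lambda>s. z / (W s * Ln (W s))) has_field_derivative - (z * (c * (L + 1)) / (u * L)^2)) (at (of_real t))"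
      using DERIV_divide[OF DERIV_const[of z] dWL] nz by (simp add: u_def L_def power2_eq_square)
    hence "((\<lambda>s. k * g1 s) has_field_derivative k * (c * (- (z * (c * (L + 1)) / (u * L)^2) - 0))) (at (of_real t))"
      unfolding g1_def by (intro DERIV_cmult DERIV_diff DERIV_const)
    moreover have "k * (c * (- (z * (c * (L + 1)) / (u * L)^2) - 0)) = - (k * ((c / u)^2 * z * (1 + 1 / L) / L))"
    proof -
      have "1 + 1 / L = (L + 1) / L" using nz by (simp add: add_divide_distrib)
      thus ?thesis by (simp only: power2_eq_square) (simp add: mult_ac)
    qed
    ultimately have "((\<lambda>s. k * g1 s) has_field_derivative - (k * ((c / u)^2 * z * (1 + 1 / L) / L))) (at (of_real t))" by simp
    from DERIV_minus[OF DERIV_Re_of_real[OF this]] show ?thesis by (simp add: u_def L_def W)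
  qed
  show conv: "convex_on {0<..} (\<lambda>t. - Re (k * g t))"
    by (rule f''_ge0_imp_convex[OF _ d1 d2]) (use k[OF curvature_sector] in auto)
  show "Re (k * (g 1 - g t)) \<ge> 0" if t: "t > 0"
  proof -
    have W1: "W (of_real 1) = w0" by (simp add: W_def c_def)
    have "w0 \<noteq> 0" "Ln w0 \<noteq> 0" using np[of 1] by (simp_all add: W1[simplified])
    hence "g1 (of_real 1) = 0" unfolding g1_def W1 saddle by simp
    hence "DERIV (\<lambda>t. - Re (k * g t)) 1 :> 0" using d1[of 1] by simp
    hence "((\<lambda>t. - Re (k * g t)) has_field_derivative 0) (at 1 within {0<..})"
      by (rule has_field_derivative_at_within)
    hence "- Re (k * g t) - - Re (k * g 1) \<ge> 0 * (t - 1)"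
      by (intro convex_on_imp_above_tangent[OF conv]) (use t in \<open>auto simp: interior_open connected_Ioi\<close>)
    moreover have "Re (k * (g 1 - g t)) = Re (k * g 1) - Re (k * g t)"
      by (simp only: right_diff_distrib minus_complex.sel)
    ultimately show ?thesis by linarith
  qed
qed

lemma X_nonneg: "t > 0 \<Longrightarrow> X t \<ge> 0"
proof -
  assume "t > 0"
  hence "Re (1 * (g 1 - g t)) \<ge> 0" by (intro convex_exponent(2)) (auto simp: in_sector_def)
  thus "X t \<ge> 0" by (simp add: X_def)
qed

lemma phase_bound:
  assumes "t > 0"
  shows "\<bar>Im (g t - g 1)\<bar> \<le> 3/100 * X t"
proof -
  have "Re (Complex (3/100) 1 * (g 1 - g t)) \<ge> 0" "Re (Complex (3/100) (-1) * (g 1 - g t)) \<ge> 0"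
    by (rule convex_exponent(2)[OF _ assms]; auto simp: in_sector_def)+
  hence "Im (g t - g 1) \<le> 3/100 * X t" "- Im (g t - g 1) \<le> 3/100 * X t" by (simp_all add: X_def)
  thus ?thesis by (rule abs_leI)
qed

lemma X_double:
  assumes "t > 1/2"
  shows "2 * X t \<le> X (2 * t - 1)"
proof -
  have "convex_on {0<..} (\<lambda>t. - Re (1 * g t))" by (rule convex_exponent(1)) (auto simp: in_sector_def)
  hence "- Re (1 * g ((1 - 1/2) *\<^sub>R (2 * t - 1) + (1/2) *\<^sub>R 1)) \<le> (1 - 1/2) * - Re (1 * g (2 * t - 1)) + (1/2) * - Re (1 * g 1)"
    by (rule convex_onD) (use assms in auto)
  moreover have "(1 - 1/2) *\<^sub>R (2 * t - 1) + (1/2) *\<^sub>R 1 = t" by (simp add: field_simps)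
  ultimately have "- Re (1 * g t) \<le> (1 - 1/2) * - Re (1 * g (2 * t - 1)) + (1/2) * - Re (1 * g 1)" by (simp only:)
  thus ?thesis unfolding X_def by simp
qed

lemma B_ge_1: "t \<ge> 0 \<Longrightarrow> B t \<ge> 1"
proof -
  assume "t \<ge> 0"
  hence "Re (w t) \<ge> 1" using sector_point(1)[OF sector_1_c] by (simp add: w_def)
  hence "norm (w t) \<ge> 1" using abs_Re_le_cmod[of "w t"] by linarith
  thus "B t \<ge> 1" by (simp add: B_def ge_one_powr_ge_zero)
qed

lemma B_double:
  assumes t: "t > 1/2"
  shows "B (2 * t - 1) \<le> 4 * B t"
proof -
  have c: "Re c > 0" using c_sector' by (simp add: in_sector_def)
  have n: "norm (w (2 * t - 1)) \<le> 2 * norm (w t)"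
  proof -
    have "(1 + Re c * (2 * t - 1))^2 \<le> (2 * (1 + Re c * t))^2"
    proof (rule power_mono)
      have "0 \<le> Re c * (2 * t - 1)" using c t by simp
      thus "0 \<le> 1 + Re c * (2 * t - 1)" by linarith
      show "1 + Re c * (2 * t - 1) \<le> 2 * (1 + Re c * t)" using c by (simp add: algebra_simps)
    qed
    moreover have "(Im c * (2 * t - 1))^2 \<le> (2 * (Im c * t))^2"
    proof -
      have "\<bar>Im c\<bar> * \<bar>2 * t - 1\<bar> \<le> \<bar>Im c\<bar> * \<bar>2 * t\<bar>" using t by (intro mult_left_mono) auto
      hence "(Im c * (2 * t - 1))^2 \<le> (Im c * (2 * t))^2" by (simp only: abs_mult[symmetric] abs_le_square_iff)
      thus ?thesis by (simp add: mult_ac)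
    qed
    ultimately have "norm (w (2 * t - 1)) ^ 2 \<le> (2 * norm (w t)) ^ 2"
      unfolding power_mult_distrib cmod_power2 w_def by (simp add: power_mult_distrib)
    thus ?thesis by (rule power2_le_imp_le) simp
  qed
  have "B (2 * t - 1) \<le> (2 * norm (w t)) powr (5/4)" unfolding B_def using n by (intro powr_mono2) auto
  also have "\<dots> = 2 powr (5/4) * B t" by (simp add: powr_mult B_def)
  also have "\<dots> \<le> 2 powr 2 * B t" by (intro mult_right_mono powr_mono) (auto simp: B_def)
  finally show ?thesis by simp
qed

lemma Im_Ln_w:
  assumes "t > 0"
  shows "\<bar>Im (Ln (w t))\<bar> \<le> 1/200" "\<bar>Im (w t)\<bar> \<le> 1/200 * Re (w t)" "Re (w t) \<ge> 1"
proof -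
  have w: "in_sector (1/200) (w t)" using sector_ray_point(1)[OF c_sector'] assms by (simp add: w_def)
  thus 1: "\<bar>Im (w t)\<bar> \<le> 1/200 * Re (w t)" by (simp add: in_sector_def)
  show 2: "Re (w t) \<ge> 1" using ray_point_basic(1)[OF c_sector' assms] by (simp add: w_def)
  have "Im (Ln (w t)) = arctan (Im (w t) / Re (w t))" using 2 by (subst Im_Ln_eq) auto
  also have "\<bar>\<dots>\<bar> \<le> \<bar>Im (w t) / Re (w t)\<bar>" by (rule abs_arctan_le)
  also have "\<dots> \<le> 1/200" using 1 2 by (simp add: abs_divide divide_le_eq)
  finally show "\<bar>Im (Ln (w t))\<bar> \<le> 1/200" .
qed

lemma integrand_eq:
  assumes t: "t > 0"
  shows "xi_integrand z (w t) = exp (g 1) * (of_real (exp (- X t) * B t) * cis (Im (g t - g 1) + 5/4 * Im (Ln (w t)))) * xi_series (w t)"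
proof -
  have w: "Re (w t) \<ge> 1" "w t \<noteq> 1" "w t \<noteq> 0"
    using ray_point_basic(1,2)[OF c_sector' t] ray_point_basic(3)[OF c_sector' t] by (auto simp: w_def)
  have p: "w t powr (5/4) = exp (5/4 * Ln (w t))" using w(3) by (simp only: powr_def if_False)
  have r: "Re (5/4 * Ln (w t)) = 5/4 * ln (norm (w t))" "Im (5/4 * Ln (w t)) = 5/4 * Im (Ln (w t))"
    using w(3) by simp_all
  have "B t = exp (5/4 * ln (norm (w t)))" using w(3) by (simp add: B_def powr_def)
  hence p': "w t powr (5/4) = of_real (B t) * cis (5/4 * Im (Ln (w t)))"
    unfolding p exp_eq_polar[of "5/4 * Ln (w t)"] r by simp
  have "exp (g t) = exp (g 1) * exp (g t - g 1)" by (simp add: exp_diff)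
  also have "exp (g t - g 1) = of_real (exp (- X t)) * cis (Im (g t - g 1))"
    unfolding exp_eq_polar[of "g t - g 1"] by (simp add: X_def)
  finally have q: "exp (g t) = exp (g 1) * (of_real (exp (- X t)) * cis (Im (g t - g 1)))" .
  have "xi_integrand z (w t) = exp (g t) * w t powr (5/4) * xi_series (w t)"
    using xi_integrand_exp[OF w(1,2), of z] by (simp only: g_def)
  thus ?thesis unfolding p' q by (simp add: cis_mult[symmetric] mult_ac)
qed

lemma norm_integrand:
  assumes "t > 0"
  shows "norm (xi_integrand z (w t)) = exp (Re (g 1)) * (exp (- X t) * B t) * norm (xi_series (w t))"
  using B_ge_1[of t] assms by (simp add: integrand_eq norm_mult)

end

text \<open>The left-hand side is largest at \<open>y = ln (1 + a)\<close>, where it equals \<open>(1 + a) * ln (1 + a) - a\<close>, that is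
  \<open>a^2 / 2\<close> up to a cubic term.\<close>

lemma legendre_exp_bound:
  fixes a y :: real
  assumes a: "\<bar>a\<bar> \<le> 1/100"
  shows "(1 + a) * y - (exp y - 1) \<le> 51/100 * a^2"
proof -
  define L where "L = ln (1 + a)"
  have p: "1 + a > 0" using a by linarith
  have "(1 + a) * (1 + (y - L)) \<le> (1 + a) * exp (y - L)"
    using p by (intro mult_left_mono exp_ge_add_one_self) auto
  also have "\<dots> = exp y" using p by (simp add: L_def exp_diff)
  finally have 1: "(1 + a) * y - (exp y - 1) \<le> (1 + a) * L - a" by (simp add: algebra_simps)
  define f where "f = (\<lambda>x::real. 51/100 * x^2 + x - (1 + x) * ln (1 + x))"
  have df: "DERIV f x :> 51/50 * x - ln (1 + x)" if "\<bar>x\<bar> \<le> 1/100" for x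
  proof -
    have p: "1 + x > 0" using that by linarith
    have "((\<lambda>x. (1 + x) * ln (1 + x)) has_field_derivative (ln (1 + x) + 1)) (at x)"
      using p by (auto intro!: derivative_eq_intros)
    moreover have "((\<lambda>x. 51/100 * x^2 + x) has_field_derivative (51/50 * x + 1)) (at x)"
      by (auto intro!: derivative_eq_intros)
    ultimately show ?thesis using DERIV_diff unfolding f_def by fastforce
  qed
  have "f 0 \<le> f a"
  proof (cases "a \<ge> 0")
    case True
    show ?thesis
    proof (rule DERIV_nonneg_imp_nondecreasing[OF True])
      fix x assume x: "0 \<le> x" "x \<le> a"
      have "ln (1 + x) \<le> 51/50 * x" using ln_add_one_self_le_self[OF x(1)] x by linarith
      hence "0 \<le> 51/50 * x - ln (1 + x)" by linarith
      moreover have "\<bar>x\<bar> \<le> 1/100" using x a by linarith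
      ultimately show "\<exists>d. DERIV f x :> d \<and> 0 \<le> d" using df by blast
    qed
  next
    case False
    show ?thesis
    proof (rule DERIV_nonpos_imp_nonincreasing[where f = f and a = a and b = 0])
      show "a \<le> 0" using False by simp
      fix x assume x: "a \<le> x" "x \<le> 0"
      have px: "1 + x \<ge> 99/100" using x a by linarith
      have "ln (inverse (1 + x)) \<le> inverse (1 + x) - 1" using px by (intro ln_le_minus_one) auto
      hence "ln (1 + x) \<ge> 1 - inverse (1 + x)" using px by (simp add: ln_inverse)
      also have "1 - inverse (1 + x) = x / (1 + x)" using px by (simp add: field_simps)
      finally have "ln (1 + x) \<ge> x / (1 + x)" .
      moreover have "x / (1 + x) \<ge> 51/50 * x"
      proof -
        have "51/50 * x * (1 + x) \<le> x" using px x mult_right_mono_neg[of "1" "51/50 * (1 + x)" x] by (simp add: mult_ac)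
        thus ?thesis using px by (simp add: pos_le_divide_eq)
      qed
      ultimately have "51/50 * x - ln (1 + x) \<le> 0" by linarith
      moreover have "\<bar>x\<bar> \<le> 1/100" using x a by linarith
      ultimately show "\<exists>d. DERIV f x :> d \<and> d \<le> 0" using df by blast
    qed
  qed
  thus ?thesis using 1 by (simp add: f_def L_def)
qed

context saddle
begin

lemma continuous_on_g: "continuous_on {0<..} g"
  unfolding g_def w_def using ray_point_basic(3,4)[OF c_sector']
  by (intro continuous_intros) auto

lemma continuous_on_X: "continuous_on {0<..} X"
  unfolding X_def[abs_def] by (intro continuous_intros continuous_on_g)

lemma continuous_on_B: "continuous_on {0<..} B"
proof -
  have "norm (w t) \<noteq> 0" if "t > 0" for t using Im_Ln_w(3)[OF that] by auto
  thus ?thesis unfolding B_def[abs_def] w_def by (intro continuous_intros) auto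
qed

definition "J t = exp (- X t) * B t"

definition "J2 t = exp (- X t / 2) * B t"

lemma measurable_J: "set_borel_measurable lborel {0<..} J" "set_borel_measurable lborel {0<..} J2"
proof -
  have "continuous_on {0<..} J" "continuous_on {0<..} J2"
    unfolding J_def[abs_def] J2_def[abs_def] by (intro continuous_intros continuous_on_X continuous_on_B; simp)+
  thus "set_borel_measurable lborel {0<..} J" "set_borel_measurable lborel {0<..} J2"
    using borel_measurable_continuous_on_indicator[of "{0<..}" J] borel_measurable_continuous_on_indicator[of "{0<..}" J2]
    by (simp_all add: set_borel_measurable_def)
qed

lemma J_pos: "t > 0 \<Longrightarrow> J t > 0" "t > 0 \<Longrightarrow> J2 t > 0"
  using B_ge_1[of t] by (auto simp: J_def J2_def)

lemma set_integrable_ray: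
  assumes "Re z' > 0"
  shows "set_integrable lborel {0<..} (\<lambda>t. xi_integrand z' (w t))"
  unfolding w_def by (rule set_integrable_subset[OF set_integrable_xi_ray[OF sector_1_c assms]]) auto

lemma ray_integral_open: "ray_integral c z' = (LINT t:{0<..}|lborel. xi_integrand z' (w t))"
  unfolding ray_integral_def set_lebesgue_integral_def w_def
  by (rule lborel_integral_cong_except_0) (auto simp: indicator_def)

lemma set_integrable_J: "set_integrable lborel {0<..} J"
proof (rule set_integrable_bound)
  show "set_integrable lborel {0<..} (\<lambda>t. exp (- Re (g 1)) * norm (xi_integrand z (w t)))"
    by (intro set_integrable_mult_right set_integrable_norm set_integrable_ray z_pos)
  show "AE t in lborel. t \<in> {0<..} \<longrightarrow> norm (J t) \<le> norm (exp (- Re (g 1)) * norm (xi_integrand z (w t)))"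
  proof (intro AE_I2 impI)
    fix t :: real assume "t \<in> {0<..}"
    hence t: "t > 0" by simp
    have "norm (xi_series (w t)) \<ge> 1"
      using xi_series_bounds(1)[OF Im_Ln_w(3)[OF t]] abs_Re_le_cmod[of "xi_series (w t)"] by linarith
    hence "J t * 1 \<le> J t * norm (xi_series (w t))" using J_pos[OF t] by (intro mult_left_mono) auto
    also have "\<dots> = exp (- Re (g 1)) * norm (xi_integrand z (w t))"
      unfolding norm_integrand[OF t] J_def[symmetric] by (simp add: exp_minus)
    finally show "norm (J t) \<le> norm (exp (- Re (g 1)) * norm (xi_integrand z (w t)))" using J_pos[OF t] by simp
  qed
qed (rule measurable_J)

text \<open>Because \<open>X\<close> is convex with minimum \<open>0\<close> at \<open>t = 1\<close>, stretching about this point by the factor 2 at least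
  doubles it. The substitution \<open>t \<mapsto> 2 * t - 1\<close> therefore compares the two integrals with a constant that
  depends neither on \<open>z\<close> nor on the width of the peak.\<close>

lemma half_exponent_integral:
  shows "set_integrable lborel {0<..} J2" "(LINT t:{0<..}|lborel. J2 t) \<le> 8 * (LINT t:{0<..}|lborel. J t)"
proof -
  define G where "G = (\<lambda>u. indicator {0<..} u *\<^sub>R J2 u)"
  define K where "K = (\<lambda>t. 4 * (indicator {0<..} t *\<^sub>R J t))"
  have [measurable]: "G \<in> borel_measurable borel"
    using measurable_J(2) by (simp add: G_def set_borel_measurable_def)
  have K: "integrable lborel K" unfolding K_def
    using set_integrable_J by (simp add: set_integrable_def)
  have le: "0 \<le> G (- 1 + 2 * t) \<and> G (- 1 + 2 * t) \<le> K t" for t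
  proof (cases "t > 1/2")
    case True
    hence t: "t > 0" "2 * t - 1 > 0" by auto
    have e: "- 1 + 2 * t = 2 * t - 1" by simp
    have "J2 (2 * t - 1) \<le> exp (- X t) * (4 * B t)"
      unfolding J2_def using X_double[OF True] B_double[OF True] B_ge_1[of "2 * t - 1"] t by (intro mult_mono) auto
    thus ?thesis using t J_pos(2)[of "2 * t - 1"] unfolding e G_def K_def by (simp add: J_def)
  next
    case False
    hence "G (- 1 + 2 * t) = 0" by (simp add: G_def indicator_def)
    moreover have "0 \<le> K t" using J_pos(1)[of t] by (auto simp: K_def indicator_def)
    ultimately show ?thesis by simp
  qed
  have GK: "integrable lborel (\<lambda>t. G (- 1 + 2 * t))"
    by (rule Bochner_Integration.integrable_bound[OF K]) (use le in \<open>auto intro!: AE_I2 order_trans[OF _ abs_ge_self]\<close>)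
  hence G: "integrable lborel G" using lborel_integrable_real_affine_iff[of 2 G "-1"] by simp
  thus "set_integrable lborel {0<..} J2" by (simp add: set_integrable_def G_def)
  have "(LINT u|lborel. G u) = \<bar>2\<bar> *\<^sub>R (LINT t|lborel. G (- 1 + 2 * t))"
    by (rule lborel_integral_real_affine) simp
  also have "\<dots> \<le> 2 * (LINT t|lborel. K t)"
    using integral_mono[OF GK K] le by simp
  also have "(LINT t|lborel. K t) = 4 * (LINT t:{0<..}|lborel. J t)"
    by (simp add: K_def set_lebesgue_integral_def)
  finally show "(LINT t:{0<..}|lborel. J2 t) \<le> 8 * (LINT t:{0<..}|lborel. J t)"
    by (simp add: G_def set_lebesgue_integral_def)
qed

lemma integral_J_pos: "(LINT t:{0<..}|lborel. J t) > 0"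
proof -
  have "continuous_on {1..2} J"
    unfolding J_def[abs_def] by (intro continuous_intros continuous_on_subset[OF continuous_on_X] continuous_on_subset[OF continuous_on_B]) auto
  then obtain m where m: "m \<in> {1..2}" "\<And>t. t \<in> {1..2} \<Longrightarrow> J m \<le> J t"
    using continuous_attains_inf[of "{1..2}" J] by auto
  have "0 < J m" using m J_pos by simp
  also have "J m = (LINT t|lborel. indicator {1..2::real} t *\<^sub>R J m)" by simp
  also have "\<dots> \<le> (LINT t|lborel. indicator {0<..} t *\<^sub>R J t)"
  proof (rule integral_mono)
    show "integrable lborel (\<lambda>t. indicator {1..2::real} t *\<^sub>R J m)" by simp
    show "integrable lborel (\<lambda>t. indicator {0<..} t *\<^sub>R J t)"
      using set_integrable_J by (simp add: set_integrable_def)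
    fix t :: real
    show "indicator {1..2} t *\<^sub>R J m \<le> indicator {0<..} t *\<^sub>R J t"
      using m(2)[of t] J_pos(1)[of t] by (auto simp: indicator_def)
  qed
  finally show ?thesis by (simp add: set_lebesgue_integral_def)
qed

text \<open>Rotated so as to be essentially positive at the saddle point, the integrand has argument
  at most \<open>3/100 * X t\<close> plus a small constant. The quadratic bound for the cosine loses a small multiple of
  \<open>X^2 * exp (- X)\<close>, hence of \<open>exp (- X / 2)\<close>.\<close>

lemma integrand_Re_ge:
  assumes t: "t > 0"
  shows "Re (exp (- g 1) * xi_integrand z (w t)) \<ge> 8 * J t - 11/50 * J2 t"
proof -
  define \<theta> where "\<theta> = Im (g t - g 1) + 5/4 * Im (Ln (w t))"
  define q where "q = xi_series (w t)"
  note W = Im_Ln_w[OF t]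
  have q: "Re q \<ge> 9" "norm q \<le> 30" "\<bar>Im q\<bar> \<le> 1/5"
  proof -
    show "Re q \<ge> 9" "norm q \<le> 30" using xi_series_bounds[OF W(3)] by (auto simp: q_def)
    have "\<bar>Im (w t)\<bar> / Re (w t) \<le> 1/200" using W by (simp add: divide_le_eq)
    thus "\<bar>Im q\<bar> \<le> 1/5" using xi_series_bounds(3)[OF W(3)] by (simp add: q_def)
  qed
  have Xn: "X t \<ge> 0" using X_nonneg[OF t] .
  have "\<bar>\<theta>\<bar> \<le> 3/100 * X t + 1/100"
    using phase_bound[OF t] W(1) unfolding \<theta>_def by linarith
  hence "\<theta>^2 \<le> (3/100 * X t + 1/100)^2" by (simp add: abs_le_square_iff[symmetric] Xn)
  also have "\<dots> \<le> 2 * (3/100 * X t)^2 + 2 * (1/100)^2"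
    using sum_squares_bound[of "3/100 * X t" "1/100"] by (simp add: power2_sum)
  finally have th: "\<theta>^2 \<le> 18/10000 * (X t)^2 + 2/10000" by (simp add: power_mult_distrib power_divide)
  have sq: "(X t)^2 \<le> 8 * exp (X t / 2)" by (rule sq_le_exp_half[OF Xn])
  have "Re (cis \<theta> * q) = cos \<theta> * Re q - sin \<theta> * Im q" by simp
  moreover have "sin \<theta> * Im q \<le> 1/5"
  proof -
    have "\<bar>sin \<theta> * Im q\<bar> \<le> 1 * (1/5)" unfolding abs_mult using q by (intro mult_mono) auto
    thus ?thesis by linarith
  qed
  moreover have "cos \<theta> * Re q \<ge> Re q - 15 * \<theta>^2"
  proof -
    have rq: "0 \<le> Re q" "Re q \<le> 30" using q abs_Re_le_cmod[of q] by linarith+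
    have "Re q * (1 - \<theta>^2 / 2) \<le> Re q * cos \<theta>" using rq by (intro mult_left_mono cos_ge_quadratic) auto
    moreover have "Re q * (\<theta>^2 / 2) \<le> 30 * (\<theta>^2 / 2)" using rq by (intro mult_right_mono) auto
    ultimately show ?thesis by (simp add: algebra_simps)
  qed
  ultimately have "Re (cis \<theta> * q) \<ge> 9 - 15 * \<theta>^2 - 1/5" using q by linarith
  hence R: "Re (cis \<theta> * q) \<ge> 8 - 11/50 * exp (X t / 2)" using th sq exp_ge_zero[of "X t / 2"] by linarith
  have "exp (- g 1) * xi_integrand z (w t) = of_real (J t) * (cis \<theta> * q)"
    unfolding integrand_eq[OF t] J_def \<theta>_def q_def by (simp add: exp_minus)
  hence "Re (exp (- g 1) * xi_integrand z (w t)) = J t * Re (cis \<theta> * q)" by (simp del: cis.sel)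
  also have "\<dots> \<ge> J t * (8 - 11/50 * exp (X t / 2))" using R J_pos(1)[OF t] by (intro mult_left_mono) auto
  also have "J t * (8 - 11/50 * exp (X t / 2)) = 8 * J t - 11/50 * (exp (- X t) * exp (X t / 2) * B t)"
    by (simp add: J_def algebra_simps)
  also have "exp (- X t) * exp (X t / 2) = exp (- X t / 2)" by (simp add: exp_add[symmetric])
  finally show ?thesis by (simp add: J2_def)
qed

lemma ray_integral_Re_ge: "Re (exp (- g 1) * ray_integral c z) \<ge> 6 * (LINT t:{0<..}|lborel. J t)"
proof -
  note SI = set_integrable_ray[OF z_pos]
  have SI': "set_integrable lborel {0<..} (\<lambda>t. exp (- g 1) * xi_integrand z (w t))"
    by (rule set_integrable_mult_right) (rule SI)
  have "Re (exp (- g 1) * ray_integral c z) = Re (LINT t:{0<..}|lborel. exp (- g 1) * xi_integrand z (w t))"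
    unfolding ray_integral_open by simp
  also have "\<dots> = (LINT t|lborel. Re (indicator {0<..} t *\<^sub>R (exp (- g 1) * xi_integrand z (w t))))"
    unfolding set_lebesgue_integral_def using integral_Re[OF SI'[unfolded set_integrable_def]] by simp
  also have "\<dots> \<ge> (LINT t|lborel. indicator {0<..} t *\<^sub>R (8 * J t - 11/50 * J2 t))"
  proof (rule integral_mono)
    have "set_integrable lborel {0<..} (\<lambda>t. 8 * J t - 11/50 * J2 t)"
      by (intro set_integral_diff(1) set_integrable_mult_right set_integrable_J half_exponent_integral(1))
    thus "integrable lborel (\<lambda>t. indicator {0<..} t *\<^sub>R (8 * J t - 11/50 * J2 t))" by (simp only: set_integrable_def)
    show "integrable lborel (\<lambda>t. Re (indicator {0<..} t *\<^sub>R (exp (- g 1) * xi_integrand z (w t))))"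
      by (rule integrable_Re[OF SI'[unfolded set_integrable_def]])
    fix t :: real
    show "indicator {0<..} t *\<^sub>R (8 * J t - 11/50 * J2 t) \<le> Re (indicator {0<..} t *\<^sub>R (exp (- g 1) * xi_integrand z (w t)))"
      using integrand_Re_ge[of t] by (cases "t > 0") (auto simp: indicator_def)
  qed
  also have "(LINT t|lborel. indicator {0<..} t *\<^sub>R (8 * J t - 11/50 * J2 t))
     = 8 * (LINT t:{0<..}|lborel. J t) - 11/50 * (LINT t:{0<..}|lborel. J2 t)"
    unfolding set_lebesgue_integral_def[symmetric]
    using set_integrable_J half_exponent_integral(1) by (subst set_integral_diff(2)) auto
  finally show ?thesis using half_exponent_integral(2) integral_J_pos by linarith
qed

theorem ray_integral_nonzero: "ray_integral 1 z \<noteq> 0"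
proof -
  have "Re (exp (- g 1) * ray_integral c z) > 0" using ray_integral_Re_ge integral_J_pos by linarith
  hence "ray_integral c z \<noteq> 0" by auto
  moreover have "c \<noteq> 0" using c_sector' by (auto simp: in_sector_def)
  moreover have "c * ray_integral c z = ray_integral 1 z" by (rule ray_integral_rotate[OF sector_1_c z_pos])
  ultimately show ?thesis by (metis mult_eq_0_iff)
qed

text \<open>On the real ray, replacing the exponent \<open>s\<close> by \<open>z'\<close> multiplies the modulus by \<open>(ln v) powr \<tau>\<close> at \<open>w = v\<close>. Compared with
  its value \<open>(ln \<omega>) powr \<tau>\<close> at the saddle point, this factor is at most \<open>exp (X / 2)\<close> up to a constant, and
  \<open>half_exponent_integral\<close> absorbs \<open>exp (X / 2)\<close>.\<close>

theorem ray_integral_upper: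
  assumes w0: "w0 = of_real \<omega>" and z: "z = of_real s" and z': "Re z' = s + \<tau>"
    and \<tau>: "\<bar>\<tau>\<bar> \<le> s / 200"
  shows "norm (ray_integral 1 z') \<le> ln \<omega> powr \<tau> * exp (51/50 * \<tau>^2 / (ln \<omega> * s)) * 40 * norm (ray_integral 1 z)"
proof -
  define l where "l = ln \<omega>"
  define A where "A = 51/50 * \<tau>^2 / (l * s)"
  have s: "s > 0" using z_pos z by simp
  have om: "\<omega> > 1" using c_sector w0 by (simp add: in_sector_def)
  have l: "l > 0" using om by (simp add: l_def)
  have zp: "Re z' > 0" using z' \<tau> s by simp
  have s_eq: "s = pi * \<omega> * l"
  proof -
    have "Ln w0 = of_real l" using om by (simp add: w0 l_def Ln_of_real)
    hence "complex_of_real s = of_real (pi * \<omega> * l)" using saddle by (simp add: z w0)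
    thus ?thesis by (simp only: of_real_eq_iff)
  qed
  have pw: "norm (xi_integrand z' (w t)) \<le> (30 * exp (Re (g 1)) * l powr \<tau> * exp A) * J2 t" if t: "t > 0" for t
  proof -
    define v where "v = 1 + (\<omega> - 1) * t"
    have v: "v > 1" using om t by (simp add: v_def)
    have wt: "w t = of_real v" unfolding w_def c_def by (simp add: w0 v_def)
    have Lw: "Ln (w t) = of_real (ln v)" unfolding wt using v by (simp add: Ln_of_real)
    have lv: "ln v > 0" using v by simp
    have np: "norm (Ln (w t) powr u) = ln v powr Re u" for u
      unfolding Lw using norm_powr_real_powr[of "complex_of_real (ln v)" u] lv by simp
    have "norm (xi_integrand z' (w t)) = ln v powr \<tau> * norm (xi_integrand z (w t))"
      unfolding xi_integrand_def norm_mult np z' z by (simp add: powr_add)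
    also have "\<dots> = ln v powr \<tau> * (exp (Re (g 1)) * (exp (- X t) * B t) * norm (xi_series (w t)))"
      by (simp only: norm_integrand[OF t])
    also have "\<dots> \<le> ln v powr \<tau> * (exp (Re (g 1)) * (exp (- X t) * B t) * 30)"
      using xi_series_bounds(2)[OF Im_Ln_w(3)[OF t]] B_ge_1[of t] t by (intro mult_left_mono) auto
    finally have 1: "norm (xi_integrand z' (w t)) \<le> ln v powr \<tau> * (exp (Re (g 1)) * (exp (- X t) * B t) * 30)" .
    define q where "q = ln v / l"
    have q: "q > 0" using lv l by (simp add: q_def)
    define y where "y = ln v - l"
    have v_eq: "v = \<omega> * exp y" using v om by (simp add: y_def l_def exp_diff)
    have Xt: "X t = pi * (v - \<omega>) - s * ln q"
    proof -
      have w1: "w 1 = of_real \<omega>" unfolding w_def c_def by (simp add: w0)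
      have "Ln (w 1) = of_real l" unfolding w1 using om by (simp add: l_def Ln_of_real)
      hence "Re (g 1) = s * ln l - pi * \<omega>" unfolding g_def unfolding z w1 using l om by (simp add: l_def Ln_of_real)
      moreover have "Re (g t) = s * ln (ln v) - pi * v" unfolding g_def unfolding z Lw unfolding wt using lv by (simp add: Ln_of_real)
      moreover have "s * ln q = s * ln (ln v) - s * ln l" using lv l by (simp add: q_def ln_div right_diff_distrib)
      ultimately show ?thesis unfolding X_def by (simp add: algebra_simps)
    qed
    define a where "a = 2 * \<tau> / s"
    have a: "\<bar>a\<bar> \<le> 1/100" using \<tau> s by (simp add: a_def abs_divide divide_le_eq abs_mult)
    have "\<tau> * ln q - X t / 2 = (\<tau> + s / 2) * ln q - pi * (v - \<omega>) / 2" by (simp add: Xt field_simps)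
    also have "\<dots> \<le> (\<tau> + s / 2) * (q - 1) - pi * (v - \<omega>) / 2"
      using ln_le_minus_one[OF q] \<tau> s by (intro diff_right_mono mult_left_mono) auto
    also have "\<dots> = (pi * \<omega> / 2) * ((1 + a) * y - (exp y - 1))"
    proof -
      have qy: "q - 1 = y / l" using l by (simp add: q_def y_def field_simps)
      have E: "(\<tau> + s / 2) * (y / l) = (pi * \<omega> / 2) * ((1 + a) * y)"
        unfolding a_def using s l om by (simp add: s_eq field_simps)
      show ?thesis unfolding qy v_eq E by (simp add: field_simps)
    qed
    also have "\<dots> \<le> (pi * \<omega> / 2) * (51/100 * a^2)"
      using om by (intro mult_left_mono legendre_exp_bound[OF a]) auto
    also have "\<dots> = A"
      unfolding a_def A_def using s l om by (simp add: s_eq field_simps power2_eq_square)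
    finally have 2: "\<tau> * ln q \<le> A + X t / 2" by simp
    have "ln v powr \<tau> = l powr \<tau> * q powr \<tau>" using l q lv by (simp add: q_def powr_mult[symmetric])
    also have "q powr \<tau> = exp (\<tau> * ln q)" using q by (simp add: powr_def)
    also have "\<dots> \<le> exp (A + X t / 2)" using 2 by simp
    finally have 3: "ln v powr \<tau> \<le> l powr \<tau> * exp (A + X t / 2)" by (simp add: mult_left_mono)
    have "norm (xi_integrand z' (w t)) \<le> (l powr \<tau> * exp (A + X t / 2)) * (exp (Re (g 1)) * (exp (- X t) * B t) * 30)"
      using B_ge_1[of t] t by (intro order_trans[OF 1] mult_right_mono 3) auto
    also have "\<dots> = (30 * exp (Re (g 1)) * l powr \<tau> * exp A) * ((exp (X t / 2) * exp (- X t)) * B t)"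
      by (simp add: exp_add)
    also have "exp (X t / 2) * exp (- X t) = exp (- X t / 2)" by (simp add: exp_add[symmetric])
    finally show ?thesis by (simp only: J2_def)
  qed
  define M where "M = 30 * exp (Re (g 1)) * l powr \<tau> * exp A"
  define I where "I = (LINT t:{0<..}|lborel. J t)"
  have M: "M \<ge> 0" by (simp add: M_def)
  have "norm (ray_integral c z') \<le> (LINT t|lborel. norm (indicator {0<..} t *\<^sub>R xi_integrand z' (w t)))"
    unfolding ray_integral_open set_lebesgue_integral_def by (rule integral_norm_bound)
  also have "\<dots> \<le> (LINT t|lborel. M * (indicator {0<..} t *\<^sub>R J2 t))"
  proof (rule integral_mono)
    show "integrable lborel (\<lambda>t. norm (indicator {0<..} t *\<^sub>R xi_integrand z' (w t)))"
      using set_integrable_ray[OF zp] unfolding set_integrable_def by (rule integrable_norm)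
    show "integrable lborel (\<lambda>t. M * (indicator {0<..} t *\<^sub>R J2 t))"
      using half_exponent_integral(1) unfolding set_integrable_def by (rule integrable_mult_right)
    fix t :: real
    show "norm (indicator {0<..} t *\<^sub>R xi_integrand z' (w t)) \<le> M * (indicator {0<..} t *\<^sub>R J2 t)"
      using pw[of t] by (cases "t > 0") (auto simp: indicator_def M_def)
  qed
  also have "\<dots> = M * (LINT t:{0<..}|lborel. J2 t)" by (simp add: set_lebesgue_integral_def)
  also have "\<dots> \<le> M * (8 * I)" unfolding I_def using half_exponent_integral(2) M by (intro mult_left_mono) auto
  finally have up: "norm (ray_integral c z') \<le> M * (8 * I)" .
  have "6 * I \<le> norm (exp (- g 1) * ray_integral c z)"
    using ray_integral_Re_ge complex_Re_le_cmod[of "exp (- g 1) * ray_integral c z"] unfolding I_def by linarith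
  also have "\<dots> = exp (- Re (g 1)) * norm (ray_integral c z)" by (simp add: norm_mult)
  finally have "exp (Re (g 1)) * (6 * I) \<le> exp (Re (g 1)) * (exp (- Re (g 1)) * norm (ray_integral c z))"
    by (intro mult_left_mono) auto
  hence low: "exp (Re (g 1)) * (6 * I) \<le> norm (ray_integral c z)" by (simp add: mult.assoc[symmetric] exp_add[symmetric])
  have "M * (8 * I) = l powr \<tau> * exp A * 40 * (exp (Re (g 1)) * (6 * I))" by (simp add: M_def)
  also have "\<dots> \<le> l powr \<tau> * exp A * 40 * norm (ray_integral c z)"
    by (intro mult_left_mono low) auto
  finally have "M * (8 * I) \<le> l powr \<tau> * exp A * 40 * norm (ray_integral c z)" .
  with up have fin: "norm (ray_integral c z') \<le> l powr \<tau> * exp A * 40 * norm (ray_integral c z)" by (rule order_trans)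
  have r: "ray_integral 1 u = c * ray_integral c u" if "Re u > 0" for u
    using ray_integral_rotate[OF sector_1_c that] by simp
  have "norm c * norm (ray_integral c z') \<le> norm c * (l powr \<tau> * exp A * 40 * norm (ray_integral c z))"
    by (intro mult_left_mono fin) auto
  thus ?thesis unfolding r[OF zp] r[OF z_pos] norm_mult A_def l_def by (simp add: mult_ac)
qed

end

section \<open>The logarithm of the moment function\<close>

lemma exp_39_le: "exp (39::real) \<le> 89 * 10 ^ 15"
proof -
  have "exp (39::real) = exp 1 ^ 39" by (simp add: exp_of_nat_mult[symmetric])
  also have "\<dots> \<le> (272/100) ^ 39" using e_less_272 by (intro power_mono) auto
  also have "\<dots> \<le> 89 * 10 ^ 15" by (simp add: power_divide)
  finally show ?thesis .
qed

text \<open>The constants fit because \<open>pi * exp 39 * 39\<close> is about \<open>1.1 * 10^19\<close>.\<close>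

lemma real_saddle_exists:
  fixes s :: real
  assumes s: "s \<ge> 16 * 10 ^ 18"
  obtains \<omega> where "\<omega> > 1" "s = pi * \<omega> * ln \<omega>" "ln \<omega> \<ge> 39"
proof -
  have s0: "s \<ge> 3" using s by simp
  have "\<exists>x\<ge>1. x \<le> s \<and> pi * x * ln x = s"
  proof (rule IVT')
    show "pi * 1 * ln 1 \<le> s" using s0 by simp
    have "exp (1::real) \<le> s" using exp_le s0 by linarith
    hence "ln s \<ge> 1" using s0 by (subst ln_ge_iff) auto
    hence "1 * s * 1 \<le> pi * s * ln s" using s0 pi_gt3 by (intro mult_mono) auto
    thus "s \<le> pi * s * ln s" by simp
    show "1 \<le> s" using s0 by simp
    show "continuous_on {1..s} (\<lambda>x. pi * x * ln x)" by (intro continuous_intros) auto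
  qed
  then obtain \<omega> where \<omega>: "\<omega> \<ge> 1" "pi * \<omega> * ln \<omega> = s" by blast
  have ge: "ln \<omega> \<ge> 39"
  proof (rule ccontr)
    assume "\<not> ln \<omega> \<ge> 39"
    hence l: "ln \<omega> < 39" by simp
    hence "exp (ln \<omega>) < exp 39" by (simp only: exp_less_cancel_iff)
    hence "\<omega> < exp 39" using \<omega> by simp
    hence "\<omega> \<le> 89 * 10 ^ 15" using exp_39_le by linarith
    hence "pi * \<omega> * ln \<omega> \<le> 3.15 * (89 * 10 ^ 15) * 39"
      using \<omega> l pi_approx by (intro mult_mono) auto
    thus False using \<omega> s by simp
  qed
  moreover have "\<omega> \<noteq> 1" using ge by auto
  ultimately show ?thesis using that[of \<omega>] \<omega> by auto
qed

text \<open>Brouwer's theorem for \<open>w \<mapsto> z / (pi * Ln w)\<close>. This map sends a small disc about the real saddle point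
  \<open>\<omega>\<close> to itself because a relative change of \<open>w\<close> changes \<open>Ln w\<close> by the same amount, which is small relative to
  \<open>ln \<omega> \<ge> 39\<close>.\<close>

lemma saddle_exists:
  fixes z :: complex
  assumes \<omega>: "\<omega> > 1" "s = pi * \<omega> * ln \<omega>" "ln \<omega> \<ge> 39" and z: "norm (z - of_real s) \<le> s / 1000"
  obtains w0 where "saddle z w0"
proof -
  define l where "l = ln \<omega>"
  have l: "l \<ge> 39" using \<omega> by (simp add: l_def)
  have s: "s = pi * \<omega> * l" "s > 0" using \<omega> l by (auto simp: l_def)
  have om: "\<omega> \<ge> 40"
  proof -
    have "\<omega> = exp l" using \<omega> by (simp add: l_def)
    thus ?thesis using exp_ge_add_one_self[of l] l by linarith
  qed
  define r where "r = \<omega> / 500"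
  have Lw: "norm (Ln w - of_real l) \<le> 1/250" "w \<notin> \<real>\<^sub>\<le>\<^sub>0" if w: "w \<in> cball (of_real \<omega>) r" for w :: complex
  proof -
    define x where "x = (w - of_real \<omega>) / of_real \<omega>"
    have nx: "norm x \<le> 1/500"
      using w om unfolding x_def r_def by (simp add: norm_divide dist_norm norm_minus_commute divide_le_eq)
    have "\<bar>Re x\<bar> \<le> 1/500" using abs_Re_le_cmod[of x] nx by linarith
    hence "Re (1 + x) > 0" by simp
    hence ne: "1 + x \<noteq> 0" by (metis less_irrefl zero_complex.sel(1))
    have we: "w = of_real \<omega> * (1 + x)" using om by (simp add: x_def field_simps)
    have "Ln w = of_real l + Ln (1 + x)"
      unfolding we using Ln_times_of_real[of \<omega> "1 + x"] ne om by (simp add: l_def Ln_of_real)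
    moreover have "norm (Ln (1 + x)) \<le> 2 * norm x" by (rule norm_Ln_le) (use nx in linarith)
    ultimately show "norm (Ln w - of_real l) \<le> 1/250" using nx by simp
    have "Re w = \<omega> * Re (1 + x)" unfolding we by simp
    hence "Re w > 0" using om \<open>Re (1 + x) > 0\<close> by simp
    thus "w \<notin> \<real>\<^sub>\<le>\<^sub>0" by (auto simp: complex_nonpos_Reals_iff)
  qed
  have nL: "norm (Ln w) \<ge> l - 1/250" if "w \<in> cball (of_real \<omega>) r" for w
    using Lw(1)[OF that] norm_triangle_ineq2[of "of_real l" "Ln w"] l by (simp add: norm_minus_commute)
  define T where "T = (\<lambda>w. z / (of_real pi * Ln w))"
  have Lnz: "Ln w \<noteq> 0" if "w \<in> cball (of_real \<omega>) r" for w
    using nL[OF that] l by auto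
  have cont: "continuous_on (cball (of_real \<omega>) r) T"
    unfolding T_def using Lnz Lw(2) by (intro continuous_intros) auto
  have self: "T w \<in> cball (of_real \<omega>) r" if w: "w \<in> cball (of_real \<omega>) r" for w
  proof -
    have "T w - of_real \<omega> = (z - of_real s + of_real (pi * \<omega>) * (of_real l - Ln w)) / (of_real pi * Ln w)"
      using Lnz[OF w] by (simp add: T_def s(1) field_simps)
    hence "norm (T w - of_real \<omega>) = norm (z - of_real s + of_real (pi * \<omega>) * (of_real l - Ln w)) / (pi * norm (Ln w))"
      by (simp add: norm_divide norm_mult)
    also have "\<dots> \<le> (s / 1000 + pi * \<omega> * (1/250)) / (pi * (l - 1/250))"
    proof (rule frac_le)
      have "norm (of_real (pi * \<omega>) * (of_real l - Ln w)) \<le> pi * \<omega> * (1/250)"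
      proof -
        have "norm (complex_of_real (pi * \<omega>)) = pi * \<omega>" using om by (simp only: norm_of_real) simp
        thus ?thesis unfolding norm_mult using Lw(1)[OF w] om by (intro mult_mono) (auto simp: norm_minus_commute)
      qed
      thus "norm (z - of_real s + of_real (pi * \<omega>) * (of_real l - Ln w)) \<le> s / 1000 + pi * \<omega> * (1/250)"
        using z norm_triangle_ineq[of "z - of_real s" "of_real (pi * \<omega>) * (of_real l - Ln w)"] by linarith
      show "pi * (l - 1/250) \<le> pi * norm (Ln w)" using nL[OF w] by (intro mult_left_mono) auto
      show "0 < pi * (l - 1/250)" using l by simp
      show "0 \<le> s / 1000 + pi * \<omega> * (1/250)" using s om by simp
    qed
    also have "\<dots> = \<omega> * ((l / 1000 + 1/250) / (l - 1/250))"
      using l by (simp add: s(1) field_simps)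
    also have "\<dots> \<le> \<omega> * (1/500)"
      using l om by (intro mult_left_mono) (auto simp: divide_le_eq)
    finally show ?thesis by (simp add: r_def dist_norm norm_minus_commute)
  qed
  obtain w0 where w0: "w0 \<in> cball (of_real \<omega>) r" "T w0 = w0"
    by (rule brouwer_ball[OF _ cont]) (use om self in \<open>auto simp: r_def\<close>)
  have "saddle z w0"
  proof
    have d: "\<bar>Re w0 - \<omega>\<bar> \<le> r" "\<bar>Im w0\<bar> \<le> r"
      using w0(1) abs_Re_le_cmod[of "w0 - of_real \<omega>"] abs_Im_le_cmod[of "w0 - of_real \<omega>"]
      by (auto simp: dist_norm norm_minus_commute)
    have "Re w0 \<ge> \<omega> - \<omega> / 500" "\<bar>Im w0\<bar> \<le> \<omega> / 500" using d unfolding r_def by linarith+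
    thus "in_sector (1/200) (w0 - 1)" using om by (auto simp: in_sector_def)
    have "\<bar>Re z - s\<bar> \<le> s / 1000" "\<bar>Im z\<bar> \<le> s / 1000"
      using z abs_Re_le_cmod[of "z - of_real s"] abs_Im_le_cmod[of "z - of_real s"] by auto
    hence "Re z \<ge> s - s / 1000" "\<bar>Im z\<bar> \<le> s / 1000" by linarith+
    thus "in_sector (1/200) z" using s(2) by (auto simp: in_sector_def)
    show "z = of_real pi * w0 * Ln w0" using w0(2) Lnz[OF w0(1)] by (simp add: T_def field_simps)
  qed
  thus ?thesis using that by blast
qed

lemma real_saddle:
  assumes \<omega>: "\<omega> > 1" "s = pi * \<omega> * ln \<omega>" "ln \<omega> \<ge> 39"
  shows "saddle (of_real s) (of_real \<omega>)"
proof
  show "in_sector (1/200) (of_real \<omega> - 1)" using \<omega> by (simp add: in_sector_def)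
  have "s > 0" using \<omega> by simp
  thus "in_sector (1/200) (of_real s)" by (simp add: in_sector_def)
  show "complex_of_real s = of_real pi * of_real \<omega> * Ln (of_real \<omega>)" using \<omega> by (simp add: Ln_of_real)
qed

text \<open>The function \<open>F\<close> is a logarithm of the quotient \<open>ray_integral 1 z / ray_integral 1 s\<close> minus a linear
  function. The linear function drops out of second differences, and its slope is chosen so that
  the real part of \<open>F\<close> is bounded above by a quantity of order \<open>\<rho>^2 / s\<close>.\<close>

lemma log_moment_exists:
  fixes s :: real
  assumes s: "s \<ge> 16 * 10 ^ 18"
  defines "\<rho> \<equiv> s / 1000"
  obtains F :: "complex \<Rightarrow> complex" and b :: complex where
    "F holomorphic_on ball (of_real s) \<rho>"
    "\<And>z. z \<in> ball (of_real s) \<rho> \<Longrightarrow> exp (F z) = ray_integral 1 z / ray_integral 1 (of_real s) * exp (- (b * (z - of_real s)))"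
    "\<And>z. z \<in> ball (of_real s) (\<rho> / 2) \<Longrightarrow> norm (F z) \<le> 2 * (262 / 10000 * \<rho>^2 / s)"
    "\<And>z. z \<in> ball (of_real s) \<rho> \<Longrightarrow> ray_integral 1 z \<noteq> 0"
proof -
  obtain \<omega> where \<omega>: "\<omega> > 1" "s = pi * \<omega> * ln \<omega>" "ln \<omega> \<ge> 39" using real_saddle_exists[OF s] by blast
  define l where "l = ln \<omega>"
  have l: "l \<ge> 39" using \<omega> by (simp add: l_def)
  have s0: "s > 0" using s by simp
  have \<rho>0: "\<rho> > 0" using s0 by (simp add: \<rho>_def)
  let ?N = "ray_integral 1"
  let ?D = "ball (complex_of_real s) \<rho>"
  have re: "Re z > 0" "\<bar>Re z - s\<bar> \<le> \<rho>" if "z \<in> ?D" for z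
  proof -
    show "\<bar>Re z - s\<bar> \<le> \<rho>" using that abs_Re_le_cmod[of "z - of_real s"] by (simp add: dist_norm norm_minus_commute)
    thus "Re z > 0" using s0 unfolding \<rho>_def by linarith
  qed
  have nz: "?N z \<noteq> 0" if z: "z \<in> ?D" for z
  proof -
    have "norm (z - of_real s) \<le> s / 1000" using z by (simp add: dist_norm norm_minus_commute \<rho>_def)
    then obtain w0 where "saddle z w0" using saddle_exists[OF \<omega>] by blast
    thus ?thesis by (rule saddle.ray_integral_nonzero)
  qed
  have holN: "?N holomorphic_on ?D"
    by (rule holomorphic_on_subset[OF holomorphic_ray_integral]) (use re in auto)
  have sD: "of_real s \<in> ?D" using \<rho>0 by simp
  obtain G where G: "G holomorphic_on ?D" "\<And>z. z \<in> ?D \<Longrightarrow> exp (G z) = ?N z"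
    using holomorphic_logarithm_exists[OF convex_ball open_ball holN nz sD] by metis
  define b where "b = complex_of_real (ln l)"
  define F where "F = (\<lambda>z. G z - G (of_real s) - b * (z - of_real s))"
  have holF: "F holomorphic_on ?D" unfolding F_def by (intro holomorphic_intros G)
  have expF: "exp (F z) = ?N z / ?N (of_real s) * exp (- (b * (z - of_real s)))" if "z \<in> ?D" for z
    unfolding F_def using G(2)[OF that] G(2)[OF sD] by (simp add: exp_diff exp_minus divide_inverse)
  define A where "A = 262 / 10000 * \<rho>^2 / s"
  have A: "A > 0" using \<rho>0 s0 by (simp add: A_def)
  have ReF: "Re (F z) \<le> A" if z: "z \<in> ?D" for z
  proof -
    define \<tau> where "\<tau> = Re z - s"
    have \<tau>: "\<bar>\<tau>\<bar> \<le> \<rho>" using re[OF z] by (simp add: \<tau>_def)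
    have "norm (?N z) \<le> ln \<omega> powr \<tau> * exp (51/50 * \<tau>^2 / (ln \<omega> * s)) * 40 * norm (?N (of_real s))"
      by (rule saddle.ray_integral_upper[OF real_saddle[OF \<omega>]]) (use \<tau> s0 in \<open>auto simp: \<tau>_def \<rho>_def\<close>)
    hence up: "norm (?N z) / norm (?N (of_real s)) \<le> l powr \<tau> * exp (51/50 * \<tau>^2 / (l * s)) * 40"
      using nz[OF sD] by (simp add: divide_le_eq l_def)
    have "exp (Re (F z)) = norm (?N z) / norm (?N (of_real s)) * exp (- (ln l * \<tau>))"
    proof -
      have "norm (exp (- (b * (z - of_real s)))) = exp (- (ln l * \<tau>))" by (simp add: b_def \<tau>_def)
      thus ?thesis by (simp only: norm_exp_eq_Re[symmetric] expF[OF z] norm_mult norm_divide)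
    qed
    also have "\<dots> \<le> (l powr \<tau> * exp (51/50 * \<tau>^2 / (l * s)) * 40) * exp (- (ln l * \<tau>))"
      by (intro mult_right_mono up) auto
    also have "\<dots> = exp (51/50 * \<tau>^2 / (l * s)) * 40"
      using l by (simp add: powr_def exp_minus mult_ac)
    (* 51/50/39 is less than 262/10000, and the constant 4 is negligible against \<rho>^2/s, which is at least 10^13. *)
    also have "\<dots> \<le> exp (51/50 * \<rho>^2 / (39 * s)) * exp 4"
    proof (intro mult_mono)
      have "\<tau>^2 \<le> \<rho>^2" using \<tau> by (simp add: abs_le_square_iff[symmetric] \<rho>0 less_imp_le)
      hence "51/50 * \<tau>^2 / (l * s) \<le> 51/50 * \<rho>^2 / (39 * s)"
        using l s0 by (intro frac_le mult_left_mono mult_right_mono) auto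
      thus "exp (51/50 * \<tau>^2 / (l * s)) \<le> exp (51/50 * \<rho>^2 / (39 * s))" by simp
      have "(40::real) \<le> (27/10) ^ 4" by (simp add: power_divide)
      also have "\<dots> \<le> exp 1 ^ 4" using exp_1_ge_27 by (intro power_mono) auto
      also have "\<dots> = exp 4" by (simp add: exp_of_nat_mult[symmetric])
      finally show "(40::real) \<le> exp 4" .
    qed auto
    also have "\<dots> = exp (51/50 * \<rho>^2 / (39 * s) + 4)" by (simp only: exp_add)
    also have "\<dots> \<le> exp A"
    proof -
      have "\<rho>^2 / s = s / 1000000" using s0 by (simp add: \<rho>_def power2_eq_square)
      moreover have "A = 262 / 10000 * (\<rho>^2 / s)" "51/50 * \<rho>^2 / (39 * s) = 51/50/39 * (\<rho>^2 / s)"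
        by (simp_all add: A_def)
      ultimately have "A = 262 / 10000 * (s / 1000000)" "51/50 * \<rho>^2 / (39 * s) = 51/50/39 * (s / 1000000)"
        by (simp_all only:)
      thus ?thesis using s by simp
    qed
    finally show ?thesis by simp
  qed
  have bound: "norm (F z) \<le> 2 * A" if z: "z \<in> ball (of_real s) (\<rho> / 2)" for z
  proof -
    have "norm (F z) \<le> 2 * A * (\<rho> / 2) / (\<rho> - \<rho> / 2)"
      by (rule Borel_Caratheodory[OF holF _ A ReF]) (use z \<rho>0 in \<open>auto simp: F_def dist_norm norm_minus_commute\<close>)
    thus ?thesis using \<rho>0 by simp
  qed
  show ?thesis by (rule that[OF holF expF bound[unfolded A_def] nz])
qed

lemma Ln_one_plus_inverse:
  fixes u :: complex and k :: real
  assumes k: "k \<ge> 10 ^ 6" and u: "norm (u - of_real k) \<le> k / 40000"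
  shows "norm (Ln (1 + 1 / u) - 1 / of_real k) \<le> 1 / (1000 * k)" "Re u > 0"
proof -
  have k0: "k > 0" using k by simp
  have "\<bar>Re u - k\<bar> \<le> k / 40000" using u abs_Re_le_cmod[of "u - of_real k"] by simp
  thus Re: "Re u > 0" using k0 by linarith
  have nu: "norm u \<ge> 999/1000 * k"
    using norm_triangle_ineq2[of "of_real k" "u"] u k0 by (simp add: norm_minus_commute)
  have u0: "u \<noteq> 0" using Re by auto
  have n1: "norm (1 / u) \<le> 2 / k"
    using nu k0 by (simp add: norm_divide divide_simps)
  have nlt: "norm (1 / u) \<le> 1/2" using n1 k k0 by (intro order_trans[OF n1]) (simp add: divide_le_eq)
  have "norm (Ln (1 + 1 / u) - 1 / u) \<le> norm (1 / u)^2 / (1 - norm (1 / u))"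
    by (rule Ln_approx_linear) (use nlt in linarith)
  also have "\<dots> \<le> (2 / k)^2 / (1/2)" using n1 nlt by (intro frac_le power_mono) auto
  also have "\<dots> = (8 / k) * (1 / k)" by (simp add: power2_eq_square)
  also have "\<dots> \<le> (1 / 10000) * (1 / k)" using k k0 by (intro mult_right_mono) (auto simp: divide_le_eq)
  finally have 1: "norm (Ln (1 + 1 / u) - 1 / u) \<le> (1 / 10000) * (1 / k)" .
  have "1 / u - 1 / of_real k = (of_real k - u) * (1 / u) * (1 / of_real k)"
    using u0 k0 by (simp add: field_simps)
  hence "norm (1 / u - 1 / of_real k) = norm (u - of_real k) * norm (1 / u) * (1 / k)"
    using k0 by (simp only: norm_mult norm_minus_commute[of u]) (simp add: norm_divide)
  also have "\<dots> \<le> (k / 40000) * (2 / k) * (1 / k)"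
    using u n1 k0 by (intro mult_mono) auto
  also have "\<dots> = (1 / 20000) * (1 / k)" using k0 by simp
  finally have 2: "norm (1 / u - 1 / of_real k) \<le> (1 / 20000) * (1 / k)" .
  have "norm (Ln (1 + 1 / u) - 1 / of_real k) \<le> (1 / 10000) * (1 / k) + (1 / 20000) * (1 / k)"
    using norm_triangle_ineq[of "Ln (1 + 1 / u) - 1 / u" "1 / u - 1 / of_real k"] 1 2 by simp
  also have "\<dots> = (3 / 20000) * (1 / k)" by (simp add: field_simps)
  also have "\<dots> \<le> (1 / 1000) * (1 / k)" using k0 by (intro mult_right_mono) auto
  finally show "norm (Ln (1 + 1 / u) - 1 / of_real k) \<le> 1 / (1000 * k)" by simp
qed

lemma xi_coeff_nonneg: "xi_coeff (int m) \<ge> 0"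
proof -
  have "0 \<le> (LINT u|lborel. indicator {0..} u *\<^sub>R (u ^ (2 * nat (int m)) * Phi u))"
    by (rule Bochner_Integration.integral_nonneg) (auto simp: indicator_def Phi_nonneg)
  thus ?thesis by (simp add: xi_coeff_def set_lebesgue_integral_def)
qed

text \<open>The quotient of factorials in \<open>a\<^sub>m\<^sub>+\<^sub>1 * a\<^sub>m\<^sub>-\<^sub>1 / a\<^sub>m\<^sup>2\<close> is the inverse of
  \<open>(1 + 1/m) * (1 + 1/(m - 1/2))\<close>, whose logarithm is close to \<open>2/m\<close>. The powers of 4 cancel, and the moments
  contribute a second difference of \<open>F\<close> with step 2, at most \<open>92/100 / k\<close>.\<close>

theorem xi_curvature:
  fixes k :: nat
  assumes k: "real k \<ge> 8 * 10 ^ 18"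
  defines "S \<equiv> real k / 50000"
  obtains h :: "complex \<Rightarrow> complex" where
    "h holomorphic_on ball (of_nat k) S"
    "\<And>z. z \<in> ball (of_nat k) S \<Longrightarrow> norm (h z - 2 / of_nat k) \<le> 95 / 100 / real k"
    "\<And>m. of_int m \<in> ball (of_nat k :: complex) S \<Longrightarrow> xi_coeff m > 0"
    "\<And>m. of_int m \<in> ball (of_nat k :: complex) S \<Longrightarrow>
       exp (- h (of_int m)) = of_real (xi_coeff (m + 1) * xi_coeff (m - 1) / (xi_coeff m)^2)"
proof -
  define s where "s = 2 * real k"
  define \<rho> where "\<rho> = s / 1000"
  have s: "s \<ge> 16 * 10 ^ 18" using k by (simp add: s_def)
  obtain F b where F: "F holomorphic_on ball (of_real s) \<rho>"
    "\<And>z. z \<in> ball (of_real s) \<rho> \<Longrightarrow> exp (F z) = ray_integral 1 z / ray_integral 1 (of_real s) * exp (- (b * (z - of_real s)))"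
    "\<And>z. z \<in> ball (of_real s) (\<rho> / 2) \<Longrightarrow> norm (F z) \<le> 2 * (262 / 10000 * \<rho>^2 / s)"
    "\<And>z. z \<in> ball (of_real s) \<rho> \<Longrightarrow> ray_integral 1 z \<noteq> 0"
    using log_moment_exists[OF s] unfolding \<rho>_def by metis
  have k0: "real k > 0" "real k \<ge> 10 ^ 6" using k by auto
  define D where "D = ball (of_nat k :: complex) S"
  have Dd: "norm (z - of_nat k) < S" if "z \<in> D" for z using that by (simp add: D_def dist_norm norm_minus_commute)
  have dd: "norm (2 * z - of_real s) < \<rho> / 50" if "z \<in> D" for z
  proof -
    have "2 * z - of_real s = 2 * (z - of_nat k)" by (simp add: s_def)
    hence "norm (2 * z - of_real s) = 2 * norm (z - of_nat k)" by (simp only: norm_mult) simp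
    thus ?thesis using Dd[OF that] by (simp add: S_def \<rho>_def s_def)
  qed
  \<comment> \<open>The bound for \<open>F\<close> holds within \<open>\<rho> / 2\<close> of \<open>s\<close>, and \<open>2 * z\<close> stays within \<open>\<rho> / 50\<close> of \<open>s\<close>.\<close>
  have sub: "ball (2 * z) (48/100 * \<rho>) \<subseteq> ball (of_real s) (\<rho> / 2)" if "z \<in> D" for z
  proof
    fix v assume "v \<in> ball (2 * z) (48/100 * \<rho>)"
    hence "norm (v - 2 * z) < 48/100 * \<rho>" by (simp add: dist_norm norm_minus_commute)
    hence "norm (v - of_real s) < \<rho> / 2"
      using norm_triangle_ineq[of "v - 2 * z" "2 * z - of_real s"] dd[OF that] by simp
    thus "v \<in> ball (of_real s) (\<rho> / 2)" by (simp add: dist_norm norm_minus_commute)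
  qed
  have sub2: "ball (of_real s :: complex) (\<rho> / 2) \<subseteq> ball (of_real s) \<rho>"
    using s by (intro subset_ball) (simp add: \<rho>_def)
  have big: "\<rho> \<ge> 10 ^ 10" using s by (simp add: \<rho>_def)
  have pts: "2 * z + 2 \<in> ball (of_real s) \<rho>" "2 * z - 2 \<in> ball (of_real s) \<rho>" "2 * z \<in> ball (of_real s) \<rho>" if "z \<in> D" for z
  proof -
    have in_ball: "v \<in> ball (of_real s) \<rho>" if "norm (v - 2 * z) < 48/100 * \<rho>" for v
    proof -
      have "v \<in> ball (2 * z) (48/100 * \<rho>)" using that by (simp add: dist_norm norm_minus_commute)
      thus ?thesis using sub[OF \<open>z \<in> D\<close>] sub2 by blast
    qed
    show "2 * z + 2 \<in> ball (of_real s) \<rho>" "2 * z - 2 \<in> ball (of_real s) \<rho>" "2 * z \<in> ball (of_real s) \<rho>"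
      by (rule in_ball; use big in simp)+
  qed
  define h where "h = (\<lambda>z. Ln (1 + 1 / z) + Ln (1 + 1 / (z - 1/2)) - (F (2 * z + 2) - 2 * F (2 * z) + F (2 * z - 2)))"
  have u: "norm (z - of_real (real k)) \<le> real k / 40000" "norm ((z - 1/2) - of_real (real k)) \<le> real k / 40000" if "z \<in> D" for z
  proof -
    show "norm (z - of_real (real k)) \<le> real k / 40000" using Dd[OF that] by (simp add: S_def)
    have "norm ((z - 1/2) - of_nat k) \<le> norm (z - of_nat k) + norm (1/2 :: complex)"
      using norm_triangle_ineq4[of "z - of_nat k" "1/2"] by (simp add: algebra_simps)
    also have "\<dots> \<le> real k / 40000" using Dd[OF that] k0 by (simp add: S_def)
    finally show "norm ((z - 1/2) - of_real (real k)) \<le> real k / 40000" by simp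
  qed
  have L: "norm (Ln (1 + 1 / z) - 1 / of_real (real k)) \<le> 1 / (1000 * real k)"
     "norm (Ln (1 + 1 / (z - 1/2)) - 1 / of_real (real k)) \<le> 1 / (1000 * real k)"
     "Re z > 0" "Re (z - 1/2) > 0" if "z \<in> D" for z
    using Ln_one_plus_inverse[OF k0(2) u(1)[OF that]] Ln_one_plus_inverse[OF k0(2) u(2)[OF that]] by auto
  have np: "1 + 1 / v \<notin> \<real>\<^sub>\<le>\<^sub>0" "v \<noteq> 0" if "Re v > 0" for v :: complex
  proof -
    show "v \<noteq> 0" using that by auto
    have "in_sector (\<bar>Im v\<bar> / Re v) v" using that by (simp add: in_sector_def)
    hence "Re (inverse v) > 0" using sector_inverse[of _ v] by (simp only: in_sector_def) blast
    thus "1 + 1 / v \<notin> \<real>\<^sub>\<le>\<^sub>0" by (auto simp: complex_nonpos_Reals_iff inverse_eq_divide)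
  qed
  have holh: "h holomorphic_on D"
  proof -
    have c: "(\<lambda>z. F (2 * z + 2)) holomorphic_on D" "(\<lambda>z. F (2 * z)) holomorphic_on D" "(\<lambda>z. F (2 * z - 2)) holomorphic_on D"
      using pts by (auto intro!: holomorphic_on_compose_gen[OF _ F(1), unfolded o_def] holomorphic_intros)
    have z0: "z \<noteq> 0" "z - 1/2 \<noteq> 0" "1 + 1 / z \<notin> \<real>\<^sub>\<le>\<^sub>0" "1 + 1 / (z - 1/2) \<notin> \<real>\<^sub>\<le>\<^sub>0" if "z \<in> D" for z
      using np[OF L(3)[OF that]] np[OF L(4)[OF that]] by auto
    show ?thesis unfolding h_def by (intro holomorphic_intros c z0)
  qed
  have hb: "norm (h z - 2 / of_nat k) \<le> 95 / 100 / real k" if z: "z \<in> D" for z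
  proof -
    define B where "B = 2 * (262 / 10000 * \<rho>^2 / s)"
    have "norm (F (2 * z + 2) - 2 * F (2 * z) + F (2 * z - 2)) \<le> 2 * (norm (2::complex))^2 * B / ((479/1000 * \<rho>)^2 - (norm (2::complex))^2)"
    proof (rule second_difference_bound)
      show "F holomorphic_on ball (2 * z) (48/100 * \<rho>)"
        by (rule holomorphic_on_subset[OF F(1)]) (use sub[OF z] sub2 in blast)
      show "norm (F x) \<le> B" if "x \<in> ball (2 * z) (48/100 * \<rho>)" for x
        unfolding B_def using F(3) sub[OF z] that by blast
    qed (use big in auto)
    also have "\<dots> = 8 * B / ((479/1000 * \<rho>)^2 - 4)" by simp
    also have "\<dots> \<le> 8 * B / (2294 / 10000 * \<rho>^2)"
    proof (rule divide_left_mono)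
      have r2: "\<rho>^2 \<ge> (10^10)^2" using big by (intro power_mono) auto
      show "2294 / 10000 * \<rho>^2 \<le> (479/1000 * \<rho>)^2 - 4"
        using r2 by (simp add: power_mult_distrib power_divide)
      thus "0 < ((479/1000 * \<rho>)^2 - 4) * (2294 / 10000 * \<rho>^2)" using r2 by (intro mult_pos_pos) auto
      show "0 \<le> 8 * B" using s by (simp add: B_def)
    qed
    also have "\<dots> = (16 * 262 / 2294) * (1 / s)" using big by (simp add: B_def field_simps)
    also have "\<dots> \<le> 92 / 100 / real k" using k0 by (simp add: s_def field_simps)
    finally have 1: "norm (F (2 * z + 2) - 2 * F (2 * z) + F (2 * z - 2)) \<le> 92 / 100 / real k" .
    have "h z - 2 / of_nat k = (Ln (1 + 1 / z) - 1 / of_real (real k)) + (Ln (1 + 1 / (z - 1/2)) - 1 / of_real (real k))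
        - (F (2 * z + 2) - 2 * F (2 * z) + F (2 * z - 2))"
      by (simp add: h_def algebra_simps)
    also have "norm \<dots> \<le> (1 / (1000 * real k) + 1 / (1000 * real k)) + 92 / 100 / real k"
      by (intro order_trans[OF norm_triangle_ineq4] add_mono order_trans[OF norm_triangle_ineq] L z 1)
    also have "\<dots> \<le> 95 / 100 / real k" using k0 by (simp add: field_simps)
    finally show ?thesis .
  qed
  have mnat: "\<exists>n. m = int n \<and> n \<ge> 2" if "of_int m \<in> D" for m
  proof -
    have "\<bar>of_int m - real k\<bar> < S"
      using Dd[OF that] by (metis norm_of_int of_int_diff of_int_of_nat_eq of_int_abs)
    moreover have "real k \<ge> 1000000" using k by simp
    ultimately have "real_of_int m \<ge> 2" unfolding S_def by linarith
    hence "m \<ge> 2" by linarith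
    thus ?thesis by (intro exI[of _ "nat m"]) auto
  qed
  have coeff: "complex_of_real (xi_coeff (int n)) = ray_integral 1 (of_nat (2 * n)) / (4 ^ (2 * n + 1) * fact (2 * n))" if "n \<ge> 1" for n
    using xi_coeff_eq_ray_integral[of n] that by simp
  have pos: "xi_coeff m > 0" if m: "of_int m \<in> D" for m
  proof -
    obtain n where n: "m = int n" "n \<ge> 2" using mnat[OF m] by blast
    have "ray_integral 1 (of_nat (2 * n)) \<noteq> 0" using F(4)[OF pts(3)[OF m]] n by simp
    hence "complex_of_real (xi_coeff m) \<noteq> 0" using coeff[of n] n by simp
    thus ?thesis using xi_coeff_nonneg[of n] n by (simp add: less_le)
  qed
  have exph: "exp (- h (of_int m)) = of_real (xi_coeff (m + 1) * xi_coeff (m - 1) / (xi_coeff m)^2)"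
    if m: "of_int m \<in> D" for m
  proof -
    obtain n where n: "m = int n" "n \<ge> 2" using mnat[OF m] by blast
    define x where "x = (of_nat n :: complex)"
    have xm: "of_int m = x" by (simp add: n x_def)
    define N where "N = ray_integral 1"
    have xD: "x \<in> D" using m by (simp add: xm)
    have nz: "N (2 * x) \<noteq> 0" "N (of_real s) \<noteq> 0"
      using F(4)[OF pts(3)[OF xD]] F(4)[of "of_real s"] s by (auto simp: N_def \<rho>_def)
    have x0: "x \<noteq> 0" "2 * x - 1 \<noteq> 0" "x - 1/2 \<noteq> 0" "x + 1 \<noteq> 0" "2 * x + 1 \<noteq> 0"
    proof -
      have "Re x \<ge> 2" using n by (simp add: x_def)
      hence "Re x > 0" "Re (2 * x - 1) > 0" "Re (x - 1/2) > 0" "Re (x + 1) > 0" "Re (2 * x + 1) > 0" by auto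
      thus "x \<noteq> 0" "2 * x - 1 \<noteq> 0" "x - 1/2 \<noteq> 0" "x + 1 \<noteq> 0" "2 * x + 1 \<noteq> 0"
        by (metis less_irrefl zero_complex.sel(1))+
    qed
    have eF: "exp (F (2 * x + 2) - 2 * F (2 * x) + F (2 * x - 2)) = N (2 * x + 2) * N (2 * x - 2) / (N (2 * x))^2"
    proof -
      define E where "E = (\<lambda>y. exp (- (b * (y - of_real s))))"
      have EE: "E (2 * x + 2) * E (2 * x - 2) = (E (2 * x))^2"
        unfolding E_def power2_eq_square exp_add[symmetric] by (rule arg_cong[of _ _ exp]) (simp add: algebra_simps)
      have E0: "E y \<noteq> 0" for y by (simp add: E_def)
      have "F (2 * x + 2) - 2 * F (2 * x) + F (2 * x - 2) = (F (2 * x + 2) + F (2 * x - 2)) - (F (2 * x) + F (2 * x))" by simp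
      hence "exp (F (2 * x + 2) - 2 * F (2 * x) + F (2 * x - 2)) = (exp (F (2 * x + 2)) * exp (F (2 * x - 2))) / (exp (F (2 * x)) * exp (F (2 * x)))"
        by (simp only: exp_add exp_diff)
      also have "\<dots> = (N (2 * x + 2) / N (of_real s) * E (2 * x + 2) * (N (2 * x - 2) / N (of_real s) * E (2 * x - 2)))
          / (N (2 * x) / N (of_real s) * E (2 * x) * (N (2 * x) / N (of_real s) * E (2 * x)))"
        unfolding N_def E_def F(2)[OF pts(1)[OF xD]] F(2)[OF pts(2)[OF xD]] F(2)[OF pts(3)[OF xD]] ..
      also have "\<dots> = N (2 * x + 2) * N (2 * x - 2) * (E (2 * x + 2) * E (2 * x - 2)) / ((N (2 * x))^2 * (E (2 * x))^2)"
        using nz by (simp add: field_simps power2_eq_square)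
      also have "\<dots> = N (2 * x + 2) * N (2 * x - 2) / (N (2 * x))^2"
        unfolding EE using E0[of "2 * x"] by simp
      finally show ?thesis .
    qed
    have eL: "exp (Ln (1 + 1 / x)) = (x + 1) / x" "exp (Ln (1 + 1 / (x - 1/2))) = (2 * x + 1) / (2 * x - 1)"
    proof -
      have a: "1 + 1 / x = (x + 1) / x" "1 + 1 / (x - 1/2) = (2 * x + 1) / (2 * x - 1)"
        using x0 by (simp_all add: field_simps)
      show "exp (Ln (1 + 1 / x)) = (x + 1) / x" "exp (Ln (1 + 1 / (x - 1/2))) = (2 * x + 1) / (2 * x - 1)"
        unfolding a using x0 by (simp_all add: exp_Ln)
    qed
    have "- h x = (F (2 * x + 2) - 2 * F (2 * x) + F (2 * x - 2)) - (Ln (1 + 1 / x) + Ln (1 + 1 / (x - 1/2)))"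
      by (simp add: h_def)
    hence lhs: "exp (- h x) = N (2 * x + 2) * N (2 * x - 2) / (N (2 * x))^2 / ((x + 1) / x * ((2 * x + 1) / (2 * x - 1)))"
      by (simp only: exp_diff[of "F (2 * x + 2) - 2 * F (2 * x) + F (2 * x - 2)"] exp_add[of "Ln (1 + 1 / x)"] eF eL)
    obtain j where j: "n = Suc j" "j \<ge> 1" using n by (cases n) auto
    have xj: "x = of_nat j + 1" by (simp add: x_def j)
    define f where "f = (fact (2 * j) :: complex)"
    have f0: "f \<noteq> 0" by (simp add: f_def)
    have fact2: "fact (2 * Suc i) = (2 * of_nat i + 2) * (2 * of_nat i + 1) * (fact (2 * i) :: complex)" for i
    proof -
      have "2 * Suc i = Suc (Suc (2 * i))" by simp
      hence "(fact (2 * Suc i) :: complex) = of_nat (Suc (Suc (2 * i))) * (of_nat (Suc (2 * i)) * fact (2 * i))"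
        by (simp only: fact_Suc)
      moreover have "of_nat (Suc (Suc (2 * i))) = (2 * of_nat i + 2 :: complex)" "of_nat (Suc (2 * i)) = (2 * of_nat i + 1 :: complex)"
        by simp_all
      ultimately show ?thesis by (simp only: mult.assoc)
    qed
    have fn: "fact (2 * n) = 2 * x * (2 * x - 1) * f"
    proof -
      have "2 * x = 2 * of_nat j + 2" "2 * x - 1 = 2 * of_nat j + 1" by (simp_all add: xj)
      thus ?thesis using fact2[of j] by (simp only: j(1) f_def)
    qed
    have fn1: "fact (2 * (n + 1)) = 2 * (x + 1) * (2 * x + 1) * (2 * x * (2 * x - 1) * f)"
    proof -
      have "2 * of_nat n + 2 = 2 * (x + 1)" by (simp add: x_def)
      thus ?thesis using fact2[of n] by (simp only: fn x_def[symmetric] Suc_eq_plus1)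
    qed
    note f1 = fn fn1
    have c0: "complex_of_real (xi_coeff m) = N (2 * x) / (4 ^ (2 * n + 1) * (2 * x * (2 * x - 1) * f))"
    proof -
      have "complex_of_nat (2 * n) = 2 * x" by (simp add: x_def)
      moreover have "complex_of_real (xi_coeff (int n)) = ray_integral 1 (of_nat (2 * n)) / (4 ^ (2 * n + 1) * fact (2 * n))"
        by (rule coeff) (use n in simp)
      ultimately show ?thesis by (simp only: n(1) fn N_def)
    qed
    have c1: "complex_of_real (xi_coeff (m + 1)) = N (2 * x + 2) / (4 ^ (2 * n + 1) * 16 * (2 * (x + 1) * (2 * x + 1) * (2 * x * (2 * x - 1) * f)))"
    proof -
      have "m + 1 = int (n + 1)" "complex_of_nat (2 * (n + 1)) = 2 * x + 2" "(4::complex) ^ (2 * (n + 1) + 1) = 4 ^ (2 * n + 1) * 16"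
        by (simp_all add: n x_def)
      thus ?thesis using coeff[of "n + 1"] by (simp only: f1 N_def)
    qed
    have c2: "complex_of_real (xi_coeff (m - 1)) = N (2 * x - 2) / (4 ^ (2 * n + 1) / 16 * f)"
    proof -
      have "m - 1 = int j" "complex_of_nat (2 * j) = 2 * x - 2" "(4::complex) ^ (2 * j + 1) = 4 ^ (2 * n + 1) / 16"
        by (simp_all add: n j xj)
      thus ?thesis using coeff[OF j(2)] by (simp only: f_def N_def)
    qed
    have alg: "Np * Nm / N0^2 / (y1 / y * (y2 / y3))
      = (Np / (q * 16 * (2 * y1 * y2 * (2 * y * y3 * f)))) * (Nm / (q / 16 * f)) / (N0 / (q * (2 * y * y3 * f)))^2"
      if "y \<noteq> 0" "y1 \<noteq> 0" "y2 \<noteq> 0" "y3 \<noteq> 0" "q \<noteq> 0" "f \<noteq> 0" "N0 \<noteq> 0" for Np Nm N0 y y1 y2 y3 q f :: complex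
      using that by (simp add: power2_eq_square mult_ac)
    have "complex_of_real (xi_coeff (m + 1) * xi_coeff (m - 1) / (xi_coeff m)^2)
       = of_real (xi_coeff (m + 1)) * of_real (xi_coeff (m - 1)) / (of_real (xi_coeff m))^2" by simp
    also have "\<dots> = exp (- h x)" unfolding lhs c0 c1 c2
      by (rule alg[symmetric]) (use x0 f0 nz in auto)
    finally show ?thesis by (simp only: xm)
  qed
  show ?thesis by (rule that[OF holh[unfolded D_def] hb[unfolded D_def] pos[unfolded D_def] exph[unfolded D_def]])
qed

theorem theorem1p1:
  fixes r k :: nat
  assumes "r \<ge> 2" and "k \<ge> 10 ^ 18 * r ^ 3"
  shows "toeplitz_det r k > 0"
proof -
  have "real (10 ^ 18 * r ^ 3) \<le> real k" using assms(2) by (rule of_nat_mono)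
  hence k: "10 ^ 18 * real r ^ 3 \<le> real k" by simp
  have "(2::real) ^ 3 \<le> real r ^ 3" using assms(1) by (intro power_mono) auto
  hence r3: "8 \<le> real r ^ 3" by simp
  hence k8: "real k \<ge> 8 * 10 ^ 18" using k by simp
  have k13: "real k \<ge> 10000000000000 * real r ^ 3" using k r3 by simp
  obtain h where h: "h holomorphic_on ball (of_nat k) (real k / 50000)"
    "\<And>z. z \<in> ball (of_nat k) (real k / 50000) \<Longrightarrow> norm (h z - 2 / of_nat k) \<le> 95 / 100 / real k"
    "\<And>m. of_int m \<in> ball (of_nat k :: complex) (real k / 50000) \<Longrightarrow> xi_coeff m > 0"
    "\<And>m. of_int m \<in> ball (of_nat k :: complex) (real k / 50000) \<Longrightarrow>
       exp (- h (of_int m)) = of_real (xi_coeff (m + 1) * xi_coeff (m - 1) / (xi_coeff m)^2)"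
    using xi_curvature[OF k8] by metis
  have "Toeplitz xi_coeff r (int k) > 0"
    by (rule Toeplitz_pos_of_slowly_varying_curvature[OF assms(1) k13 h])
  thus ?thesis by (simp add: Toeplitz_def toeplitz_det_def)
qed

end
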